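(* Let $r,s\ge 0$, let $\mathbf k=(k_1,\dots,k_r)$ be discrete variables and $\mathbf y=(y_1,\dots,y_s)$ continuous variables. (i) Let $n$ be a discrete variable and let $F(n,\mathbf k,\mathbf y)$ be a proper-hypergeometric term or, more generally, a holonomic hypergeometric term in $(\mathbf k,\mathbf y)$ and $n$. Then there exist a nonzero linear ordinary recurrence operator $P(N,n)$ with polynomial coefficients (that is, $P(N,n)=\sum_{l=0}^{L}p_l(n)N^l$ with each $p_l$ a polynomial in $n$, not depending on $\mathbf k,\mathbf y$, not all $p_l$ zero) and rational functions $R_1,\dots,R_r,S_1,\dots,S_s$ of $(n,\mathbf k,\mathbf y)$ such that $$P(N,n)F=\sum_{i=1}^r\Delta_{k_i}(R_iF)+\sum_{j=1}^sD_{y_j}(S_jF).$$ (ii) Let $x$ be a continuous variable and let $F(x,\mathbf k,\mathbf y)$ be a proper-hypergeometric term or, more generally, a holonomic hypergeometric term in $(\mathbf k,\mathbf y)$ and $x$. Then there exist a nonzero linear ordinary differential operator $P(D_x,x)$ with polynomial coefficients (that is, $P(D_x,x)=\sum_{l=0}^{L}p_l(x)D_x^l$ with each $p_l$ a polynomial in $x$, not depending on $\mathbf k,\mathbf y$, not all $p_l$ zero) and rational functions $R_1,\dots,R_r,S_1,\dots,S_s$ of $(x,\mathbf k,\mathbf y)$ such that $$P(D_x,x)F=\sum_{i=1}^r\Delta_{k_i}(R_iF)+\sum_{j=1}^sD_{y_j}(S_jF).$$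
   Context: Operators: $K_i$ is the forward shift $k_i\mapsto k_i+1$ (all other variables fixed), $\Delta_{k_i}=K_i-1$, $N$ is the forward shift $n\mapsto n+1$, $D_{y_j}=\partial/\partial y_j$, $D_x=\partial/\partial x$. Hypergeometric term: a function $F$ of finitely many discrete and continuous variables is a hypergeometric term if, for each discrete variable with forward shift $K$, the quotient $KF/F$ is a rational function of all the variables, and, for each continuous variable $v$, the quotient $(\partial F/\partial v)/F$ is a rational function of all the variables. Holonomic: a function $F$ of $p$ discrete variables $m_1,\dots,m_p$ and $q$ continuous variables $v_1,\dots,v_q$ is holonomic (in the sense of Zeilberger's holonomic systems approach) if its (formal, possibly bilateral) generating function $\sum_{m}F(m,v)z_1^{m_1}\cdots z_p^{m_p}$ is holonomic in $(z,v)$, i.e. the left module it generates over the Weyl algebra in the $p+q$ variables $z_1,\dots,z_p,v_1,\dots,v_q$ is zero or has the minimal possible Bernstein dimension $p+q$. A holonomic hypergeometric term is a hypergeometric term that is holonomic. Proper-hypergeometric terms are a class of holonomic hypergeometric terms; for purely discrete variables $(n,\mathbf k)$ they are the functions of the form $$F(n,\mathbf k)=\frac{\prod (a_in+\mathbf b_i\cdot\mathbf k+c_i)!}{\prod (u_in+\mathbf v_i\cdot\mathbf k+w_i)!}\,Q(n,\mathbf k)\,\boldsymbol\xi^{\mathbf k},$$ with finite products, where the $a_i,u_i$ are specific integers, $\mathbf b_i,\mathbf v_i$ are vectors of specific integers, the $c_i,w_i$ are complex numbers that may depend on additional parameters, $Q$ is a polynomial, $\boldsymbol\xi$ is a vector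 of parameters, $\boldsymbol\xi^{\mathbf k}=\prod_i\xi_i^{k_i}$, and $z!=\Gamma(z+1)$. *)

theory Defs
  imports
    "HOL-Analysis.Analysis"
    "HOL-Library.Poly_Mapping"
    "HOL-Library.Function_Algebras"
    "HOL-Computational_Algebra.Polynomial"
begin

section \<open>Functions of discrete and continuous variables\<close>

text \<open>
  A function \<open>F m v\<close> of \<open>p\<close> discrete variables \<open>m 0, \<dots>, m (p - 1)\<close>, ranging over the
  integers, and \<open>q\<close> continuous variables \<open>v 0, \<dots>, v (q - 1)\<close>, the tuple \<open>v\<close> ranging over an
  open set \<open>U\<close> of the \<open>q\<close>-dimensional complex space. Tuples are extensional functions, so
  \<open>p = 0\<close> or \<open>q = 0\<close> leaves exactly one tuple. Values of \<open>F\<close> outside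
  \<open>int_points p \<times> U\<close> are irrelevant.
\<close>

type_synonym dcfun = "(nat \<Rightarrow> int) \<Rightarrow> (nat \<Rightarrow> complex) \<Rightarrow> complex"

definition int_points :: "nat \<Rightarrow> (nat \<Rightarrow> int) set" where
  "int_points p = {..<p} \<rightarrow>\<^sub>E UNIV"

abbreviation complex_space :: "nat \<Rightarrow> (nat \<Rightarrow> complex) topology" where
  "complex_space q \<equiv> product_topology (\<lambda>_. euclidean) {..<q}"

text \<open>Holomorphy in several variables: jointly continuous and holomorphic in each variable.\<close>

definition holomorphic_several :: "nat \<Rightarrow> (nat \<Rightarrow> complex) set \<Rightarrow> ((nat \<Rightarrow> complex) \<Rightarrow> complex) \<Rightarrow> bool"
  where
  "holomorphic_several q U f \<longleftrightarrow>
     continuous_map (subtopology (complex_space q) U) euclidean f \<and>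
     (\<forall>v\<in>U. \<forall>j<q. (\<lambda>t. f (v(j := t))) field_differentiable at (v j))"

definition shift :: "nat \<Rightarrow> dcfun \<Rightarrow> dcfun" where
  "shift i F = (\<lambda>m v. F (m(i := m i + 1)) v)"

definition fdiff :: "nat \<Rightarrow> dcfun \<Rightarrow> dcfun" where
  "fdiff i F = (\<lambda>m v. shift i F m v - F m v)"

definition partial_deriv :: "nat \<Rightarrow> dcfun \<Rightarrow> dcfun" where
  "partial_deriv j F = (\<lambda>m v. deriv (\<lambda>t. F m (v(j := t))) (v j))"


section \<open>Polynomials and rational functions of all the variables\<close>

text \<open>
  In a polynomial in the \<open>p + q\<close> variables, the indeterminates \<open>0, \<dots>, p - 1\<close> stand for the
  discrete variables and \<open>p, \<dots>, p + q - 1\<close> for the continuous ones.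
\<close>

type_synonym cmpoly = "(nat \<Rightarrow>\<^sub>0 nat) \<Rightarrow>\<^sub>0 complex"

definition indets :: "cmpoly \<Rightarrow> nat set" where
  "indets P = (\<Union>\<alpha>\<in>Poly_Mapping.keys P. Poly_Mapping.keys \<alpha>)"

definition poly_value :: "nat \<Rightarrow> cmpoly \<Rightarrow> dcfun" where
  "poly_value p P m v =
     (\<Sum>\<alpha>\<in>Poly_Mapping.keys P. Poly_Mapping.lookup P \<alpha> *
        (\<Prod>i\<in>Poly_Mapping.keys \<alpha>. (if i < p then of_int (m i) else v (i - p)) ^ Poly_Mapping.lookup \<alpha> i))"

text \<open>
  A rational function is given by a fraction (numerator, denominator), not necessarily in lowest
  terms. Identities between rational multiples of a function are meant at the points where no
  denominator vanishes: a function is known to satisfy its defining rational first-order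
  relations only outside the zero set of a nonzero polynomial.
\<close>

type_synonym ratfun = "cmpoly \<times> cmpoly"

definition is_ratfun :: "nat \<Rightarrow> nat \<Rightarrow> ratfun \<Rightarrow> bool" where
  "is_ratfun p q R \<longleftrightarrow>
     indets (fst R) \<subseteq> {..<p + q} \<and> indets (snd R) \<subseteq> {..<p + q} \<and> snd R \<noteq> 0"

definition no_pole :: "nat \<Rightarrow> ratfun \<Rightarrow> (nat \<Rightarrow> int) \<Rightarrow> (nat \<Rightarrow> complex) \<Rightarrow> bool" where
  "no_pole p R m v \<longleftrightarrow> poly_value p (snd R) m v \<noteq> 0"

definition ratfun_mult :: "nat \<Rightarrow> ratfun \<Rightarrow> dcfun \<Rightarrow> dcfun" where
  "ratfun_mult p R F = (\<lambda>m v. poly_value p (fst R) m v / poly_value p (snd R) m v * F m v)"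


section \<open>Hypergeometric terms\<close>

text \<open>
  The relations ``\<open>(K F) / F\<close> is the rational function \<open>a / b\<close>'' and
  ``\<open>(\<partial>F/\<partial>v) / F\<close> is the rational function \<open>a / b\<close>'' are stated with denominators cleared,
  so that they also make sense where \<open>F\<close> or \<open>b\<close> vanishes.
\<close>

definition hypergeometric_term :: "nat \<Rightarrow> nat \<Rightarrow> (nat \<Rightarrow> complex) set \<Rightarrow> dcfun \<Rightarrow> bool" where
  "hypergeometric_term p q U F \<longleftrightarrow>
     (\<forall>m\<in>int_points p. holomorphic_several q U (F m)) \<and>
     (\<forall>i<p. \<exists>R. is_ratfun p q R \<and>
        (\<forall>m\<in>int_points p. \<forall>v\<in>U.
           poly_value p (snd R) m v * shift i F m v = poly_value p (fst R) m v * F m v)) \<and>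
     (\<forall>j<q. \<exists>R. is_ratfun p q R \<and>
        (\<forall>m\<in>int_points p. \<forall>v\<in>U.
           poly_value p (snd R) m v * partial_deriv j F m v = poly_value p (fst R) m v * F m v))"


section \<open>Holonomicity\<close>

text \<open>
  The formal bilateral generating function of \<open>F\<close>, the sum over all integer tuples \<open>m\<close> of
  \<open>F m v * z 0 powi m 0 * \<dots> * z (p - 1) powi m (p - 1)\<close>, is represented by its coefficients,
  i.e. by \<open>F\<close> itself, set to zero outside \<open>int_points p \<times> U\<close> in order that equality of
  functions is equality of generating functions. The generators \<open>Z i\<close>, \<open>DZ i\<close>, \<open>V j\<close>, \<open>DV j\<close> of
  the Weyl algebra act as multiplication by \<open>z i\<close>, \<open>\<partial>/\<partial>z i\<close>, multiplication by \<open>v j\<close> and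
  \<open>\<partial>/\<partial>v j\<close>.
\<close>

definition gen_fun :: "nat \<Rightarrow> (nat \<Rightarrow> complex) set \<Rightarrow> dcfun \<Rightarrow> dcfun" where
  "gen_fun p U F = (\<lambda>m v. if m \<in> int_points p \<and> v \<in> U then F m v else 0)"

datatype weyl_gen = Z nat | DZ nat | V nat | DV nat

fun weyl_act :: "nat \<Rightarrow> (nat \<Rightarrow> complex) set \<Rightarrow> weyl_gen \<Rightarrow> dcfun \<Rightarrow> dcfun" where
  "weyl_act p U (Z i) G = gen_fun p U (\<lambda>m v. G (m(i := m i - 1)) v)"
| "weyl_act p U (DZ i) G = gen_fun p U (\<lambda>m v. of_int (m i + 1) * G (m(i := m i + 1)) v)"
| "weyl_act p U (V j) G = gen_fun p U (\<lambda>m v. v j * G m v)"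
| "weyl_act p U (DV j) G = gen_fun p U (partial_deriv j G)"

definition weyl_gens :: "nat \<Rightarrow> nat \<Rightarrow> weyl_gen set" where
  "weyl_gens p q = Z ` {..<p} \<union> DZ ` {..<p} \<union> V ` {..<q} \<union> DV ` {..<q}"

global_interpretation dcfun: vector_space "\<lambda>(c :: complex) (G :: dcfun) m v. c * G m v"
  by unfold_locales (simp_all add: fun_eq_iff algebra_simps)

text \<open>
  The Bernstein filtration of the Weyl algebra: its \<open>\<nu>\<close>-th piece is spanned by the words of
  length at most \<open>\<nu>\<close> in the generators (equivalently, by the monomials of total degree at most
  \<open>\<nu>\<close>, as commutators of generators are constants). Applied to the generating function of \<open>F\<close>
  it yields a good filtration of the module that the latter generates, whose Bernstein
  dimension is hence the degree of the Hilbert polynomial of this filtration.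
\<close>

definition bernstein_piece :: "nat \<Rightarrow> nat \<Rightarrow> (nat \<Rightarrow> complex) set \<Rightarrow> dcfun \<Rightarrow> nat \<Rightarrow> dcfun set" where
  "bernstein_piece p q U F \<nu> =
     dcfun.span {foldr (weyl_act p U) w (gen_fun p U F) | w.
                   set w \<subseteq> weyl_gens p q \<and> length w \<le> \<nu>}"

definition weyl_module :: "nat \<Rightarrow> nat \<Rightarrow> (nat \<Rightarrow> complex) set \<Rightarrow> dcfun \<Rightarrow> dcfun set" where
  "weyl_module p q U F = (\<Union>\<nu>. bernstein_piece p q U F \<nu>)"

definition has_bernstein_dim :: "nat \<Rightarrow> nat \<Rightarrow> (nat \<Rightarrow> complex) set \<Rightarrow> dcfun \<Rightarrow> nat \<Rightarrow> bool" where
  "has_bernstein_dim p q U F d \<longleftrightarrow>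
     (\<exists>h :: real poly. h \<noteq> 0 \<and> degree h = d \<and>
        (\<forall>\<^sub>F \<nu> in sequentially. real (dcfun.dim (bernstein_piece p q U F \<nu>)) = poly h (real \<nu>)))"

definition holonomic :: "nat \<Rightarrow> nat \<Rightarrow> (nat \<Rightarrow> complex) set \<Rightarrow> dcfun \<Rightarrow> bool" where
  "holonomic p q U F \<longleftrightarrow> weyl_module p q U F = {0} \<or> has_bernstein_dim p q U F (p + q)"

definition holonomic_hypergeometric_term ::
    "nat \<Rightarrow> nat \<Rightarrow> (nat \<Rightarrow> complex) set \<Rightarrow> dcfun \<Rightarrow> bool" where
  "holonomic_hypergeometric_term p q U F \<longleftrightarrow> hypergeometric_term p q U F \<and> holonomic p q U F"


section \<open>Proper-hypergeometric terms in purely discrete variables\<close>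

text \<open>
  The discrete variable \<open>0\<close> plays the role of \<open>n\<close>, the variables \<open>1, \<dots>, r\<close> that of the tuple
  \<open>k\<close>. A pair \<open>(a, c)\<close> in one of the lists is the factor \<open>(a 0 * n + \<Sum>i. a i * k i + c)!\<close>.
  Since \<open>Gamma\<close> is \<open>0\<close> at its poles and \<open>x / 0 = 0\<close>, a factorial of a negative integer in the
  denominator makes the term vanish, as usual; the term is also extended by zero
  to the points where a factorial in the numerator has a pole.
\<close>

definition cfact :: "complex \<Rightarrow> complex" where
  "cfact z = Gamma (z + 1)"

definition proper_hypergeometric_term :: "nat \<Rightarrow> (nat \<Rightarrow> complex) set \<Rightarrow> dcfun \<Rightarrow> bool" where
  "proper_hypergeometric_term r U F \<longleftrightarrow>
     (\<exists>(num :: ((nat \<Rightarrow> int) \<times> complex) list) (den :: ((nat \<Rightarrow> int) \<times> complex) list)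
       (Q :: cmpoly) (\<xi> :: nat \<Rightarrow> complex).
        indets Q \<subseteq> {..<Suc r} \<and> (\<forall>i\<in>{1..r}. \<xi> i \<noteq> 0) \<and>
        (\<forall>m\<in>int_points (Suc r). \<forall>v\<in>U.
           F m v =
             (\<Prod>(a, c)\<leftarrow>num. cfact (of_int (\<Sum>i<Suc r. a i * m i) + c)) /
             (\<Prod>(a, c)\<leftarrow>den. cfact (of_int (\<Sum>i<Suc r. a i * m i) + c)) *
             poly_value (Suc r) Q m v * (\<Prod>i=1..r. \<xi> i powi m i)))"

end

theory Submission
  imports Defs
begin

text \<open>
  Let \<open>F\<close> depend on \<open>p\<close> discrete and \<open>q\<close> continuous variables, let \<open>d = p + q\<close>, and let the
  variable \<open>t0\<close> be the one in which an equation is sought. Write \<open>\<partial>\<^sub>t\<close> for the backward shift minus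
  the identity if \<open>t\<close> is discrete, and for the partial derivative if \<open>t\<close> is continuous. The
  argument is Zeilberger's dimension count followed by integration by parts.

  \<^bold>\<open>Counting.\<close> Apply to \<open>F\<close> all monomials of degree at most \<open>N\<close> in each of the \<open>d + 1\<close> operators
  ``multiply by \<open>t0\<close>'', ``shift or differentiate in \<open>t0\<close>'' and \<open>\<partial>\<^sub>t\<close> for \<open>t \<noteq> t0\<close>. These are
  \<open>(N + 1) ^ (d + 1)\<close> functions, but they lie in a space whose dimension grows only like
  \<open>N ^ d\<close>. For holonomic \<open>F\<close> this is the meaning of the minimal Bernstein dimension; for a product
  of factorials, all shifts of \<open>F\<close> by at most \<open>\<nu>\<close> are multiples of one function by polynomials of
  degree linear in \<open>\<nu>\<close> (Sister Celine's method). Hence some nontrivial linear combination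
  vanishes: \<open>\<Sum>\<^sub>\<gamma> \<partial>\<^sup>\<gamma> P\<^sub>\<gamma> F = 0\<close>, where the operators \<open>P\<^sub>\<gamma>\<close> involve only the variable \<open>t0\<close>
  (\<open>telescoper_of_slow_filtration\<close>).

  \<^bold>\<open>Elimination.\<close> It is not enough to keep the term \<open>\<gamma> = 0\<close>, as \<open>P\<^sub>0\<close> may vanish. Instead, take one
  variable \<open>t\<close> after the other, let \<open>g\<close> be the least exponent of \<open>\<partial>\<^sub>t\<close> that occurs, and multiply by
  a polynomial \<open>w\<^sub>g\<close> of degree \<open>g\<close> in \<open>t\<close>, a binomial coefficient or a divided power.
  Summation or integration by parts turns \<open>w\<^sub>g \<partial>\<^sub>t\<^sup>j x\<close> into \<open>w\<close> of index \<open>g - j\<close> times \<open>x\<close>, up to something in the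
  image of \<open>\<partial>\<^sub>t\<close> (\<open>weight_delta_power\<close>): the terms with \<open>j > g\<close> disappear and those with \<open>j = g\<close> lose
  their \<open>\<partial>\<^sub>t\<close>. In the end a single nonzero operator \<open>P\<^sub>\<gamma>\<close> is left, and \<open>P\<^sub>\<gamma> F\<close> is a sum of
  functions \<open>\<partial>\<^sub>t G\<^sub>t\<close> (\<open>elimination\<close>).

  \<^bold>\<open>Certificates.\<close> All functions that occur are obtained from \<open>F\<close> by the operators above, so they are
  rational multiples of \<open>F\<close>. This holds only where certain denominators do not vanish, and all
  identities are therefore read \<^emph>\<open>generically\<close>, outside the zero set of a nonzero polynomial. This
  reading also takes care of differentiability: outside the zero set every function is a
  differentiable multiple of \<open>F\<close>, hence differentiable again, and no theory of functions of
  several complex variables enters. At the end the exceptional polynomial is absorbed into the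
  denominators of the certificates; if there is no variable besides \<open>t0\<close>, then it is a polynomial
  in \<open>t0\<close> alone and is multiplied into the equation (\<open>certificates_of_telescoping\<close>).
\<close>


section \<open>Polynomial functions\<close>

text \<open>
  The functions defined by polynomials in all the variables, generated in such a way that
  closure under shifts and derivatives follows by induction, without computing with the
  coefficients of a polynomial.
\<close>

inductive polyfun :: "nat \<Rightarrow> nat \<Rightarrow> dcfun \<Rightarrow> bool" for p q where
  const: "polyfun p q (\<lambda>m v. c)"
| discrete: "i < p \<Longrightarrow> polyfun p q (\<lambda>m v. of_int (m i))"
| continuous: "j < q \<Longrightarrow> polyfun p q (\<lambda>m v. v j)"
| add: "polyfun p q f \<Longrightarrow> polyfun p q g \<Longrightarrow> polyfun p q (\<lambda>m v. f m v + g m v)"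
| mult: "polyfun p q f \<Longrightarrow> polyfun p q g \<Longrightarrow> polyfun p q (\<lambda>m v. f m v * g m v)"

definition coord_value :: "nat \<Rightarrow> (nat \<Rightarrow> int) \<Rightarrow> (nat \<Rightarrow> complex) \<Rightarrow> nat \<Rightarrow> complex" where
  "coord_value p m v i = (if i < p then of_int (m i) else v (i - p))"

text \<open>
  The definition of \<open>poly_value\<close> sums over exactly the monomials that are present, and multiplies
  over exactly the indeterminates that are present. Sums and products of polynomials can be
  treated once both ranges are enlarged to common finite sets.
\<close>

lemma poly_value_superset:
  assumes "finite A" "Poly_Mapping.keys P \<subseteq> A"
  shows "poly_value p P m v =
    (\<Sum>\<alpha>\<in>A. Poly_Mapping.lookup P \<alpha> *
        (\<Prod>i\<in>Poly_Mapping.keys \<alpha>. coord_value p m v i ^ Poly_Mapping.lookup \<alpha> i))"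
  unfolding poly_value_def coord_value_def
  by (rule sum.mono_neutral_left) (use assms in \<open>auto simp: in_keys_iff\<close>)

lemma monomial_superset:
  assumes "finite I" "Poly_Mapping.keys \<alpha> \<subseteq> I"
  shows "(\<Prod>i\<in>Poly_Mapping.keys \<alpha>. (x i :: complex) ^ Poly_Mapping.lookup \<alpha> i) =
    (\<Prod>i\<in>I. x i ^ Poly_Mapping.lookup \<alpha> i)"
  by (rule prod.mono_neutral_left) (use assms in \<open>auto simp: in_keys_iff\<close>)

lemma poly_value_add: "poly_value p (P + Q) m v = poly_value p P m v + poly_value p Q m v"
proof -
  let ?A = "Poly_Mapping.keys P \<union> Poly_Mapping.keys Q"
  have "Poly_Mapping.keys (P + Q) \<subseteq> ?A" by (rule Poly_Mapping.keys_add)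
  then show ?thesis
    by (simp add: poly_value_superset[of ?A] lookup_add ring_distribs sum.distrib)
qed

lemma poly_value_single:
  "poly_value p (Poly_Mapping.single \<alpha> c) m v =
     c * (\<Prod>i\<in>Poly_Mapping.keys \<alpha>. coord_value p m v i ^ Poly_Mapping.lookup \<alpha> i)"
  by (simp add: poly_value_superset[of "{\<alpha>}"])

lemma poly_value_0 [simp]: "poly_value p 0 m v = 0"
  by (simp add: poly_value_def)

lemma poly_value_mult_single:
  "poly_value p (Poly_Mapping.single \<alpha> c * Poly_Mapping.single \<beta> d) m v =
   poly_value p (Poly_Mapping.single \<alpha> c) m v * poly_value p (Poly_Mapping.single \<beta> d) m v"
proof -
  let ?I = "Poly_Mapping.keys \<alpha> \<union> Poly_Mapping.keys \<beta>"
  have "(\<Prod>i\<in>Poly_Mapping.keys (\<alpha> + \<beta>). coord_value p m v i ^ Poly_Mapping.lookup (\<alpha> + \<beta>) i) =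
      (\<Prod>i\<in>?I. coord_value p m v i ^ Poly_Mapping.lookup (\<alpha> + \<beta>) i)"
    by (rule monomial_superset) (simp_all add: Poly_Mapping.keys_add)
  moreover have "(\<Prod>i\<in>Poly_Mapping.keys \<alpha>. coord_value p m v i ^ Poly_Mapping.lookup \<alpha> i) =
      (\<Prod>i\<in>?I. coord_value p m v i ^ Poly_Mapping.lookup \<alpha> i)"
    by (rule monomial_superset) auto
  moreover have "(\<Prod>i\<in>Poly_Mapping.keys \<beta>. coord_value p m v i ^ Poly_Mapping.lookup \<beta> i) =
      (\<Prod>i\<in>?I. coord_value p m v i ^ Poly_Mapping.lookup \<beta> i)"
    by (rule monomial_superset) auto
  ultimately show ?thesis
    by (simp add: mult_single poly_value_single lookup_add power_add prod.distrib)
qed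

lemma poly_value_sum: "poly_value p (\<Sum>i\<in>I. P i) m v = (\<Sum>i\<in>I. poly_value p (P i) m v)"
  by (induction I rule: infinite_finite_induct) (simp_all add: poly_value_add)

lemma cmpoly_as_sum:
  "(\<Sum>\<alpha>\<in>Poly_Mapping.keys P. Poly_Mapping.single \<alpha> (Poly_Mapping.lookup P \<alpha>)) = P"
proof (rule poly_mapping_eqI)
  fix \<beta>
  show "Poly_Mapping.lookup (\<Sum>\<alpha>\<in>Poly_Mapping.keys P.
      Poly_Mapping.single \<alpha> (Poly_Mapping.lookup P \<alpha>)) \<beta> = Poly_Mapping.lookup P \<beta>"
    by (simp add: lookup_sum lookup_single when_def in_keys_iff)
qed

lemma poly_value_mult: "poly_value p (P * Q) m v = poly_value p P m v * poly_value p Q m v"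
proof -
  let ?s = "\<lambda>P \<alpha>. Poly_Mapping.single \<alpha> (Poly_Mapping.lookup P \<alpha>)"
  have "P * Q = (\<Sum>\<alpha>\<in>Poly_Mapping.keys P. \<Sum>\<beta>\<in>Poly_Mapping.keys Q. ?s P \<alpha> * ?s Q \<beta>)"
    by (simp add: sum_product [symmetric] cmpoly_as_sum)
  then have "poly_value p (P * Q) m v =
      (\<Sum>\<alpha>\<in>Poly_Mapping.keys P. poly_value p (?s P \<alpha>) m v) *
      (\<Sum>\<beta>\<in>Poly_Mapping.keys Q. poly_value p (?s Q \<beta>) m v)"
    by (simp add: poly_value_sum poly_value_mult_single sum_product)
  also have "\<dots> = poly_value p P m v * poly_value p Q m v"
    by (simp only: poly_value_sum [symmetric] cmpoly_as_sum)
  finally show ?thesis .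
qed

lemma indets_add: "indets (P + Q) \<subseteq> indets P \<union> indets Q"
  using Poly_Mapping.keys_add[of P Q] by (auto simp: indets_def)

lemma indets_mult: "indets (P * Q) \<subseteq> indets P \<union> indets Q"
proof
  fix i assume "i \<in> indets (P * Q)"
  then obtain \<alpha> \<beta> where "\<alpha> \<in> Poly_Mapping.keys P" "\<beta> \<in> Poly_Mapping.keys Q"
    "i \<in> Poly_Mapping.keys (\<alpha> + \<beta>)"
    using keys_mult[of P Q] by (auto simp: indets_def)
  then show "i \<in> indets P \<union> indets Q"
    using Poly_Mapping.keys_add[of \<alpha> \<beta>] by (auto simp: indets_def)
qed

lemma polyfun_sum: "(\<And>i. i \<in> I \<Longrightarrow> polyfun p q (f i)) \<Longrightarrow> polyfun p q (\<lambda>m v. \<Sum>i\<in>I. f i m v)"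
  by (induction I rule: infinite_finite_induct) (auto intro: polyfun.const polyfun.add)

lemma polyfun_prod: "(\<And>i. i \<in> I \<Longrightarrow> polyfun p q (f i)) \<Longrightarrow> polyfun p q (\<lambda>m v. \<Prod>i\<in>I. f i m v)"
  by (induction I rule: infinite_finite_induct) (auto intro: polyfun.const polyfun.mult)

lemma polyfun_power: "polyfun p q f \<Longrightarrow> polyfun p q (\<lambda>m v. f m v ^ n)"
  by (induction n) (auto intro: polyfun.const polyfun.mult)

lemma polyfun_diff: "polyfun p q f \<Longrightarrow> polyfun p q g \<Longrightarrow> polyfun p q (\<lambda>m v. f m v - g m v)"
  using polyfun.add[OF _ polyfun.mult[OF polyfun.const[of p q "-1"]], of f g] by simp

lemma polyfun_coord_value: "i < p + q \<Longrightarrow> polyfun p q (\<lambda>m v. coord_value p m v i)"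
  by (cases "i < p") (auto simp: coord_value_def intro: polyfun.intros)

lemma polyfun_iff_cmpoly:
  "polyfun p q f \<longleftrightarrow> (\<exists>P. indets P \<subseteq> {..<p + q} \<and> f = poly_value p P)"
proof
  assume "polyfun p q f"
  then show "\<exists>P. indets P \<subseteq> {..<p + q} \<and> f = poly_value p P"
  proof induction
    case (const c)
    show ?case
      by (rule exI[of _ "Poly_Mapping.single 0 c"])
        (auto simp: indets_def poly_value_single fun_eq_iff)
  next
    case (discrete i)
    then show ?case
      by (intro exI[of _ "Poly_Mapping.single (Poly_Mapping.single i 1) 1"])
        (auto simp: indets_def poly_value_single fun_eq_iff coord_value_def)
  next
    case (continuous j)
    then show ?case
      by (intro exI[of _ "Poly_Mapping.single (Poly_Mapping.single (p + j) 1) 1"])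
        (auto simp: indets_def poly_value_single fun_eq_iff coord_value_def)
  next
    case (add f g)
    then obtain P Q where "indets P \<subseteq> {..<p + q}" "f = poly_value p P"
      "indets Q \<subseteq> {..<p + q}" "g = poly_value p Q" by auto
    then show ?case
      using indets_add[of P Q] by (intro exI[of _ "P + Q"]) (auto simp: poly_value_add fun_eq_iff)
  next
    case (mult f g)
    then obtain P Q where "indets P \<subseteq> {..<p + q}" "f = poly_value p P"
      "indets Q \<subseteq> {..<p + q}" "g = poly_value p Q" by auto
    then show ?case
      using indets_mult[of P Q] by (intro exI[of _ "P * Q"]) (auto simp: poly_value_mult fun_eq_iff)
  qed
next
  assume "\<exists>P. indets P \<subseteq> {..<p + q} \<and> f = poly_value p P"
  then obtain P where P: "indets P \<subseteq> {..<p + q}" "f = poly_value p P" by auto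
  have "polyfun p q (\<lambda>m v. \<Sum>\<alpha>\<in>Poly_Mapping.keys P. Poly_Mapping.lookup P \<alpha> *
      (\<Prod>i\<in>Poly_Mapping.keys \<alpha>. coord_value p m v i ^ Poly_Mapping.lookup \<alpha> i))"
    using P(1) by (intro polyfun_sum polyfun.mult polyfun.const polyfun_prod polyfun_power
        polyfun_coord_value) (auto simp: indets_def)
  moreover have "(\<lambda>m v. \<Sum>\<alpha>\<in>Poly_Mapping.keys P. Poly_Mapping.lookup P \<alpha> *
      (\<Prod>i\<in>Poly_Mapping.keys \<alpha>. coord_value p m v i ^ Poly_Mapping.lookup \<alpha> i)) = f"
    by (simp add: P(2) poly_value_def coord_value_def fun_eq_iff)
  ultimately show "polyfun p q f" by simp
qed

text \<open>
  A nonzero polynomial does not vanish on all integer points: induction on the number of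
  indeterminates, each step viewing the polynomial as a univariate one whose coefficient at some
  exponent \<open>\<alpha>0 i\<close> is nonzero by the induction hypothesis. A polynomial is given by a family of
  exponent functions that are distinct on \<open>I\<close>.
\<close>

lemma nonzero_polynomial_has_integer_nonroot:
  fixes c :: "(nat \<Rightarrow> nat) \<Rightarrow> complex"
  assumes "finite I" "finite A" "inj_on (\<lambda>\<alpha>. restrict \<alpha> I) A" "\<alpha>0 \<in> A" "c \<alpha>0 \<noteq> 0"
  shows "\<exists>x :: nat \<Rightarrow> int. (\<Sum>\<alpha>\<in>A. c \<alpha> * (\<Prod>i\<in>I. of_int (x i) ^ \<alpha> i)) \<noteq> 0"
  using assms
proof (induction I arbitrary: A rule: finite_induct)
  case empty
  then have "A = {\<alpha>0}" by (auto simp: inj_on_def)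
  then show ?case using empty by simp
next
  case (insert i I)
  define B where "B = {\<alpha>\<in>A. \<alpha> i = \<alpha>0 i}"
  have "finite B" "\<alpha>0 \<in> B" using insert.prems(1,3) by (auto simp: B_def)
  have "inj_on (\<lambda>\<alpha>. restrict \<alpha> I) B"
  proof (rule inj_onI)
    fix \<alpha> \<beta> assume \<alpha>\<beta>: "\<alpha> \<in> B" "\<beta> \<in> B" "restrict \<alpha> I = restrict \<beta> I"
    then have "restrict \<alpha> (insert i I) = restrict \<beta> (insert i I)"
      by (auto simp: B_def fun_eq_iff restrict_def split: if_splits)
    then show "\<alpha> = \<beta>"
      using insert.prems(2) \<alpha>\<beta>(1,2) unfolding inj_on_def B_def by blast
  qed
  then obtain x :: "nat \<Rightarrow> int" where x: "(\<Sum>\<alpha>\<in>B. c \<alpha> * (\<Prod>i\<in>I. of_int (x i) ^ \<alpha> i)) \<noteq> 0"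
    using insert.IH[of B] insert.prems(4) \<open>finite B\<close> \<open>\<alpha>0 \<in> B\<close> by blast
  define h where "h = (\<Sum>\<alpha>\<in>A. monom (c \<alpha> * (\<Prod>i\<in>I. of_int (x i) ^ \<alpha> i)) (\<alpha> i))"
  have "coeff h (\<alpha>0 i) = (\<Sum>\<alpha>\<in>B. c \<alpha> * (\<Prod>i\<in>I. of_int (x i) ^ \<alpha> i))"
    unfolding h_def B_def coeff_sum coeff_monom using insert.prems(1)
    by (intro sum.mono_neutral_cong_right) auto
  then have "h \<noteq> 0" using x by auto
  have "infinite (range (of_int :: int \<Rightarrow> complex))"
    by (simp add: finite_image_iff inj_on_def infinite_UNIV_int)
  then obtain t :: int where t: "poly h (of_int t) \<noteq> 0"
    using poly_roots_finite[OF \<open>h \<noteq> 0\<close>] by (metis (mono_tags, lifting) finite_subset image_subset_iff mem_Collect_eq rangeE subsetI)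
  have "(\<Prod>k\<in>I. of_int ((x(i := t)) k) ^ \<alpha> k) = (\<Prod>k\<in>I. (of_int (x k) :: complex) ^ \<alpha> k)" for \<alpha>
    using insert.hyps(2) by (intro prod.cong) auto
  then have "(\<Sum>\<alpha>\<in>A. c \<alpha> * (\<Prod>k\<in>insert i I. of_int ((x(i := t)) k) ^ \<alpha> k)) = poly h (of_int t)"
    unfolding h_def poly_sum poly_monom using insert.hyps
    by (intro sum.cong) (simp_all add: algebra_simps)
  then show ?case using t by metis
qed

text \<open>
  This identifies nonzero polynomials with nonzero polynomial functions, so that being nonzero
  can be checked by values. It transfers, for instance, to shifted polynomials.
\<close>

lemma poly_value_eq_0_iff:
  assumes "indets P \<subseteq> {..<p + q}"
  shows "poly_value p P = (\<lambda>m v. 0) \<longleftrightarrow> P = 0"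
proof
  show "P = 0 \<Longrightarrow> poly_value p P = (\<lambda>m v. 0)"
    by (simp add: fun_eq_iff)
next
  assume zero: "poly_value p P = (\<lambda>m v. 0)"
  show "P = 0"
  proof (rule ccontr)
    assume "P \<noteq> 0"
    then obtain \<alpha>0 where \<alpha>0: "\<alpha>0 \<in> Poly_Mapping.keys P" by fastforce
    let ?I = "{..<p + q}"
    have sub: "Poly_Mapping.keys \<alpha> \<subseteq> ?I" if "\<alpha> \<in> Poly_Mapping.keys P" for \<alpha>
      using that assms by (auto simp: indets_def)
    have inj: "inj_on (\<lambda>\<alpha>. restrict (Poly_Mapping.lookup \<alpha>) ?I) (Poly_Mapping.keys P)"
    proof (rule inj_onI, rule poly_mapping_eqI)
      fix \<alpha> \<beta> i assume *: "\<alpha> \<in> Poly_Mapping.keys P" "\<beta> \<in> Poly_Mapping.keys P"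
        "restrict (Poly_Mapping.lookup \<alpha>) ?I = restrict (Poly_Mapping.lookup \<beta>) ?I"
      show "Poly_Mapping.lookup \<alpha> i = Poly_Mapping.lookup \<beta> i"
      proof (cases "i \<in> ?I")
        case True
        then show ?thesis using *(3) by (metis restrict_apply')
      next
        case False
        then show ?thesis using sub *(1,2) by (metis in_keys_iff subsetD)
      qed
    qed
    let ?A = "Poly_Mapping.lookup ` Poly_Mapping.keys P"
    let ?c = "\<lambda>a. Poly_Mapping.lookup P (Abs_poly_mapping a)"
    have "inj_on (\<lambda>\<alpha>. restrict \<alpha> ?I) ?A"
      using inj by (auto simp: inj_on_def)
    then obtain x :: "nat \<Rightarrow> int" where
      x: "(\<Sum>a\<in>?A. ?c a * (\<Prod>i\<in>?I. of_int (x i) ^ a i)) \<noteq> 0"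
      using nonzero_polynomial_has_integer_nonroot[of ?I ?A "Poly_Mapping.lookup \<alpha>0" ?c] \<alpha>0
      by (auto simp: in_keys_iff)
    have "(\<Sum>a\<in>?A. ?c a * (\<Prod>i\<in>?I. of_int (x i) ^ a i)) =
        (\<Sum>\<alpha>\<in>Poly_Mapping.keys P. Poly_Mapping.lookup P \<alpha> *
          (\<Prod>i\<in>?I. of_int (x i) ^ Poly_Mapping.lookup \<alpha> i))"
      by (subst sum.reindex) (auto simp: inj_on_def)
    also have "\<dots> = poly_value p P x (\<lambda>j. of_int (x (p + j)))"
      unfolding poly_value_def using sub
      by (intro sum.cong refl arg_cong2[of _ _ _ _ "(*)"] prod.mono_neutral_cong_right)
        (auto simp: in_keys_iff)
    finally show False using x zero by (simp add: fun_eq_iff)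
  qed
qed

text \<open>
  Polynomials in several indeterminates form an integral domain. Therefore the product of the
  exceptional polynomials of two generic identities is an exceptional polynomial for both.
\<close>

lemma polyfun_mult_nonzero:
  assumes "polyfun p q f" "polyfun p q g" "f \<noteq> (\<lambda>m v. 0)" "g \<noteq> (\<lambda>m v. 0)"
  shows "(\<lambda>m v. f m v * g m v) \<noteq> (\<lambda>m v. 0)"
proof -
  obtain P Q where P: "indets P \<subseteq> {..<p + q}" "f = poly_value p P"
    and Q: "indets Q \<subseteq> {..<p + q}" "g = poly_value p Q"
    using assms by (auto simp: polyfun_iff_cmpoly)
  then have "P * Q \<noteq> 0" using assms by (auto simp: fun_eq_iff)
  moreover have "indets (P * Q) \<subseteq> {..<p + q}"
    using indets_mult[of P Q] P Q by auto
  moreover have "poly_value p (P * Q) = (\<lambda>m v. f m v * g m v)"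
    by (simp add: poly_value_mult P Q fun_eq_iff)
  ultimately show ?thesis using poly_value_eq_0_iff by metis
qed

lemma polyfun_nonzero_iff_cmpoly:
  "polyfun p q f \<and> f \<noteq> (\<lambda>m v. 0) \<longleftrightarrow>
    (\<exists>P. indets P \<subseteq> {..<p + q} \<and> P \<noteq> 0 \<and> f = poly_value p P)"
  using poly_value_eq_0_iff unfolding polyfun_iff_cmpoly by metis

lemma polyfun_shift:
  "polyfun p q f \<Longrightarrow> polyfun p q (\<lambda>m v. f (m(i := m i + k)) v)"
proof (induction rule: polyfun.induct)
  case (discrete l)
  show ?case
    using polyfun.add[OF polyfun.discrete[OF discrete] polyfun.const[of p q "of_int k"]]
      polyfun.discrete[OF discrete, of q]
    by (cases "l = i") auto
qed (auto intro: polyfun.intros)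

lemma shift_nonzero:
  fixes f :: dcfun
  assumes "f \<noteq> (\<lambda>m v. 0)"
  shows "(\<lambda>m v. f (m(i := m i + k)) v) \<noteq> (\<lambda>m v. 0)"
proof -
  obtain m v where "f m v \<noteq> 0" using assms by (auto simp: fun_eq_iff)
  then have "f ((m(i := m i - k))(i := (m(i := m i - k)) i + k)) v \<noteq> 0" by simp
  then show ?thesis unfolding fun_eq_iff by blast
qed

lemma polyfun_has_derivative:
  assumes "polyfun p q f"
  shows "\<exists>f'. polyfun p q f' \<and>
    (\<forall>m v. ((\<lambda>t. f m (v(j := t))) has_field_derivative f' m v) (at (v j)))"
  using assms
proof induction
  case (const c)
  show ?case by (intro exI[of _ "\<lambda>m v. 0"]) (auto intro: polyfun.const)
next
  case (discrete i)
  show ?case by (intro exI[of _ "\<lambda>m v. 0"]) (auto intro: polyfun.const)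
next
  case (continuous l)
  show ?case
    by (intro exI[of _ "\<lambda>m v. if l = j then 1 else 0"]) (auto intro: polyfun.const)
next
  case (add f g)
  then obtain f' g' where "polyfun p q f'" "polyfun p q g'"
    "\<forall>m v. ((\<lambda>t. f m (v(j := t))) has_field_derivative f' m v) (at (v j))"
    "\<forall>m v. ((\<lambda>t. g m (v(j := t))) has_field_derivative g' m v) (at (v j))" by blast
  then show ?case
    using DERIV_add polyfun.add by (intro exI[of _ "\<lambda>m v. f' m v + g' m v"]) blast
next
  case (mult f g)
  then obtain f' g' where f'g': "polyfun p q f'" "polyfun p q g'"
    "\<forall>m v. ((\<lambda>t. f m (v(j := t))) has_field_derivative f' m v) (at (v j))"
    "\<forall>m v. ((\<lambda>t. g m (v(j := t))) has_field_derivative g' m v) (at (v j))" by blast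
  then have "((\<lambda>t. f m (v(j := t)) * g m (v(j := t))) has_field_derivative
      f' m v * g m v + g' m v * f m v) (at (v j))" for m v
    using DERIV_mult[of "\<lambda>t. f m (v(j := t))" "f' m v" "v j" UNIV "\<lambda>t. g m (v(j := t))" "g' m v"]
    by (simp only: fun_upd_triv)
  then show ?case using mult.hyps f'g'(1,2)
    by (intro exI[of _ "\<lambda>m v. f' m v * g m v + g' m v * f m v"])
      (intro conjI polyfun.add polyfun.mult allI)
qed

text \<open>
  With only one variable in all, an exceptional polynomial is a polynomial in that variable and may be
  used as a coefficient of a recurrence or differential equation.
\<close>

lemma polyfun_univariate:
  assumes "polyfun p q f" "p + q = 1"
  shows "\<exists>e. \<forall>m v. f m v = poly e (coord_value p m v 0)"
  using assms(1)
proof induction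
  case (const c)
  show ?case by (rule exI[of _ "[:c:]"]) simp
next
  case (discrete i)
  then have "i = 0" "p \<noteq> 0" using assms(2) by auto
  then show ?case by (intro exI[of _ "[:0, 1:]"]) (simp add: coord_value_def del: One_nat_def)
next
  case (continuous j)
  then have "j = 0" "p = 0" using assms(2) by auto
  then show ?case by (intro exI[of _ "[:0, 1:]"]) (simp add: coord_value_def)
next
  case (add f g)
  then obtain d e where "\<forall>m v. f m v = poly d (coord_value p m v 0)"
    "\<forall>m v. g m v = poly e (coord_value p m v 0)" by blast
  then show ?case by (intro exI[of _ "d + e"]) simp
next
  case (mult f g)
  then obtain d e where "\<forall>m v. f m v = poly d (coord_value p m v 0)"
    "\<forall>m v. g m v = poly e (coord_value p m v 0)" by blast
  then show ?case by (intro exI[of _ "d * e"]) simp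
qed

section \<open>Generic identities\<close>

text \<open>
  Validity outside the zero set of some nonzero polynomial. Every finite combination of
  operators on functions leads from generic identities to generic identities, because the
  exceptional polynomials can be multiplied, shifted, and, being continuous, stay nonzero
  nearby.
\<close>

definition generically ::
    "nat \<Rightarrow> nat \<Rightarrow> (nat \<Rightarrow> complex) set \<Rightarrow> ((nat \<Rightarrow> int) \<Rightarrow> (nat \<Rightarrow> complex) \<Rightarrow> bool) \<Rightarrow> bool" where
  "generically p q U P \<longleftrightarrow>
     (\<exists>f. polyfun p q f \<and> f \<noteq> (\<lambda>m v. 0) \<and>
        (\<forall>m\<in>int_points p. \<forall>v\<in>U. f m v \<noteq> 0 \<longrightarrow> P m v))"

lemma generically_always:
  assumes "\<And>m v. m \<in> int_points p \<Longrightarrow> v \<in> U \<Longrightarrow> P m v"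
  shows "generically p q U P"
  unfolding generically_def
  by (rule exI[of _ "\<lambda>m v. 1"]) (use assms in \<open>auto intro: polyfun.const simp: fun_eq_iff\<close>)

lemma generically_nonzero:
  "polyfun p q f \<Longrightarrow> f \<noteq> (\<lambda>m v. 0) \<Longrightarrow> generically p q U (\<lambda>m v. f m v \<noteq> 0)"
  unfolding generically_def by blast

lemma generically_mono:
  assumes "generically p q U P"
    and "\<And>m v. m \<in> int_points p \<Longrightarrow> v \<in> U \<Longrightarrow> P m v \<Longrightarrow> Q m v"
  shows "generically p q U Q"
  using assms unfolding generically_def by blast

lemma generically_conj:
  assumes "generically p q U P" "generically p q U Q"
  shows "generically p q U (\<lambda>m v. P m v \<and> Q m v)"
proof -
  obtain f g where f: "polyfun p q f" "f \<noteq> (\<lambda>m v. 0)" "\<forall>m\<in>int_points p. \<forall>v\<in>U. f m v \<noteq> 0 \<longrightarrow> P m v"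
    and g: "polyfun p q g" "g \<noteq> (\<lambda>m v. 0)" "\<forall>m\<in>int_points p. \<forall>v\<in>U. g m v \<noteq> 0 \<longrightarrow> Q m v"
    using assms unfolding generically_def by blast
  have "(\<lambda>m v. f m v * g m v) \<noteq> (\<lambda>m v. 0)"
    using polyfun_mult_nonzero f(1,2) g(1,2) by blast
  then show ?thesis
    unfolding generically_def using f g polyfun.mult[OF f(1) g(1)]
    by (intro exI[of _ "\<lambda>m v. f m v * g m v"]) auto
qed

lemma generically_ball:
  assumes "finite I" "\<And>i. i \<in> I \<Longrightarrow> generically p q U (P i)"
  shows "generically p q U (\<lambda>m v. \<forall>i\<in>I. P i m v)"
  using assms
proof (induction I rule: finite_induct)
  case empty
  show ?case by (rule generically_always) simp
next
  case (insert i I)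
  then show ?case
    using generically_conj[of p q U "P i" "\<lambda>m v. \<forall>i\<in>I. P i m v"] by simp
qed

lemma int_points_upd: "m \<in> int_points p \<Longrightarrow> i < p \<Longrightarrow> m(i := k) \<in> int_points p"
  by (auto simp: int_points_def PiE_def extensional_def)

lemma generically_shift:
  assumes "generically p q U P" "i < p"
  shows "generically p q U (\<lambda>m v. P (m(i := m i + k)) v)"
proof -
  obtain f where f: "polyfun p q f" "f \<noteq> (\<lambda>m v. 0)" "\<forall>m\<in>int_points p. \<forall>v\<in>U. f m v \<noteq> 0 \<longrightarrow> P m v"
    using assms unfolding generically_def by blast
  show ?thesis unfolding generically_def
    by (rule exI[of _ "\<lambda>m v. f (m(i := m i + k)) v"])
      (use f polyfun_shift[OF f(1)] shift_nonzero[OF f(2)] int_points_upd[OF _ assms(2)] in blast)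
qed

lemma open_slice:
  assumes "openin (complex_space q) U" "v \<in> U" "j < q"
  shows "open {t. v(j := t) \<in> U}"
proof -
  have "v \<in> topspace (complex_space q)" using assms openin_subset by blast
  then have "continuous_map euclidean (complex_space q) (\<lambda>t. v(j := t))"
    using assms(3)
    by (auto simp: continuous_map_componentwise PiE_def extensional_def)
  from openin_continuous_map_preimage[OF this assms(1)] show ?thesis by simp
qed

lemma eventually_slice_nonzero:
  assumes "openin (complex_space q) U" "v \<in> U" "j < q" "polyfun p q f" "f m v \<noteq> 0"
  shows "\<forall>\<^sub>F t in nhds (v j). v(j := t) \<in> U \<and> f m (v(j := t)) \<noteq> 0"
proof -
  have "\<forall>\<^sub>F t in nhds (v j). v(j := t) \<in> U"
    using open_slice[OF assms(1-3)] assms(2) eventually_nhds_in_open[of "{t. v(j := t) \<in> U}" "v j"]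
    by simp
  moreover have "\<forall>\<^sub>F t in nhds (v j). f m (v(j := t)) \<noteq> 0"
  proof -
    obtain f' where "((\<lambda>t. f m (v(j := t))) has_field_derivative f' m v) (at (v j))"
      using polyfun_has_derivative[OF assms(4)] by blast
    then have "isCont (\<lambda>t. f m (v(j := t))) (v j)" by (rule DERIV_isCont)
    then have "((\<lambda>t. f m (v(j := t))) \<longlongrightarrow> f m v) (nhds (v j))"
      by (simp add: isCont_def tendsto_nhds_iff)
    then show ?thesis using assms(5) by (rule tendsto_imp_eventually_ne)
  qed
  ultimately show ?thesis by eventually_elim simp
qed

text \<open>
  A generic property holds generically on a whole neighbourhood in direction \<open>j\<close>. Hence generic identities may be
  differentiated.
\<close>

lemma generically_slice:
  assumes "generically p q U P" "openin (complex_space q) U" "j < q"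
  shows "generically p q U (\<lambda>m v. \<forall>\<^sub>F t in nhds (v j). v(j := t) \<in> U \<and> P m (v(j := t)))"
proof -
  obtain f where f: "polyfun p q f" "f \<noteq> (\<lambda>m v. 0)" "\<forall>m\<in>int_points p. \<forall>v\<in>U. f m v \<noteq> 0 \<longrightarrow> P m v"
    using assms unfolding generically_def by blast
  have "\<forall>\<^sub>F t in nhds (v j). v(j := t) \<in> U \<and> P m (v(j := t))"
    if "m \<in> int_points p" "v \<in> U" "f m v \<noteq> 0" for m v
    using eventually_slice_nonzero[OF assms(2) that(2) assms(3) f(1) that(3)]
    by eventually_elim (use f(3) that(1) in blast)
  then show ?thesis using f(1,2) unfolding generically_def by blast
qed

section \<open>Rational multiples of a solution of first-order relations\<close>

text \<open>
  Variables are numbered as the indeterminates of a polynomial: \<open>t < p\<close> is discrete, and \<open>t \<ge> p\<close>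
  is the continuous variable \<open>t - p\<close>. The shift is backward because the variable \<open>z\<^sub>t\<close> of a
  generating function shifts coefficients backward, so that \<open>step\<close> acts as a generator of the Weyl algebra
  for both kinds of variables.
\<close>

definition step :: "nat \<Rightarrow> nat \<Rightarrow> dcfun \<Rightarrow> dcfun" where
  "step p t G = (if t < p then (\<lambda>m v. G (m(t := m t - 1)) v) else partial_deriv (t - p) G)"

definition delta :: "nat \<Rightarrow> nat \<Rightarrow> dcfun \<Rightarrow> dcfun" where
  "delta p t G = (if t < p then (\<lambda>m v. G (m(t := m t - 1)) v - G m v) else partial_deriv (t - p) G)"

text \<open>
  What is used of a hypergeometric term. Both polynomials in a shift relation are nonzero, so
  that the relation can be solved for the shift in either direction. Any term that vanishes
  generically satisfies such relations trivially.
\<close>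

locale first_order_system =
  fixes p q :: nat and U :: "(nat \<Rightarrow> complex) set" and F :: dcfun
  assumes open_domain: "openin (complex_space q) U"
    and differentiable: "\<And>m v j. m \<in> int_points p \<Longrightarrow> v \<in> U \<Longrightarrow> j < q \<Longrightarrow>
      (\<lambda>t. F m (v(j := t))) field_differentiable at (v j)"
    and shift_relation: "\<And>i. i < p \<Longrightarrow> \<exists>a b. polyfun p q a \<and> polyfun p q b \<and>
      a \<noteq> (\<lambda>m v. 0) \<and> b \<noteq> (\<lambda>m v. 0) \<and>
      generically p q U (\<lambda>m v. a m v * F (m(i := m i + 1)) v = b m v * F m v)"
    and derivative_relation: "\<And>j. j < q \<Longrightarrow> \<exists>a b. polyfun p q a \<and> polyfun p q b \<and>
      a \<noteq> (\<lambda>m v. 0) \<and>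
      generically p q U (\<lambda>m v. a m v * partial_deriv j F m v = b m v * F m v)"
begin

text \<open>
  The module of rational functions times \<open>F\<close>, closed under all operators considered below.
\<close>

definition rational_multiple :: "dcfun \<Rightarrow> bool" where
  "rational_multiple G \<longleftrightarrow> (\<exists>f g. polyfun p q f \<and> polyfun p q g \<and> g \<noteq> (\<lambda>m v. 0) \<and>
     generically p q U (\<lambda>m v. g m v * G m v = f m v * F m v))"

lemma rational_multipleE:
  assumes "rational_multiple G"
  obtains f g where "polyfun p q f" "polyfun p q g" "g \<noteq> (\<lambda>m v. 0)"
    "generically p q U (\<lambda>m v. g m v * G m v = f m v * F m v)"
  using assms unfolding rational_multiple_def by blast

lemma rational_multipleI:
  assumes "polyfun p q f" "polyfun p q g" "g \<noteq> (\<lambda>m v. 0)"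
    "generically p q U (\<lambda>m v. g m v * G m v = f m v * F m v)"
  shows "rational_multiple G"
  using assms unfolding rational_multiple_def by blast

lemma rational_multiple_self: "rational_multiple F"
  by (rule rational_multipleI[OF polyfun.const[of p q 1] polyfun.const[of p q 1]])
    (auto simp: fun_eq_iff intro: generically_always)

lemma rational_multiple_zero: "rational_multiple (\<lambda>m v. 0)"
  by (rule rational_multipleI[OF polyfun.const[of p q 0] polyfun.const[of p q 1]])
    (auto simp: fun_eq_iff intro: generically_always)

lemma rational_multiple_cong:
  assumes "rational_multiple G" "generically p q U (\<lambda>m v. G m v = H m v)"
  shows "rational_multiple H"
proof -
  obtain f g where fg: "polyfun p q f" "polyfun p q g" "g \<noteq> (\<lambda>m v. 0)"
    and *: "generically p q U (\<lambda>m v. g m v * G m v = f m v * F m v)"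
    using assms(1) by (rule rational_multipleE)
  from generically_conj[OF * assms(2)] show ?thesis
    by (rule rational_multipleI[OF fg generically_mono]) auto
qed

lemma rational_multiple_add:
  assumes "rational_multiple G" "rational_multiple H"
  shows "rational_multiple (\<lambda>m v. G m v + H m v)"
proof -
  obtain f g where fg: "polyfun p q f" "polyfun p q g" "g \<noteq> (\<lambda>m v. 0)"
    and G: "generically p q U (\<lambda>m v. g m v * G m v = f m v * F m v)"
    using assms(1) by (rule rational_multipleE)
  obtain f' g' where fg': "polyfun p q f'" "polyfun p q g'" "g' \<noteq> (\<lambda>m v. 0)"
    and H: "generically p q U (\<lambda>m v. g' m v * H m v = f' m v * F m v)"
    using assms(2) by (rule rational_multipleE)
  show ?thesis
  proof (rule rational_multipleI)
    show "polyfun p q (\<lambda>m v. f m v * g' m v + f' m v * g m v)"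
      "polyfun p q (\<lambda>m v. g m v * g' m v)"
      using fg fg' by (auto intro: polyfun.intros)
    show "(\<lambda>m v. g m v * g' m v) \<noteq> (\<lambda>m v. 0)"
      using polyfun_mult_nonzero fg(2,3) fg'(2,3) by blast
    show "generically p q U (\<lambda>m v. g m v * g' m v * (G m v + H m v) =
        (f m v * g' m v + f' m v * g m v) * F m v)"
      using generically_conj[OF G H]
    proof (rule generically_mono)
      fix m v assume "g m v * G m v = f m v * F m v \<and> g' m v * H m v = f' m v * F m v"
      then show "g m v * g' m v * (G m v + H m v) = (f m v * g' m v + f' m v * g m v) * F m v"
        by algebra
    qed
  qed
qed

lemma rational_multiple_mult:
  assumes "rational_multiple G" "polyfun p q h"
  shows "rational_multiple (\<lambda>m v. h m v * G m v)"
proof -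
  obtain f g where fg: "polyfun p q f" "polyfun p q g" "g \<noteq> (\<lambda>m v. 0)"
    and G: "generically p q U (\<lambda>m v. g m v * G m v = f m v * F m v)"
    using assms(1) by (rule rational_multipleE)
  from G have "generically p q U (\<lambda>m v. g m v * (h m v * G m v) = (h m v * f m v) * F m v)"
    by (rule generically_mono) (simp add: mult.assoc mult.left_commute)
  then show ?thesis
    by (intro rational_multipleI[OF polyfun.mult[OF assms(2) fg(1)] fg(2,3)])
qed

lemma rational_multiple_scale:
  "rational_multiple G \<Longrightarrow> rational_multiple (\<lambda>m v. c * G m v)"
  using rational_multiple_mult[OF _ polyfun.const] .

lemma rational_multiple_sum:
  "(\<And>i. i \<in> I \<Longrightarrow> rational_multiple (G i)) \<Longrightarrow> rational_multiple (\<lambda>m v. \<Sum>i\<in>I. G i m v)"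
  by (induction I rule: infinite_finite_induct)
    (auto intro: rational_multiple_zero rational_multiple_add)

lemma rational_multiple_diff:
  "rational_multiple G \<Longrightarrow> rational_multiple H \<Longrightarrow> rational_multiple (\<lambda>m v. G m v - H m v)"
  using rational_multiple_add[OF _ rational_multiple_scale[of _ "-1"], of G H] by simp

lemma rational_multiple_shift:
  assumes "rational_multiple G" "i < p"
  shows "rational_multiple (\<lambda>m v. G (m(i := m i + 1)) v)"
proof -
  let ?s = "\<lambda>f m v. f (m(i := m i + 1)) v"
  obtain f g where fg: "polyfun p q f" "polyfun p q g" "g \<noteq> (\<lambda>m v. 0)"
    and G: "generically p q U (\<lambda>m v. g m v * G m v = f m v * F m v)"
    using assms(1) by (rule rational_multipleE)
  obtain a b where ab: "polyfun p q a" "polyfun p q b" "a \<noteq> (\<lambda>m v. 0)"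
    and F: "generically p q U (\<lambda>m v. a m v * ?s F m v = b m v * F m v)"
    using shift_relation[OF assms(2)] by blast
  show ?thesis
  proof (rule rational_multipleI)
    show "polyfun p q (\<lambda>m v. ?s f m v * b m v)" "polyfun p q (\<lambda>m v. a m v * ?s g m v)"
      using fg ab by (auto intro: polyfun.mult polyfun_shift)
    show "(\<lambda>m v. a m v * ?s g m v) \<noteq> (\<lambda>m v. 0)"
      using polyfun_mult_nonzero[OF ab(1) polyfun_shift[OF fg(2)] ab(3) shift_nonzero[OF fg(3)]] .
    show "generically p q U (\<lambda>m v. a m v * ?s g m v * ?s G m v = ?s f m v * b m v * F m v)"
      using generically_conj[OF generically_shift[OF G assms(2), of 1] F]
    proof (rule generically_mono)
      fix m v assume "?s g m v * ?s G m v = ?s f m v * ?s F m v \<and> a m v * ?s F m v = b m v * F m v"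
      then show "a m v * ?s g m v * ?s G m v = ?s f m v * b m v * F m v" by algebra
    qed
  qed
qed

lemma rational_multiple_back_shift:
  assumes "rational_multiple G" "i < p"
  shows "rational_multiple (\<lambda>m v. G (m(i := m i - 1)) v)"
proof -
  let ?s = "\<lambda>f m v. f (m(i := m i + (- 1))) v"
  obtain f g where fg: "polyfun p q f" "polyfun p q g" "g \<noteq> (\<lambda>m v. 0)"
    and G: "generically p q U (\<lambda>m v. g m v * G m v = f m v * F m v)"
    using assms(1) by (rule rational_multipleE)
  obtain a b where ab: "polyfun p q a" "polyfun p q b" "b \<noteq> (\<lambda>m v. 0)"
    and F: "generically p q U (\<lambda>m v. a m v * F (m(i := m i + 1)) v = b m v * F m v)"
    using shift_relation[OF assms(2)] by blast
  have "rational_multiple (?s G)"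
  proof (rule rational_multipleI)
    show "polyfun p q (\<lambda>m v. ?s f m v * ?s a m v)" "polyfun p q (\<lambda>m v. ?s b m v * ?s g m v)"
      by - (intro polyfun.mult polyfun_shift fg ab)+
    show "(\<lambda>m v. ?s b m v * ?s g m v) \<noteq> (\<lambda>m v. 0)"
      using polyfun_mult_nonzero[OF polyfun_shift[OF ab(2)] polyfun_shift[OF fg(2)]
          shift_nonzero[OF ab(3)] shift_nonzero[OF fg(3)]] .
    show "generically p q U (\<lambda>m v. ?s b m v * ?s g m v * ?s G m v = ?s f m v * ?s a m v * F m v)"
      using generically_conj[OF generically_shift[OF G assms(2), of "-1"]
          generically_shift[OF F assms(2), of "-1"]]
    proof (rule generically_mono)
      fix m v assume "?s g m v * ?s G m v = ?s f m v * ?s F m v \<and>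
        ?s a m v * F ((m(i := m i + - 1))(i := (m(i := m i + - 1)) i + 1)) v = ?s b m v * ?s F m v"
      then have "?s g m v * ?s G m v = ?s f m v * ?s F m v" "?s a m v * F m v = ?s b m v * ?s F m v"
        by simp_all
      then show "?s b m v * ?s g m v * ?s G m v = ?s f m v * ?s a m v * F m v" by algebra
    qed
  qed
  then show ?thesis by simp
qed

lemma rational_multiple_slice:
  assumes "rational_multiple G" "j < q"
  obtains f g where "polyfun p q f" "polyfun p q g" "g \<noteq> (\<lambda>m v. 0)"
    "generically p q U (\<lambda>m v. \<forall>\<^sub>F t in nhds (v j). g m (v(j := t)) \<noteq> 0 \<and>
      G m (v(j := t)) = f m (v(j := t)) / g m (v(j := t)) * F m (v(j := t)))"
proof -
  obtain f g where fg: "polyfun p q f" "polyfun p q g" "g \<noteq> (\<lambda>m v. 0)"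
    and G: "generically p q U (\<lambda>m v. g m v * G m v = f m v * F m v)"
    using assms(1) by (rule rational_multipleE)
  have "generically p q U (\<lambda>m v. g m v \<noteq> 0 \<and> G m v = f m v / g m v * F m v)"
    using generically_conj[OF generically_nonzero[OF fg(2,3)] G]
    by (rule generically_mono) (simp add: eq_divide_eq mult.commute)
  from generically_slice[OF this open_domain assms(2)] show ?thesis
    by (rule that[OF fg generically_mono]) (auto elim!: eventually_mono)
qed

text \<open>
  Near a generic point a rational multiple of \<open>F\<close> equals \<open>f / g * F\<close> with \<open>g\<close> nonvanishing. It is
  thus differentiable because \<open>F\<close> is, and the derivative is again a rational multiple of \<open>F\<close>, since
  the derivative of \<open>F\<close> is one. Derivatives of any order and in any order thus exist
  generically.
\<close>

lemma rational_multiple_has_derivative: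
  assumes "rational_multiple G" "j < q"
  obtains G' where "rational_multiple G'"
    "generically p q U (\<lambda>m v. ((\<lambda>t. G m (v(j := t))) has_field_derivative G' m v) (at (v j)))"
proof -
  obtain f g where fg: "polyfun p q f" "polyfun p q g" "g \<noteq> (\<lambda>m v. 0)"
    and G: "generically p q U (\<lambda>m v. \<forall>\<^sub>F t in nhds (v j). g m (v(j := t)) \<noteq> 0 \<and>
      G m (v(j := t)) = f m (v(j := t)) / g m (v(j := t)) * F m (v(j := t)))"
    using rational_multiple_slice[OF assms] .
  obtain f' where f': "polyfun p q f'"
    "\<And>m v. ((\<lambda>t. f m (v(j := t))) has_field_derivative f' m v) (at (v j))"
    using polyfun_has_derivative[OF fg(1)] by blast
  obtain g' where g': "polyfun p q g'"
    "\<And>m v. ((\<lambda>t. g m (v(j := t))) has_field_derivative g' m v) (at (v j))"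
    using polyfun_has_derivative[OF fg(2)] by blast
  obtain a b where ab: "polyfun p q a" "polyfun p q b" "a \<noteq> (\<lambda>m v. 0)"
    and F: "generically p q U (\<lambda>m v. a m v * partial_deriv j F m v = b m v * F m v)"
    using derivative_relation[OF assms(2)] by blast
  define G' where "G' = (\<lambda>m v. (f' m v * g m v - f m v * g' m v) / (g m v * g m v) * F m v +
      partial_deriv j F m v * (f m v / g m v))"
  have "generically p q U (\<lambda>m v. ((\<lambda>t. G m (v(j := t))) has_field_derivative G' m v) (at (v j)))"
    using G
  proof (rule generically_mono)
    fix m v
    assume m: "m \<in> int_points p" and v: "v \<in> U"
      and ev: "\<forall>\<^sub>F t in nhds (v j). g m (v(j := t)) \<noteq> 0 \<and>
        G m (v(j := t)) = f m (v(j := t)) / g m (v(j := t)) * F m (v(j := t))"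
    have nz: "g m v \<noteq> 0" using eventually_nhds_x_imp_x[OF ev] by simp
    have "((\<lambda>t. F m (v(j := t))) has_field_derivative partial_deriv j F m v) (at (v j))"
      unfolding partial_deriv_def using differentiable[OF m v assms(2)]
      by (simp add: DERIV_deriv_iff_field_differentiable)
    moreover have "((\<lambda>t. f m (v(j := t)) / g m (v(j := t))) has_field_derivative
        (f' m v * g m v - f m v * g' m v) / (g m v * g m v)) (at (v j))"
      using DERIV_divide[OF f'(2)[of m v] g'(2)[of m v]] nz by simp
    ultimately have D: "((\<lambda>t. f m (v(j := t)) / g m (v(j := t)) * F m (v(j := t)))
        has_field_derivative G' m v) (at (v j))"
      unfolding G'_def by (auto dest: DERIV_mult simp only: fun_upd_triv)
    have ev': "\<forall>\<^sub>F t in nhds (v j).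
        G m (v(j := t)) = f m (v(j := t)) / g m (v(j := t)) * F m (v(j := t))"
      using ev by eventually_elim simp
    show "((\<lambda>t. G m (v(j := t))) has_field_derivative G' m v) (at (v j))"
      using D by (simp only: DERIV_cong_ev[OF refl ev' refl])
  qed
  moreover have "rational_multiple G'"
  proof (rule rational_multipleI)
    show "polyfun p q (\<lambda>m v. a m v * (f' m v * g m v - f m v * g' m v) + f m v * g m v * b m v)"
      "polyfun p q (\<lambda>m v. a m v * (g m v * g m v))"
      using fg f' g' ab by (auto intro!: polyfun.intros polyfun_diff)
    show "(\<lambda>m v. a m v * (g m v * g m v)) \<noteq> (\<lambda>m v. 0)"
      using polyfun_mult_nonzero[OF ab(1) polyfun.mult[OF fg(2,2)] ab(3)
        polyfun_mult_nonzero[OF fg(2,2,3,3)]] .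
    show "generically p q U (\<lambda>m v. a m v * (g m v * g m v) * G' m v =
        (a m v * (f' m v * g m v - f m v * g' m v) + f m v * g m v * b m v) * F m v)"
      using generically_conj[OF F generically_nonzero[OF fg(2,3)]]
    proof (rule generically_mono)
      fix m v assume *: "a m v * partial_deriv j F m v = b m v * F m v \<and> g m v \<noteq> 0"
      then have "(g m v * g m v) * G' m v = (f' m v * g m v - f m v * g' m v) * F m v +
          f m v * g m v * partial_deriv j F m v"
        by (simp add: G'_def field_simps)
      then show "a m v * (g m v * g m v) * G' m v =
          (a m v * (f' m v * g m v - f m v * g' m v) + f m v * g m v * b m v) * F m v"
        using * by algebra
    qed
  qed
  ultimately show ?thesis using that by blast
qed

lemma rational_multiple_differentiable:
  assumes "rational_multiple G" "j < q"
  shows "generically p q U (\<lambda>m v.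
    ((\<lambda>t. G m (v(j := t))) has_field_derivative partial_deriv j G m v) (at (v j)))"
proof -
  obtain G' where "generically p q U (\<lambda>m v.
      ((\<lambda>t. G m (v(j := t))) has_field_derivative G' m v) (at (v j)))"
    using rational_multiple_has_derivative[OF assms] .
  then show ?thesis
    by (rule generically_mono) (simp add: partial_deriv_def DERIV_imp_deriv)
qed

lemma rational_multiple_partial_deriv:
  assumes "rational_multiple G" "j < q"
  shows "rational_multiple (partial_deriv j G)"
proof -
  obtain G' where "rational_multiple G'" "generically p q U (\<lambda>m v.
      ((\<lambda>t. G m (v(j := t))) has_field_derivative G' m v) (at (v j)))"
    using rational_multiple_has_derivative[OF assms] .
  then show ?thesis
    by (rule rational_multiple_cong[OF _ generically_mono])
      (simp add: partial_deriv_def DERIV_imp_deriv)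
qed

lemma rational_multiple_step:
  "rational_multiple G \<Longrightarrow> t < p + q \<Longrightarrow> rational_multiple (step p t G)"
  using rational_multiple_back_shift rational_multiple_partial_deriv by (auto simp: step_def)

lemma rational_multiple_delta:
  "rational_multiple G \<Longrightarrow> t < p + q \<Longrightarrow> rational_multiple (delta p t G)"
  using rational_multiple_back_shift rational_multiple_partial_deriv
  by (auto simp: delta_def intro!: rational_multiple_diff)

lemma partial_deriv_cong:
  assumes "generically p q U (\<lambda>m v. G m v = H m v)" "j < q"
  shows "generically p q U (\<lambda>m v. partial_deriv j G m v = partial_deriv j H m v)"
  using generically_slice[OF assms(1) open_domain assms(2)]
  by (rule generically_mono)
    (auto simp: partial_deriv_def elim!: eventually_mono intro!: deriv_cong_ev)

lemma step_cong:
  assumes "generically p q U (\<lambda>m v. G m v = H m v)" "t < p + q"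
  shows "generically p q U (\<lambda>m v. step p t G m v = step p t H m v)"
  using partial_deriv_cong[OF assms(1), of "t - p"] generically_shift[OF assms(1), of t "-1"] assms(2)
  by (cases "t < p") (simp_all add: step_def)

lemma delta_eq_step:
  "delta p t G m v = step p t G m v - (if t < p then G m v else 0)"
  by (simp add: delta_def step_def)

lemma delta_cong:
  assumes "generically p q U (\<lambda>m v. G m v = H m v)" "t < p + q"
  shows "generically p q U (\<lambda>m v. delta p t G m v = delta p t H m v)"
  using generically_conj[OF assms(1) step_cong[OF assms]]
  by (rule generically_mono) (simp add: delta_eq_step)

lemma step_add:
  assumes "rational_multiple G" "rational_multiple H" "t < p + q"
  shows "generically p q U (\<lambda>m v. step p t (\<lambda>m v. G m v + H m v) m v = step p t G m v + step p t H m v)"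
proof (cases "t < p")
  case True
  then show ?thesis by (auto simp: step_def intro: generically_always)
next
  case False
  then have "t - p < q" using assms(3) by simp
  with assms have "generically p q U (\<lambda>m v.
    ((\<lambda>x. G m (v(t - p := x))) has_field_derivative partial_deriv (t - p) G m v) (at (v (t - p))) \<and>
    ((\<lambda>x. H m (v(t - p := x))) has_field_derivative partial_deriv (t - p) H m v) (at (v (t - p))))"
    by (intro generically_conj rational_multiple_differentiable)
  then show ?thesis
  proof (rule generically_mono)
    fix m v assume *: "((\<lambda>x. G m (v(t - p := x))) has_field_derivative partial_deriv (t - p) G m v) (at (v (t - p))) \<and>
    ((\<lambda>x. H m (v(t - p := x))) has_field_derivative partial_deriv (t - p) H m v) (at (v (t - p)))"
    show "step p t (\<lambda>m v. G m v + H m v) m v = step p t G m v + step p t H m v"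
      using DERIV_imp_deriv[OF DERIV_add[OF conjunct1[OF *] conjunct2[OF *]]] False
      by (simp add: step_def partial_deriv_def)
  qed
qed

text \<open>
  Factors that do not depend on the variable \<open>t\<close> commute with the operator in \<open>t\<close>.
\<close>

lemma step_mult:
  assumes "rational_multiple G" "t < p + q"
    and "\<And>m. t < p \<Longrightarrow> h (m(t := m t - 1)) = h m"
    and "\<And>m v x. t \<ge> p \<Longrightarrow> h m (v(t - p := x)) = h m v"
  shows "generically p q U (\<lambda>m v. step p t (\<lambda>m v. h m v * G m v) m v = h m v * step p t G m v)"
proof (cases "t < p")
  case True
  then show ?thesis using assms(3) by (auto simp: step_def intro: generically_always)
next
  case False
  then have "t - p < q" using assms(2) by simp
  from rational_multiple_differentiable[OF assms(1) this] show ?thesis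
  proof (rule generically_mono)
    fix m v assume *: "((\<lambda>x. G m (v(t - p := x))) has_field_derivative partial_deriv (t - p) G m v) (at (v (t - p)))"
    show "step p t (\<lambda>m v. h m v * G m v) m v = h m v * step p t G m v"
      using DERIV_imp_deriv[OF DERIV_cmult[OF *, of "h m v"]] False assms(4)
      by (simp add: step_def partial_deriv_def)
  qed
qed

lemma delta_add:
  assumes "rational_multiple G" "rational_multiple H" "t < p + q"
  shows "generically p q U (\<lambda>m v.
    delta p t (\<lambda>m v. G m v + H m v) m v = delta p t G m v + delta p t H m v)"
  using step_add[OF assms] by (rule generically_mono) (simp add: delta_eq_step)

lemma delta_mult:
  assumes "rational_multiple G" "t < p + q"
    and "\<And>m. t < p \<Longrightarrow> h (m(t := m t - 1)) = h m"
    and "\<And>m v x. t \<ge> p \<Longrightarrow> h m (v(t - p := x)) = h m v"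
  shows "generically p q U (\<lambda>m v. delta p t (\<lambda>m v. h m v * G m v) m v = h m v * delta p t G m v)"
proof -
  have "generically p q U (\<lambda>m v. step p t (\<lambda>m v. h m v * G m v) m v = h m v * step p t G m v)"
    by (rule step_mult[where h = h, OF assms(1,2)]) (use assms(3,4) in auto)
  then show ?thesis by (rule generically_mono) (simp add: delta_eq_step algebra_simps)
qed

lemma delta_scale:
  assumes "rational_multiple G" "t < p + q"
  shows "generically p q U (\<lambda>m v. delta p t (\<lambda>m v. c * G m v) m v = c * delta p t G m v)"
  using delta_mult[OF assms, of "\<lambda>m v. c"] by simp

lemma delta_zero: "delta p t (\<lambda>m v. 0) m v = 0"
  by (simp add: delta_def partial_deriv_def)

end

section \<open>Summation and integration by parts\<close>

text \<open>
  The normalisation makes index \<open>g + 1\<close> go to index \<open>g\<close>, without any constants, both under the forward difference and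
  under minus the derivative, which are the formal adjoints of the two kinds of \<open>\<partial>\<^sub>t\<close>.
\<close>

definition weight :: "nat \<Rightarrow> nat \<Rightarrow> nat \<Rightarrow> dcfun" where
  "weight p t g = (\<lambda>m v. if t < p then of_int (m t) gchoose g else (- v (t - p)) ^ g / fact g)"

lemma weight_0 [simp]: "weight p t 0 m v = 1"
  by (simp add: weight_def)

lemma polyfun_weight:
  assumes "t < p + q"
  shows "polyfun p q (weight p t g)"
proof (cases "t < p")
  case True
  have "polyfun p q (\<lambda>m v. 1 / fact g * (\<Prod>i\<in>{0..<g}. of_int (m t) - of_nat i))"
    by (intro polyfun.mult polyfun.const polyfun_prod polyfun_diff polyfun.discrete True)
  then show ?thesis using True by (simp add: weight_def gbinomial_prod_rev)
next
  case False
  then have "polyfun p q (\<lambda>m v. 1 / fact g * ((-1) * v (t - p)) ^ g)"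
    using assms by (intro polyfun.mult polyfun.const polyfun_power polyfun.continuous) auto
  then show ?thesis using False by (simp add: weight_def)
qed

context first_order_system
begin

text \<open>
  The product rule. In the discrete case the weight has to be shifted forward
  inside \<open>H\<close>, since the backward shift in \<open>\<partial>\<^sub>t\<close> moves it back.
\<close>

lemma delta_by_parts:
  assumes "rational_multiple G" "t < p + q"
  shows "\<exists>H. rational_multiple H \<and> generically p q U (\<lambda>m v.
    weight p t (Suc g) m v * delta p t G m v = delta p t H m v + weight p t g m v * G m v)"
proof (cases "t < p")
  case True
  let ?w = "\<lambda>m v. weight p t (Suc g) (m(t := m t + 1)) v"
  have "rational_multiple (\<lambda>m v. ?w m v * G m v)"
    by (rule rational_multiple_mult[OF assms(1) polyfun_shift[OF polyfun_weight[OF assms(2)]]])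
  moreover have "weight p t (Suc g) m v * delta p t G m v =
      delta p t (\<lambda>m v. ?w m v * G m v) m v + weight p t g m v * G m v" for m v
  proof -
    have "?w m v = weight p t (Suc g) m v + weight p t g m v"
      using gbinomial_Suc_Suc[of "of_int (m t) :: complex" g] True by (simp add: weight_def)
    moreover have "delta p t (\<lambda>m v. ?w m v * G m v) m v =
        weight p t (Suc g) m v * G (m(t := m t - 1)) v - ?w m v * G m v"
      using True by (simp add: delta_def)
    moreover have "delta p t G m v = G (m(t := m t - 1)) v - G m v"
      using True by (simp add: delta_def)
    ultimately show ?thesis by algebra
  qed
  ultimately show ?thesis by (intro exI conjI generically_always)
next
  case False
  define j where "j = t - p"
  have j: "j < q" using False assms(2) by (auto simp: j_def)
  have "rational_multiple (\<lambda>m v. weight p t (Suc g) m v * G m v)"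
    by (rule rational_multiple_mult[OF assms(1) polyfun_weight[OF assms(2)]])
  moreover have "generically p q U (\<lambda>m v.
    weight p t (Suc g) m v * delta p t G m v =
      delta p t (\<lambda>m v. weight p t (Suc g) m v * G m v) m v + weight p t g m v * G m v)"
    using rational_multiple_differentiable[OF assms(1) j]
  proof (rule generically_mono)
    fix m v assume G: "((\<lambda>x. G m (v(j := x))) has_field_derivative partial_deriv j G m v) (at (v j))"
    have "((\<lambda>x. (- x) ^ Suc g / fact (Suc g)) has_field_derivative
        (of_nat (Suc g) * (- v j) ^ g * (-1)) / fact (Suc g)) (at (v j))"
      by (auto intro!: derivative_eq_intros simp del: fact_Suc power_Suc)
    also have "(of_nat (Suc g) * (- v j) ^ g * (-1)) / fact (Suc g) = - ((- v j) ^ g / fact g :: complex)"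
      by (simp add: divide_simps del: of_nat_Suc)
    finally have w: "((\<lambda>x. (- x) ^ Suc g / fact (Suc g)) has_field_derivative
        - ((- v j) ^ g / fact g)) (at (v j))" .
    have "((\<lambda>x. (- x) ^ Suc g / fact (Suc g) * G m (v(j := x))) has_field_derivative
       - ((- v j) ^ g / fact g) * G m v + partial_deriv j G m v * ((- v j) ^ Suc g / fact (Suc g))) (at (v j))"
      using DERIV_mult[OF w G] by (simp only: fun_upd_triv fun_upd_same)
    from DERIV_imp_deriv[OF this] show "weight p t (Suc g) m v * delta p t G m v =
      delta p t (\<lambda>m v. weight p t (Suc g) m v * G m v) m v + weight p t g m v * G m v"
      using False unfolding delta_def weight_def partial_deriv_def by (simp add: j_def)
  qed
  ultimately show ?thesis by blast
qed

text \<open>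
  The generic sums of \<open>\<partial>\<^sub>t G\<^sub>t\<close> for \<open>t \<in> T\<close>, with rational multiples \<open>G\<^sub>t\<close> of \<open>F\<close>: what
  disappears on summing or integrating over the variables in \<open>T\<close>.
\<close>

definition telescoping :: "nat set \<Rightarrow> dcfun \<Rightarrow> bool" where
  "telescoping T H \<longleftrightarrow> (\<exists>G. (\<forall>t\<in>T. rational_multiple (G t)) \<and>
     generically p q U (\<lambda>m v. H m v = (\<Sum>t\<in>T. delta p t (G t) m v)))"

lemma telescoping_cong:
  assumes "telescoping T G" "generically p q U (\<lambda>m v. H m v = G m v)"
  shows "telescoping T H"
proof -
  obtain A where A: "\<forall>t\<in>T. rational_multiple (A t)"
    "generically p q U (\<lambda>m v. G m v = (\<Sum>t\<in>T. delta p t (A t) m v))"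
    using assms(1) unfolding telescoping_def by blast
  have "generically p q U (\<lambda>m v. H m v = (\<Sum>t\<in>T. delta p t (A t) m v))"
    using generically_conj[OF assms(2) A(2)] by (rule generically_mono) simp
  with A(1) show ?thesis unfolding telescoping_def by blast
qed

lemma telescoping_zero: "telescoping T (\<lambda>m v. 0)"
  unfolding telescoping_def
  by (rule exI[of _ "\<lambda>t m v. 0"])
    (auto intro: generically_always rational_multiple_zero simp: delta_zero)

lemma telescoping_add:
  assumes "telescoping T G" "telescoping T H" "finite T" "T \<subseteq> {..<p + q}"
  shows "telescoping T (\<lambda>m v. G m v + H m v)"
proof -
  obtain A where A: "\<forall>t\<in>T. rational_multiple (A t)"
    "generically p q U (\<lambda>m v. G m v = (\<Sum>t\<in>T. delta p t (A t) m v))"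
    using assms(1) unfolding telescoping_def by blast
  obtain B where B: "\<forall>t\<in>T. rational_multiple (B t)"
    "generically p q U (\<lambda>m v. H m v = (\<Sum>t\<in>T. delta p t (B t) m v))"
    using assms(2) unfolding telescoping_def by blast
  have "generically p q U (\<lambda>m v. \<forall>t\<in>T. delta p t (\<lambda>m v. A t m v + B t m v) m v =
      delta p t (A t) m v + delta p t (B t) m v)"
    using A(1) B(1) assms(3,4) by (intro generically_ball delta_add) auto
  from generically_conj[OF this generically_conj[OF A(2) B(2)]]
  have "generically p q U (\<lambda>m v. G m v + H m v =
      (\<Sum>t\<in>T. delta p t (\<lambda>m v. A t m v + B t m v) m v))"
    by (rule generically_mono) (simp add: sum.distrib)
  then show ?thesis
    unfolding telescoping_def using A(1) B(1)
    by (intro exI[of _ "\<lambda>t m v. A t m v + B t m v"] conjI ballI rational_multiple_add) auto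
qed

lemma telescoping_mult:
  assumes "telescoping T H" "finite T" "T \<subseteq> {..<p + q}" "polyfun p q h"
    and "\<And>t m. t \<in> T \<Longrightarrow> t < p \<Longrightarrow> h (m(t := m t - 1)) = h m"
    and "\<And>t m v x. t \<in> T \<Longrightarrow> t \<ge> p \<Longrightarrow> h m (v(t - p := x)) = h m v"
  shows "telescoping T (\<lambda>m v. h m v * H m v)"
proof -
  obtain A where A: "\<forall>t\<in>T. rational_multiple (A t)"
    "generically p q U (\<lambda>m v. H m v = (\<Sum>t\<in>T. delta p t (A t) m v))"
    using assms(1) unfolding telescoping_def by blast
  have "generically p q U (\<lambda>m v. \<forall>t\<in>T. delta p t (\<lambda>m v. h m v * A t m v) m v =
      h m v * delta p t (A t) m v)"
    using A(1) assms by (intro generically_ball delta_mult) auto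
  from generically_conj[OF this A(2)]
  have "generically p q U (\<lambda>m v. h m v * H m v =
      (\<Sum>t\<in>T. delta p t (\<lambda>m v. h m v * A t m v) m v))"
    by (rule generically_mono) (simp add: sum_distrib_left)
  then show ?thesis
    unfolding telescoping_def using A(1) assms(4)
    by (intro exI[of _ "\<lambda>t m v. h m v * A t m v"] conjI ballI rational_multiple_mult) auto
qed

lemma telescoping_diff:
  assumes "telescoping T G" "telescoping T H" "finite T" "T \<subseteq> {..<p + q}"
  shows "telescoping T (\<lambda>m v. G m v - H m v)"
  using telescoping_add[OF assms(1) telescoping_mult[OF assms(2-4) polyfun.const[of p q "-1"]] assms(3,4)]
  by simp

lemma telescoping_sum:
  assumes "\<And>i. i \<in> I \<Longrightarrow> telescoping T (G i)" "finite T" "T \<subseteq> {..<p + q}"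
  shows "telescoping T (\<lambda>m v. \<Sum>i\<in>I. G i m v)"
  using assms(1)
  by (induction I rule: infinite_finite_induct)
    (auto intro: telescoping_zero telescoping_add[OF _ _ assms(2,3)])

lemma telescoping_delta:
  assumes "rational_multiple G"
  shows "telescoping {t} (delta p t G)"
  unfolding telescoping_def using assms
  by (intro exI[of _ "\<lambda>s. G"]) (auto intro: generically_always)

lemma telescoping_mono:
  assumes "telescoping S H" "S \<subseteq> T" "finite T"
  shows "telescoping T H"
proof -
  obtain A where A: "\<forall>t\<in>S. rational_multiple (A t)"
    "generically p q U (\<lambda>m v. H m v = (\<Sum>t\<in>S. delta p t (A t) m v))"
    using assms(1) unfolding telescoping_def by blast
  let ?A = "\<lambda>t. if t \<in> S then A t else (\<lambda>m v. 0)"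
  have "(\<Sum>t\<in>T. delta p t (?A t) m v) = (\<Sum>t\<in>S. delta p t (A t) m v)" for m v
    using assms(2,3) by (intro sum.mono_neutral_cong_right) (auto simp: delta_zero)
  then show ?thesis
    unfolding telescoping_def using A
    by (intro exI[of _ ?A]) (auto intro: rational_multiple_zero)
qed

lemma telescoping_shift:
  assumes "telescoping T H" "T \<subseteq> {..<p + q}" "i < p" "i \<notin> T"
  shows "telescoping T (\<lambda>m v. H (m(i := m i + 1)) v)"
proof -
  obtain A where A: "\<forall>t\<in>T. rational_multiple (A t)"
    "generically p q U (\<lambda>m v. H m v = (\<Sum>t\<in>T. delta p t (A t) m v))"
    using assms(1) unfolding telescoping_def by blast
  have "delta p t (A t) (m(i := m i + 1)) v = delta p t (\<lambda>m v. A t (m(i := m i + 1)) v) m v"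
    if "t \<in> T" for t m v
  proof -
    have "t \<noteq> i" using that assms(4) by auto
    then show ?thesis by (simp add: delta_def partial_deriv_def fun_upd_twist)
  qed
  with generically_shift[OF A(2) assms(3), of 1]
  have "generically p q U (\<lambda>m v. H (m(i := m i + 1)) v =
      (\<Sum>t\<in>T. delta p t (\<lambda>m v. A t (m(i := m i + 1)) v) m v))"
    by simp
  then show ?thesis
    unfolding telescoping_def using A(1) assms(3) rational_multiple_shift
    by (intro exI[of _ "\<lambda>t m v. A t (m(i := m i + 1)) v"]) blast
qed

lemma rational_multiple_delta_power:
  "rational_multiple x \<Longrightarrow> t < p + q \<Longrightarrow> rational_multiple ((delta p t ^^ j) x)"
  by (induction j) (auto intro: rational_multiple_delta)

text \<open>
  Each application of \<open>delta_by_parts\<close> trades one \<open>\<partial>\<^sub>t\<close> for a decrease of the weight by one. The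
  weight is exhausted first if \<open>j > g\<close>, and then everything telescopes.
\<close>

lemma weight_delta_power:
  assumes "rational_multiple x" "t < p + q"
  shows "telescoping {t} (\<lambda>m v. weight p t g m v * (delta p t ^^ j) x m v -
    (if j \<le> g then weight p t (g - j) m v * x m v else 0))"
proof (induction j arbitrary: g)
  case 0
  then show ?case by (simp add: telescoping_zero)
next
  case (Suc j)
  let ?y = "(delta p t ^^ j) x"
  have y: "rational_multiple ?y" using assms by (rule rational_multiple_delta_power)
  show ?case
  proof (cases g)
    case 0
    then show ?thesis using telescoping_delta[OF y, of t] by simp
  next
    case (Suc k)
    obtain H where H: "rational_multiple H" "generically p q U (\<lambda>m v.
      weight p t (Suc k) m v * delta p t ?y m v = delta p t H m v + weight p t k m v * ?y m v)"
      using delta_by_parts[OF y assms(2)] by blast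
    have "telescoping {t} (\<lambda>m v. delta p t H m v + (weight p t k m v * ?y m v -
        (if j \<le> k then weight p t (k - j) m v * x m v else 0)))"
      using assms(2) by (intro telescoping_add telescoping_delta H(1) Suc.IH) auto
    then show ?thesis
      by (rule telescoping_cong, intro generically_mono[OF H(2)]) (simp add: Suc)
  qed
qed

end

section \<open>Elimination of the summation and integration variables\<close>

text \<open>
  The order of the operators is fixed by the list, so that no interchange of
  partial derivatives is ever required.
\<close>

fun iterated_delta :: "nat \<Rightarrow> nat list \<Rightarrow> nat list \<Rightarrow> dcfun \<Rightarrow> dcfun" where
  "iterated_delta p (t # ts) (j # js) G = (delta p t ^^ j) (iterated_delta p ts js G)"
| "iterated_delta p _ _ G = G"

context first_order_system
begin

lemma rational_multiple_iterated_delta: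
  assumes "rational_multiple G" "set ts \<subseteq> {..<p + q}"
  shows "rational_multiple (iterated_delta p ts js G)"
  using assms(2)
proof (induction ts arbitrary: js)
  case Nil
  show ?case using assms(1) by simp
next
  case (Cons t ts)
  then show ?case using assms(1) by (cases js) (auto intro: rational_multiple_delta_power)
qed

lemma delta_power_cong:
  assumes "generically p q U (\<lambda>m v. G m v = H m v)" "t < p + q"
  shows "generically p q U (\<lambda>m v. (delta p t ^^ j) G m v = (delta p t ^^ j) H m v)"
  by (induction j) (auto intro: assms delta_cong)

lemma delta_power_add:
  assumes "rational_multiple G" "rational_multiple H" "t < p + q"
  shows "generically p q U (\<lambda>m v. (delta p t ^^ j) (\<lambda>m v. G m v + c * H m v) m v =
    (delta p t ^^ j) G m v + c * (delta p t ^^ j) H m v)"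
proof (induction j)
  case 0
  show ?case by (simp add: generically_always)
next
  case (Suc j)
  let ?P = "\<lambda>G. (delta p t ^^ j) G"
  have X: "rational_multiple (?P G)" "rational_multiple (?P H)"
    using assms by (auto intro: rational_multiple_delta_power)
  from generically_conj[OF delta_cong[OF Suc.IH assms(3)] generically_conj[OF
      delta_add[OF X(1) rational_multiple_scale[OF X(2)] assms(3), of c] delta_scale[OF X(2) assms(3), of c]]]
  show ?case by (rule generically_mono) simp
qed

lemma iterated_delta_add:
  assumes "rational_multiple G" "rational_multiple H" "set ts \<subseteq> {..<p + q}"
  shows "generically p q U (\<lambda>m v. iterated_delta p ts js (\<lambda>m v. G m v + c * H m v) m v =
    iterated_delta p ts js G m v + c * iterated_delta p ts js H m v)"
  using assms(3)
proof (induction ts arbitrary: js)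
  case Nil
  show ?case by (simp add: generically_always)
next
  case (Cons t ts)
  show ?case
  proof (cases js)
    case Nil
    then show ?thesis by (simp add: generically_always)
  next
    case [simp]: (Cons j js')
    have X: "rational_multiple (iterated_delta p ts js' G)" "rational_multiple (iterated_delta p ts js' H)"
      using assms(1,2) Cons.prems by (auto intro: rational_multiple_iterated_delta)
    have t: "t < p + q" using Cons.prems by simp
    have IH: "generically p q U (\<lambda>m v. iterated_delta p ts js' (\<lambda>m v. G m v + c * H m v) m v =
        iterated_delta p ts js' G m v + c * iterated_delta p ts js' H m v)"
      using Cons.IH Cons.prems by simp
    from generically_conj[OF delta_power_cong[OF IH t, of j] delta_power_add[OF X t, of j c]]
    show ?thesis by (rule generically_mono) simp
  qed
qed

lemma iterated_delta_zero: "iterated_delta p ts js (\<lambda>m v. 0) = (\<lambda>m v. 0)"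
proof (induction p ts js "\<lambda>(m :: nat \<Rightarrow> int) (v :: nat \<Rightarrow> complex). 0 :: complex" rule: iterated_delta.induct)
  case (1 p t ts j js)
  have "(delta p t ^^ j) (\<lambda>m v. 0) = (\<lambda>m v. 0)"
    by (induction j) (auto simp: delta_def partial_deriv_def fun_eq_iff)
  then show ?case using 1 by simp
qed auto

lemma iterated_delta_sum:
  assumes "finite I" "\<And>i. i \<in> I \<Longrightarrow> rational_multiple (G i)" "set ts \<subseteq> {..<p + q}"
  shows "generically p q U (\<lambda>m v. iterated_delta p ts js (\<lambda>m v. \<Sum>i\<in>I. c i * G i m v) m v =
    (\<Sum>i\<in>I. c i * iterated_delta p ts js (G i) m v))"
  using assms(1,2)
proof (induction I rule: finite_induct)
  case empty
  show ?case by (simp add: iterated_delta_zero generically_always)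
next
  case (insert i I)
  have X: "rational_multiple (\<lambda>m v. \<Sum>i\<in>I. c i * G i m v)"
    using insert by (intro rational_multiple_sum rational_multiple_scale) auto
  have "generically p q U (\<lambda>m v.
      iterated_delta p ts js (\<lambda>m v. (\<Sum>i\<in>I. c i * G i m v) + c i * G i m v) m v =
      iterated_delta p ts js (\<lambda>m v. \<Sum>i\<in>I. c i * G i m v) m v + c i * iterated_delta p ts js (G i) m v)"
    using X insert.prems assms(3) by (intro iterated_delta_add) auto
  moreover have "generically p q U (\<lambda>m v. iterated_delta p ts js (\<lambda>m v. \<Sum>i\<in>I. c i * G i m v) m v =
    (\<Sum>i\<in>I. c i * iterated_delta p ts js (G i) m v))"
    using insert by auto
  ultimately have "generically p q U (\<lambda>m v.
      iterated_delta p ts js (\<lambda>m v. (\<Sum>i\<in>I. c i * G i m v) + c i * G i m v) m v =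
      (\<Sum>i\<in>I. c i * iterated_delta p ts js (G i) m v) + c i * iterated_delta p ts js (G i) m v)"
    by (rule generically_mono[OF generically_conj]) simp
  then show ?case using insert.hyps by (simp add: add.commute)
qed

text \<open>
  The weight for the outermost operator with the least exponent \<open>g\<close> removes this operator from the
  relation and leaves only the terms that had exponent exactly \<open>g\<close>; these form a nonempty
  family \<open>\<Gamma>'\<close>. Sums of \<open>\<partial>\<^sub>s\<close> that were collected for other variables \<open>s\<close> survive the
  multiplication by this weight, which commutes with \<open>\<partial>\<^sub>s\<close>.
\<close>

lemma elimination:
  assumes "finite \<Gamma>" "\<Gamma> \<noteq> {}" "\<And>\<gamma>. \<gamma> \<in> \<Gamma> \<Longrightarrow> length \<gamma> = length ts \<and> rational_multiple (y \<gamma>)"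
    and "distinct ts" "set ts \<subseteq> {..<p + q}" "T \<subseteq> {..<p + q}" "T \<inter> set ts = {}"
    and "telescoping T (\<lambda>m v. \<Sum>\<gamma>\<in>\<Gamma>. iterated_delta p ts \<gamma> (y \<gamma>) m v)"
  shows "\<exists>\<gamma>\<in>\<Gamma>. telescoping (T \<union> set ts) (y \<gamma>)"
  using assms
proof (induction ts arbitrary: \<Gamma> T y)
  case Nil
  then have "\<Gamma> = {[]}" by auto
  with Nil show ?case by simp
next
  case (Cons t ts)
  define g where "g = Min (hd ` \<Gamma>)"
  define \<Gamma>' where "\<Gamma>' = {\<gamma>. g # \<gamma> \<in> \<Gamma>}"
  have t: "t < p + q" "t \<notin> T" "t \<notin> set ts" using Cons.prems by auto
  have finT: "finite (insert t T)" and subT: "insert t T \<subseteq> {..<p + q}"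
    using Cons.prems t by (auto intro: finite_subset)
  have nonempty: "\<gamma> \<noteq> []" if "\<gamma> \<in> \<Gamma>" for \<gamma>
    using Cons.prems(3)[OF that] by auto
  have "g \<in> hd ` \<Gamma>" unfolding g_def using Cons.prems(1,2) by (intro Min_in) auto
  then obtain \<gamma>0 where "\<gamma>0 \<in> \<Gamma>" "hd \<gamma>0 = g" by auto
  then have "tl \<gamma>0 \<in> \<Gamma>'" using nonempty by (auto simp: \<Gamma>'_def)
  have "\<Gamma>' \<subseteq> tl ` \<Gamma>" by (force simp: \<Gamma>'_def image_iff)
  then have fin: "finite \<Gamma>'" using Cons.prems(1) finite_subset by blast
  have bound: "g \<le> hd \<gamma>" if "\<gamma> \<in> \<Gamma>" for \<gamma>
    unfolding g_def using Cons.prems(1) that by simp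
  let ?z = "\<lambda>\<gamma>. iterated_delta p ts (tl \<gamma>) (y \<gamma>)"
  have z: "rational_multiple (?z \<gamma>)" if "\<gamma> \<in> \<Gamma>" for \<gamma>
    using Cons.prems(3)[OF that] Cons.prems(5) by (intro rational_multiple_iterated_delta) auto
  have expand: "iterated_delta p (t # ts) \<gamma> (y \<gamma>) = (delta p t ^^ hd \<gamma>) (?z \<gamma>)" if "\<gamma> \<in> \<Gamma>" for \<gamma>
    using nonempty[OF that] by (cases \<gamma>) auto
  have "telescoping T (\<lambda>m v. \<Sum>\<gamma>\<in>\<Gamma>. (delta p t ^^ hd \<gamma>) (?z \<gamma>) m v)"
    using Cons.prems(8) by (simp add: expand cong: sum.cong)
  then have "telescoping T (\<lambda>m v. weight p t g m v * (\<Sum>\<gamma>\<in>\<Gamma>. (delta p t ^^ hd \<gamma>) (?z \<gamma>) m v))"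
  proof (rule telescoping_mult)
    show "finite T" using finT by simp
    show "polyfun p q (weight p t g)" by (rule polyfun_weight[OF t(1)])
    show "weight p t g (m(s := m s - 1)) = weight p t g m" if "s \<in> T" "s < p" for s m
      using that t(2) by (auto simp: weight_def)
    show "weight p t g m (v(s - p := x)) = weight p t g m v" if "s \<in> T" "s \<ge> p" for s m v x
    proof -
      have "t < p \<or> t - p \<noteq> s - p" using that t(2) by (metis eq_diff_iff not_less)
      then show ?thesis by (auto simp: weight_def)
    qed
  qed (use Cons.prems in auto)
  then have 1: "telescoping (insert t T)
      (\<lambda>m v. \<Sum>\<gamma>\<in>\<Gamma>. weight p t g m v * (delta p t ^^ hd \<gamma>) (?z \<gamma>) m v)"
    using finT by (auto simp: sum_distrib_left intro: telescoping_mono)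
  have 2: "telescoping (insert t T) (\<lambda>m v. \<Sum>\<gamma>\<in>\<Gamma>. weight p t g m v * (delta p t ^^ hd \<gamma>) (?z \<gamma>) m v -
      (if hd \<gamma> \<le> g then weight p t (g - hd \<gamma>) m v * ?z \<gamma> m v else 0))"
    using finT subT by (intro telescoping_sum telescoping_mono[OF weight_delta_power[OF z t(1)]]) auto
  have "telescoping (insert t T) (\<lambda>m v. \<Sum>\<gamma>\<in>\<Gamma>.
      if hd \<gamma> \<le> g then weight p t (g - hd \<gamma>) m v * ?z \<gamma> m v else 0)"
    using telescoping_diff[OF 1 2 finT subT] by (simp add: sum_subtractf)
  also have "(\<lambda>m v. \<Sum>\<gamma>\<in>\<Gamma>. if hd \<gamma> \<le> g then weight p t (g - hd \<gamma>) m v * ?z \<gamma> m v else 0) =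
      (\<lambda>m v. \<Sum>\<gamma>\<in>\<Gamma>'. iterated_delta p ts \<gamma> (y (g # \<gamma>)) m v)"
  proof (intro ext)
    fix m v
    have "(\<Sum>\<gamma>\<in>\<Gamma>'. iterated_delta p ts \<gamma> (y (g # \<gamma>)) m v) = (\<Sum>\<gamma>\<in>(#) g ` \<Gamma>'. ?z \<gamma> m v)"
      by (subst sum.reindex) auto
    also have "\<dots> = (\<Sum>\<gamma>\<in>\<Gamma>. if hd \<gamma> \<le> g then weight p t (g - hd \<gamma>) m v * ?z \<gamma> m v else 0)"
    proof (rule sum.mono_neutral_cong_left)
      show "\<forall>\<gamma>\<in>\<Gamma> - (#) g ` \<Gamma>'.
          (if hd \<gamma> \<le> g then weight p t (g - hd \<gamma>) m v * ?z \<gamma> m v else 0) = 0"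
      proof
        fix \<gamma> assume \<gamma>: "\<gamma> \<in> \<Gamma> - (#) g ` \<Gamma>'"
        then obtain k ks where k: "\<gamma> = k # ks" using nonempty by (cases \<gamma>) auto
        then have "k \<noteq> g" using \<gamma> by (auto simp: \<Gamma>'_def)
        then show "(if hd \<gamma> \<le> g then weight p t (g - hd \<gamma>) m v * ?z \<gamma> m v else 0) = 0"
          using bound[of \<gamma>] \<gamma> k by auto
      qed
    qed (use Cons.prems(1) in \<open>auto simp: \<Gamma>'_def\<close>)
    finally show "(\<Sum>\<gamma>\<in>\<Gamma>. if hd \<gamma> \<le> g then weight p t (g - hd \<gamma>) m v * ?z \<gamma> m v else 0) =
      (\<Sum>\<gamma>\<in>\<Gamma>'. iterated_delta p ts \<gamma> (y (g # \<gamma>)) m v)" by simp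
  qed
  finally have tel: "telescoping (insert t T)
    (\<lambda>m v. \<Sum>\<gamma>\<in>\<Gamma>'. iterated_delta p ts \<gamma> (y (g # \<gamma>)) m v)" .
  have "\<exists>\<gamma>\<in>\<Gamma>'. telescoping (insert t T \<union> set ts) (y (g # \<gamma>))"
  proof (rule Cons.IH[OF fin _ _ _ _ subT _ tel])
    show "\<Gamma>' \<noteq> {}" using \<open>tl \<gamma>0 \<in> \<Gamma>'\<close> by auto
    show "length \<gamma> = length ts \<and> rational_multiple (y (g # \<gamma>))" if "\<gamma> \<in> \<Gamma>'" for \<gamma>
      using that Cons.prems(3)[of "g # \<gamma>"] by (auto simp: \<Gamma>'_def)
  qed (use Cons.prems t in auto)
  then show ?case by (auto simp: \<Gamma>'_def)
qed

end

context first_order_system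
begin

section \<open>The dimension count\<close>

lemma rational_multiple_step_power:
  "t < p + q \<Longrightarrow> rational_multiple ((step p t ^^ b) F)"
  by (induction b) (auto intro: rational_multiple_self rational_multiple_step)

text \<open>
  The relation is grouped by the exponents \<open>\<gamma>\<close> of the operators to be eliminated. Only those \<open>\<gamma>\<close>
  with a nonzero coefficient enter the elimination, so that the surviving
  operator in \<open>t0\<close> is nonzero whichever \<open>\<gamma>\<close> it belongs to.
\<close>

lemma telescoper_of_relation:
  fixes c :: "nat list \<times> nat \<times> nat \<Rightarrow> complex" and N :: nat and ts :: "nat list"
  defines "\<Gamma>0 \<equiv> {\<gamma>. set \<gamma> \<subseteq> {..N} \<and> length \<gamma> = length ts}"
  assumes t0: "t0 < p + q" and ts: "distinct ts" "set ts = {..<p + q} - {t0}"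
    and nonzero: "\<exists>i\<in>\<Gamma>0 \<times> {..N} \<times> {..N}. c i \<noteq> 0"
    and relation: "generically p q U (\<lambda>m v. (\<Sum>(\<gamma>, a, b)\<in>\<Gamma>0 \<times> {..N} \<times> {..N}. c (\<gamma>, a, b) *
      iterated_delta p ts \<gamma> (\<lambda>m v. coord_value p m v t0 ^ a * (step p t0 ^^ b) F m v) m v) = 0)"
  shows "\<exists>d. (\<exists>b\<le>N. d b \<noteq> 0) \<and> telescoping ({..<p + q} - {t0})
    (\<lambda>m v. \<Sum>b\<le>N. poly (d b) (coord_value p m v t0) * (step p t0 ^^ b) F m v)"
proof -
  let ?P = "{..N} \<times> {..N}"
  define x where "x = (\<lambda>k m v. coord_value p m v t0 ^ fst k * (step p t0 ^^ snd k) F m v)"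
  define y where "y = (\<lambda>\<gamma> m v. \<Sum>k\<in>?P. c (\<gamma>, k) * x k m v)"
  define \<Gamma> where "\<Gamma> = {\<gamma>\<in>\<Gamma>0. \<exists>k\<in>?P. c (\<gamma>, k) \<noteq> 0}"
  have fin0: "finite \<Gamma>0" unfolding \<Gamma>0_def by (rule finite_lists_length_eq) simp
  then have fin: "finite \<Gamma>" unfolding \<Gamma>_def by simp
  have x: "rational_multiple (x k)" for k
    unfolding x_def using t0
    by (intro rational_multiple_mult rational_multiple_step_power polyfun_power polyfun_coord_value)
  have sub: "set ts \<subseteq> {..<p + q}" using ts(2) by auto
  have lin: "generically p q U (\<lambda>m v. iterated_delta p ts \<gamma> (y \<gamma>) m v =
      (\<Sum>k\<in>?P. c (\<gamma>, k) * iterated_delta p ts \<gamma> (x k) m v))" for \<gamma>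
    unfolding y_def using x sub by (intro iterated_delta_sum) auto
  have "generically p q U (\<lambda>m v. (\<Sum>\<gamma>\<in>\<Gamma>. iterated_delta p ts \<gamma> (y \<gamma>) m v) = 0)"
    using generically_conj[OF relation generically_ball[OF fin lin]]
  proof (rule generically_mono)
    fix m v
    assume *: "(\<Sum>(\<gamma>, a, b)\<in>\<Gamma>0 \<times> {..N} \<times> {..N}. c (\<gamma>, a, b) *
      iterated_delta p ts \<gamma> (\<lambda>m v. coord_value p m v t0 ^ a * (step p t0 ^^ b) F m v) m v) = 0 \<and>
      (\<forall>\<gamma>\<in>\<Gamma>. iterated_delta p ts \<gamma> (y \<gamma>) m v =
        (\<Sum>k\<in>?P. c (\<gamma>, k) * iterated_delta p ts \<gamma> (x k) m v))"
    then have "(\<Sum>\<gamma>\<in>\<Gamma>. iterated_delta p ts \<gamma> (y \<gamma>) m v) =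
        (\<Sum>\<gamma>\<in>\<Gamma>. \<Sum>k\<in>?P. c (\<gamma>, k) * iterated_delta p ts \<gamma> (x k) m v)" by simp
    also have "\<dots> = (\<Sum>\<gamma>\<in>\<Gamma>0. \<Sum>k\<in>?P. c (\<gamma>, k) * iterated_delta p ts \<gamma> (x k) m v)"
    proof (rule sum.mono_neutral_left[OF fin0])
      show "\<forall>\<gamma>\<in>\<Gamma>0 - \<Gamma>. (\<Sum>k\<in>?P. c (\<gamma>, k) * iterated_delta p ts \<gamma> (x k) m v) = 0"
        by (intro ballI sum.neutral) (auto simp: \<Gamma>_def)
    qed (auto simp: \<Gamma>_def)
    also have "\<dots> = (\<Sum>(\<gamma>, k)\<in>\<Gamma>0 \<times> ?P. c (\<gamma>, k) * iterated_delta p ts \<gamma> (x k) m v)"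
      by (rule sum.cartesian_product)
    also have "\<dots> = 0"
      using * by (simp add: x_def case_prod_unfold)
    finally show "(\<Sum>\<gamma>\<in>\<Gamma>. iterated_delta p ts \<gamma> (y \<gamma>) m v) = 0" .
  qed
  then have tel: "telescoping {} (\<lambda>m v. \<Sum>\<gamma>\<in>\<Gamma>. iterated_delta p ts \<gamma> (y \<gamma>) m v)"
    by (rule telescoping_cong[OF telescoping_zero])
  have "\<exists>\<gamma>\<in>\<Gamma>. telescoping ({} \<union> set ts) (y \<gamma>)"
  proof (rule elimination[OF fin _ _ ts(1) sub _ _ tel])
    show "\<Gamma> \<noteq> {}" using nonzero by (auto simp: \<Gamma>_def)
    show "length \<gamma> = length ts \<and> rational_multiple (y \<gamma>)" if "\<gamma> \<in> \<Gamma>" for \<gamma>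
      using that unfolding y_def
      by (auto simp: \<Gamma>_def \<Gamma>0_def intro!: rational_multiple_sum rational_multiple_scale x)
  qed auto
  then obtain \<gamma> where \<gamma>: "\<gamma> \<in> \<Gamma>" "telescoping (set ts) (y \<gamma>)" by auto
  define d where "d = (\<lambda>b. \<Sum>a\<le>N. monom (c (\<gamma>, a, b)) a)"
  have "coeff (d b) a = c (\<gamma>, a, b)" if "a \<le> N" for a b
    using that by (simp add: d_def coeff_sum)
  moreover obtain a b where "a \<le> N" "b \<le> N" "c (\<gamma>, a, b) \<noteq> 0"
    using \<gamma>(1) by (auto simp: \<Gamma>_def)
  ultimately have "\<exists>b\<le>N. d b \<noteq> 0" by (metis coeff_0)
  moreover have "y \<gamma> = (\<lambda>m v. \<Sum>b\<le>N. poly (d b) (coord_value p m v t0) * (step p t0 ^^ b) F m v)"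
  proof (intro ext)
    fix m v
    have "y \<gamma> m v = (\<Sum>a\<le>N. \<Sum>b\<le>N. c (\<gamma>, a, b) * x (a, b) m v)"
      by (simp add: y_def sum.cartesian_product)
    also have "\<dots> = (\<Sum>b\<le>N. \<Sum>a\<le>N. c (\<gamma>, a, b) * x (a, b) m v)"
      by (rule sum.swap)
    finally show "y \<gamma> m v = (\<Sum>b\<le>N. poly (d b) (coord_value p m v t0) * (step p t0 ^^ b) F m v)"
      by (simp add: d_def x_def poly_sum poly_monom sum_distrib_right mult.assoc)
  qed
  ultimately show ?thesis using \<gamma>(2) ts(2) by auto
qed

text \<open>
  Here \<open>rep \<nu>\<close> stands for a filtration whose \<open>\<nu>\<close>-th piece has dimension at most
  \<open>C * (\<nu> + 1) ^ (p + q)\<close> for large \<open>\<nu>\<close>, expressed by the existence of linear relations.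
  Multiplication by a variable may cost two steps: on generating functions, multiplication by a discrete
  variable is the Euler operator \<open>z \<partial>/\<partial>z\<close>, of degree two.
\<close>

theorem telescoper_of_slow_filtration:
  fixes rep :: "nat \<Rightarrow> dcfun \<Rightarrow> bool"
  assumes t0: "t0 < p + q"
    and rep_self: "rep 0 F"
    and rep_Suc: "\<And>\<nu> G. rep \<nu> G \<Longrightarrow> rep (Suc \<nu>) G"
    and rep_step: "\<And>\<nu> G t. rep \<nu> G \<Longrightarrow> rational_multiple G \<Longrightarrow> t < p + q \<Longrightarrow> rep (Suc \<nu>) (step p t G)"
    and rep_delta: "\<And>\<nu> G t. rep \<nu> G \<Longrightarrow> rational_multiple G \<Longrightarrow> t < p + q \<Longrightarrow> rep (Suc \<nu>) (delta p t G)"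
    and rep_coord: "\<And>\<nu> G t. rep \<nu> G \<Longrightarrow> rational_multiple G \<Longrightarrow> t < p + q \<Longrightarrow>
      rep (\<nu> + 2) (\<lambda>m v. coord_value p m v t * G m v)"
    and dependent: "\<And>\<nu> (I :: (nat list \<times> nat \<times> nat) set) G. \<nu> \<ge> \<nu>0 \<Longrightarrow> finite I \<Longrightarrow>
      card I > C * (\<nu> + 1) ^ (p + q) \<Longrightarrow> (\<And>i. i \<in> I \<Longrightarrow> rep \<nu> (G i)) \<Longrightarrow>
      \<exists>c. (\<exists>i\<in>I. c i \<noteq> 0) \<and> generically p q U (\<lambda>m v. (\<Sum>i\<in>I. c i * G i m v) = 0)"
  shows "\<exists>d N. (\<exists>b\<le>N. d b \<noteq> 0) \<and> telescoping ({..<p + q} - {t0})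
    (\<lambda>m v. \<Sum>b\<le>N. poly (d b) (coord_value p m v t0) * (step p t0 ^^ b) F m v)"
proof -
  define D where "D = p + q"
  define ts where "ts = sorted_list_of_set ({..<p + q} - {t0})"
  have ts: "distinct ts" "set ts = {..<p + q} - {t0}" by (simp_all add: ts_def)
  have len: "length ts + 1 = D"
    using t0 distinct_card[OF ts(1)] ts(2) by (simp add: D_def)
  \<comment> \<open>The monomials have exponents at most \<open>N\<close>: \<open>D - 1\<close> operators of weight one to be eliminated, one step in \<open>t0\<close>,
    and multiplications by \<open>t0\<close> of weight two, hence total weight at most \<open>(D + 2) * N\<close>.\<close>
  define N where "N = C * (D + 2) ^ D + \<nu>0"
  define \<nu> where "\<nu> = (D + 2) * N"
  have mono: "rep k G \<Longrightarrow> k \<le> l \<Longrightarrow> rep l G" for k l G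
    using rep_Suc by (induction l) (auto simp: le_Suc_eq)
  have delta_power: "rep (k + j) ((delta p t ^^ j) G)"
    if "rep k G" "rational_multiple G" "t < p + q" for k j t G
    using that by (induction j) (auto intro: rep_delta rational_multiple_delta_power)
  have iterated: "rep (k + length ss * N) (iterated_delta p ss \<gamma> G)"
    if "rep k G" "rational_multiple G" "set ss \<subseteq> {..<p + q}" "set \<gamma> \<subseteq> {..N}" for k G ss \<gamma>
    using that(3,4)
  proof (induction ss arbitrary: \<gamma>)
    case Nil
    show ?case using that(1) by simp
  next
    case (Cons t ss)
    show ?case
    proof (cases \<gamma>)
      case Nil
      then show ?thesis using mono[OF that(1)] by simp
    next
      case (Cons j js)
      then have "rep (k + length ss * N + j) (iterated_delta p (t # ss) \<gamma> G)"
        using Cons.IH[of js] Cons.prems that(2)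
        by (auto intro!: delta_power rational_multiple_iterated_delta)
      then show ?thesis using Cons.prems Cons by (elim mono) auto
    qed
  qed
  have step_power: "rep b ((step p t0 ^^ b) F)" for b
    using t0 by (induction b) (auto intro: rep_self rep_step rational_multiple_step_power)
  have mono_step: "rep (b + 2 * a) (\<lambda>m v. coord_value p m v t0 ^ a * (step p t0 ^^ b) F m v)
      \<and> rational_multiple (\<lambda>m v. coord_value p m v t0 ^ a * (step p t0 ^^ b) F m v)" for a b
  proof (induction a)
    case 0
    then show ?case using step_power rational_multiple_step_power[OF t0] by simp
  next
    case (Suc a)
    then show ?case
      using rep_coord[of "b + 2 * a" _ t0] rational_multiple_mult[OF _ polyfun_coord_value[OF t0]] t0
      by (fastforce simp: mult.assoc)
  qed
  define I where "I = {\<gamma>. set \<gamma> \<subseteq> {..N} \<and> length \<gamma> = length ts} \<times> {..N} \<times> {..N}"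
  have fin: "finite I" unfolding I_def by (intro finite_cartesian_product finite_lists_length_eq) auto
  have "card I = (N + 1) ^ length ts * ((N + 1) * (N + 1))"
    unfolding I_def by (simp add: card_cartesian_product card_lists_length_eq)
  then have card: "card I = (N + 1) * (N + 1) ^ D"
    using len by (metis (no_types, lifting) Suc_eq_plus1 mult.assoc mult.commute power_Suc)
  have "C * (\<nu> + 1) ^ D \<le> C * ((D + 2) * (N + 1)) ^ D"
    unfolding \<nu>_def by (intro mult_left_mono power_mono) (auto simp: algebra_simps)
  also have "\<dots> = (C * (D + 2) ^ D) * (N + 1) ^ D"
    by (simp only: power_mult_distrib mult.assoc)
  also have "\<dots> < (N + 1) * (N + 1) ^ D"
    by (intro mult_strict_right_mono) (auto simp: N_def)
  finally have big: "card I > C * (\<nu> + 1) ^ (p + q)"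
    using card by (simp add: D_def)
  have "N \<le> \<nu>" by (simp add: \<nu>_def)
  then have "\<nu>0 \<le> \<nu>" by (simp add: N_def)
  let ?G = "\<lambda>(\<gamma>, a, b). iterated_delta p ts \<gamma> (\<lambda>m v. coord_value p m v t0 ^ a * (step p t0 ^^ b) F m v)"
  have "rep \<nu> (?G i)" if "i \<in> I" for i
  proof -
    obtain \<gamma> a b where i_eq: "i = (\<gamma>, a, b)" by (cases i)
    with that have i: "i = (\<gamma>, a, b)" "set \<gamma> \<subseteq> {..N}" "a \<le> N" "b \<le> N"
      by (simp_all add: I_def)
    have "rep (b + 2 * a + length ts * N) (?G i)"
      unfolding i prod.case using mono_step[of b a] ts(2) i(2) by (intro iterated) auto
    moreover have "b + 2 * a + length ts * N \<le> N + 2 * N + length ts * N"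
      using i by linarith
    moreover have "N + 2 * N + length ts * N = \<nu>"
      unfolding \<nu>_def len[symmetric] by (simp add: algebra_simps)
    ultimately show ?thesis using mono[of _ "?G i" \<nu>] by simp
  qed
  then have "\<exists>c. (\<exists>i\<in>I. c i \<noteq> 0) \<and> generically p q U (\<lambda>m v. (\<Sum>i\<in>I. c i * ?G i m v) = 0)"
    using dependent[of \<nu> I ?G] \<open>\<nu>0 \<le> \<nu>\<close> fin big by presburger
  then obtain c where c: "\<exists>i\<in>I. c i \<noteq> 0"
    "generically p q U (\<lambda>m v. (\<Sum>i\<in>I. c i * ?G i m v) = 0)" by (elim exE conjE)
  have "\<exists>d. (\<exists>b\<le>N. d b \<noteq> 0) \<and> telescoping ({..<p + q} - {t0})
    (\<lambda>m v. \<Sum>b\<le>N. poly (d b) (coord_value p m v t0) * (step p t0 ^^ b) F m v)"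
    by (rule telescoper_of_relation[OF t0 ts]) (use c in \<open>simp_all add: I_def case_prod_unfold\<close>)
  then show ?thesis by blast
qed

section \<open>Certificates\<close>

lemma ratfun_of_polyfuns:
  assumes "polyfun p q f" "polyfun p q g" "g \<noteq> (\<lambda>m v. 0)"
  obtains R where "is_ratfun p q R" "poly_value p (fst R) = f" "poly_value p (snd R) = g"
proof -
  obtain P where P: "indets P \<subseteq> {..<p + q}" "f = poly_value p P"
    using assms(1) by (auto simp: polyfun_iff_cmpoly)
  obtain Q where Q: "indets Q \<subseteq> {..<p + q}" "Q \<noteq> 0" "g = poly_value p Q"
    using assms(2,3) polyfun_nonzero_iff_cmpoly by blast
  show ?thesis using that[of "(P, Q)"] P Q by (simp add: is_ratfun_def)
qed

text \<open>
  A fraction need not be in lowest terms, so any exceptional polynomial can be put into its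
  denominator. A point without pole is then a point where the generic identities hold.
\<close>

lemma rational_multiple_ratfun:
  assumes "rational_multiple G" "polyfun p q E" "E \<noteq> (\<lambda>m v. 0)"
  shows "\<exists>R. is_ratfun p q R \<and> (\<forall>m\<in>int_points p. \<forall>v\<in>U. no_pole p R m v \<longrightarrow>
    E m v \<noteq> 0 \<and> G m v = ratfun_mult p R F m v)"
proof -
  obtain f g where fg: "polyfun p q f" "polyfun p q g" "g \<noteq> (\<lambda>m v. 0)"
    and G: "generically p q U (\<lambda>m v. g m v * G m v = f m v * F m v)"
    using assms(1) by (rule rational_multipleE)
  obtain e where e: "polyfun p q e" "e \<noteq> (\<lambda>m v. 0)"
    "\<forall>m\<in>int_points p. \<forall>v\<in>U. e m v \<noteq> 0 \<longrightarrow> g m v * G m v = f m v * F m v"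
    using G unfolding generically_def by blast
  define h where "h = (\<lambda>m v. E m v * e m v)"
  have h: "polyfun p q h" "h \<noteq> (\<lambda>m v. 0)"
    unfolding h_def using assms(2,3) e(1,2) polyfun_mult_nonzero by (auto intro: polyfun.mult)
  obtain R where R: "is_ratfun p q R" "poly_value p (fst R) = (\<lambda>m v. h m v * f m v)"
    "poly_value p (snd R) = (\<lambda>m v. h m v * g m v)"
    by (rule ratfun_of_polyfuns[OF polyfun.mult[OF h(1) fg(1)] polyfun.mult[OF h(1) fg(2)]
          polyfun_mult_nonzero[OF h(1) fg(2) h(2) fg(3)]])
  have "E m v \<noteq> 0 \<and> G m v = ratfun_mult p R F m v"
    if "m \<in> int_points p" "v \<in> U" "no_pole p R m v" for m v
  proof -
    have nz: "h m v \<noteq> 0" "g m v \<noteq> 0" using that(3) by (auto simp: no_pole_def R)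
    then have "g m v * G m v = f m v * F m v" using e(3) that by (auto simp: h_def)
    then show ?thesis using nz
      by (simp add: ratfun_mult_def R h_def eq_divide_eq mult.commute)
  qed
  then show ?thesis using R(1) by blast
qed

text \<open>
  For discrete \<open>t\<close> the backward difference of \<open>A t\<close> is the forward difference of minus its
  backward shift. If there are variables besides \<open>t0\<close>, then the exceptional polynomial \<open>E\<close> goes into the
  denominators and \<open>e = 1\<close>; otherwise \<open>E\<close> becomes \<open>e\<close>.
\<close>

lemma certificates_of_telescoping:
  assumes "telescoping T H" "T = {..<p + q} - {t0}" "t0 < p + q"
  shows "\<exists>e R. e \<noteq> 0 \<and> (\<forall>t\<in>T. is_ratfun p q (R t)) \<and>
    (\<forall>m\<in>int_points p. \<forall>v\<in>U.
      (\<forall>t\<in>T. no_pole p (R t) m v \<and> (t < p \<longrightarrow> no_pole p (R t) (m(t := m t + 1)) v)) \<longrightarrow>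
      poly e (coord_value p m v t0) * H m v =
        (\<Sum>t\<in>T \<inter> {..<p}. fdiff t (ratfun_mult p (R t) F) m v) +
        (\<Sum>t\<in>T - {..<p}. partial_deriv (t - p) (ratfun_mult p (R t) F) m v))"
proof -
  obtain A where A: "\<forall>t\<in>T. rational_multiple (A t)"
    "generically p q U (\<lambda>m v. H m v = (\<Sum>t\<in>T. delta p t (A t) m v))"
    using assms(1) unfolding telescoping_def by blast
  obtain E where E: "polyfun p q E" "E \<noteq> (\<lambda>m v. 0)"
    "\<forall>m\<in>int_points p. \<forall>v\<in>U. E m v \<noteq> 0 \<longrightarrow> H m v = (\<Sum>t\<in>T. delta p t (A t) m v)"
    using A(2) unfolding generically_def by blast
  have "finite T" using assms(2) by simp
  show ?thesis
  proof (cases "T = {}")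
    case True
    with assms(2,3) have "card {..<p + q} = 1" by (metis Diff_eq_empty_iff card_1_singleton_iff
      lessThan_iff subset_singletonD One_nat_def empty_iff)
    then have 1: "p + q = 1" by simp
    then have "t0 = 0" using assms(3) by simp
    obtain e where e: "\<forall>m v. E m v = poly e (coord_value p m v 0)"
      using polyfun_univariate[OF E(1) 1] by blast
    have "e \<noteq> 0" using E(2) e by (auto simp: fun_eq_iff)
    moreover have "poly e (coord_value p m v t0) * H m v = 0"
      if "m \<in> int_points p" "v \<in> U" for m v
      using E(3) that e True \<open>t0 = 0\<close> by (cases "E m v = 0") auto
    ultimately show ?thesis using True by (intro exI[of _ e]) simp
  next
    case False
    define B where "B = (\<lambda>t. if t < p then (\<lambda>m v. - A t (m(t := m t - 1)) v) else A t)"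
    have B: "rational_multiple (B t)" if "t \<in> T" for t
    proof (cases "t < p")
      case True
      then show ?thesis
        using rational_multiple_scale[OF rational_multiple_back_shift[of "A t" t], of "-1"] A(1) that
        by (simp add: B_def)
    next
      case False
      then show ?thesis using A(1) that by (simp add: B_def)
    qed
    have deltaB: "delta p t (A t) m v = (if t < p then fdiff t (B t) m v else partial_deriv (t - p) (B t) m v)"
      for t m v
      by (simp add: delta_def B_def fdiff_def shift_def)
    have "\<forall>t\<in>T. \<exists>R. is_ratfun p q R \<and> (\<forall>m\<in>int_points p. \<forall>v\<in>U. no_pole p R m v \<longrightarrow>
        E m v \<noteq> 0 \<and> B t m v = ratfun_mult p R F m v)"
      using rational_multiple_ratfun[OF B E(1,2)] by blast
    from bchoice[OF this] obtain R where R: "\<And>t. t \<in> T \<Longrightarrow> is_ratfun p q (R t)"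
      "\<And>t m v. t \<in> T \<Longrightarrow> m \<in> int_points p \<Longrightarrow> v \<in> U \<Longrightarrow> no_pole p (R t) m v \<Longrightarrow>
        E m v \<noteq> 0 \<and> B t m v = ratfun_mult p (R t) F m v" by blast
    have "H m v = (\<Sum>t\<in>T \<inter> {..<p}. fdiff t (ratfun_mult p (R t) F) m v) +
        (\<Sum>t\<in>T - {..<p}. partial_deriv (t - p) (ratfun_mult p (R t) F) m v)"
      if m: "m \<in> int_points p" and v: "v \<in> U"
        and np: "\<forall>t\<in>T. no_pole p (R t) m v \<and> (t < p \<longrightarrow> no_pole p (R t) (m(t := m t + 1)) v)"
      for m v
    proof -
      have "E m v \<noteq> 0" using False R(2) np m v by blast
      then have "H m v = (\<Sum>t\<in>T. delta p t (A t) m v)" using E(3) m v by blast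
      also have "\<dots> = (\<Sum>t\<in>T \<inter> {..<p}. delta p t (A t) m v) + (\<Sum>t\<in>T - {..<p}. delta p t (A t) m v)"
        using \<open>finite T\<close> by (rule sum.Int_Diff)
      also have "(\<Sum>t\<in>T \<inter> {..<p}. delta p t (A t) m v) =
          (\<Sum>t\<in>T \<inter> {..<p}. fdiff t (ratfun_mult p (R t) F) m v)"
      proof (rule sum.cong[OF refl])
        fix t assume t: "t \<in> T \<inter> {..<p}"
        then have "B t m v = ratfun_mult p (R t) F m v"
          "B t (m(t := m t + 1)) v = ratfun_mult p (R t) F (m(t := m t + 1)) v"
          using R(2) np m v int_points_upd by auto
        then show "delta p t (A t) m v = fdiff t (ratfun_mult p (R t) F) m v"
          using t by (simp add: deltaB fdiff_def shift_def)
      qed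
      also have "(\<Sum>t\<in>T - {..<p}. delta p t (A t) m v) =
          (\<Sum>t\<in>T - {..<p}. partial_deriv (t - p) (ratfun_mult p (R t) F) m v)"
      proof (rule sum.cong[OF refl])
        fix t assume t: "t \<in> T - {..<p}"
        then have tq: "t - p < q" using assms(2) by auto
        have "polyfun p q (poly_value p (snd (R t)))"
          using R(1) t by (auto simp: is_ratfun_def polyfun_iff_cmpoly)
        from eventually_slice_nonzero[OF open_domain v tq this, of m]
        have "\<forall>\<^sub>F x in nhds (v (t - p)).
            v(t - p := x) \<in> U \<and> no_pole p (R t) m (v(t - p := x))"
          using np t by (simp add: no_pole_def)
        then have "\<forall>\<^sub>F x in nhds (v (t - p)).
            B t m (v(t - p := x)) = ratfun_mult p (R t) F m (v(t - p := x))"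
          by eventually_elim (use R(2) t m in blast)
        then have "partial_deriv (t - p) (B t) m v =
            partial_deriv (t - p) (ratfun_mult p (R t) F) m v"
          unfolding partial_deriv_def by (rule deriv_cong_ev) (rule refl)
        then show "delta p t (A t) m v = partial_deriv (t - p) (ratfun_mult p (R t) F) m v"
          using t by (simp add: deltaB)
      qed
      finally show ?thesis .
    qed
    then show ?thesis using R(1) by (intro exI[of _ 1] exI[of _ R]) simp
  qed
qed

end

section \<open>Holonomic terms\<close>

text \<open>
  Stated for families, since different monomials may yield the same function; such a repetition
  is itself a linear relation.
\<close>

lemma dependent_family:
  fixes e :: "'i \<Rightarrow> dcfun"
  assumes "finite I" "finite B" "card I > card B" "\<And>i. i \<in> I \<Longrightarrow> e i \<in> dcfun.span B"
  shows "\<exists>c. (\<exists>i\<in>I. c i \<noteq> 0) \<and> (\<forall>m v. (\<Sum>i\<in>I. c i * e i m v) = 0)"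
proof (cases "inj_on e I")
  case True
  have "dcfun.dependent (e ` I)"
  proof (rule ccontr)
    assume "dcfun.independent (e ` I)"
    then have "card (e ` I) \<le> card B"
      using dcfun.independent_span_bound[OF assms(2)] assms(4) by blast
    then show False using assms(3) card_image[OF True] by simp
  qed
  then obtain u where u: "\<exists>x\<in>e ` I. u x \<noteq> 0" "(\<Sum>x\<in>e ` I. (\<lambda>m v. u x * x m v)) = 0"
    unfolding dcfun.dependent_finite[OF finite_imageI[OF assms(1)]] by (elim exE conjE)
  have ev: "(\<Sum>x\<in>X. h x) m v = (\<Sum>x\<in>X. h x m v)" for X and h :: "dcfun \<Rightarrow> dcfun" and m v
    by (induction X rule: infinite_finite_induct) simp_all
  have "(\<Sum>i\<in>I. u (e i) * e i m v) = 0" for m v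
  proof -
    have "(\<Sum>x\<in>e ` I. (\<lambda>m v. u x * x m v)) m v = (\<Sum>x\<in>e ` I. u x * x m v)"
      by (rule ev)
    also have "\<dots> = (\<Sum>i\<in>I. u (e i) * e i m v)"
      by (simp add: sum.reindex[OF True])
    finally show ?thesis unfolding u(2) by (simp only: zero_fun_apply)
  qed
  then show ?thesis using u(1) by (intro exI[of _ "\<lambda>i. u (e i)"]) auto
next
  case False
  then obtain i j where ij: "i \<in> I" "j \<in> I" "i \<noteq> j" "e i = e j" by (auto simp: inj_on_def)
  define c :: "'i \<Rightarrow> complex" where "c = (\<lambda>k. if k = i then 1 else if k = j then -1 else 0)"
  have "(\<Sum>k\<in>I. c k * e k m v) = 0" for m v
  proof -
    have "(\<Sum>k\<in>I. c k * e k m v) = (\<Sum>k\<in>{i, j}. c k * e k m v)"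
      using ij assms(1) by (intro sum.mono_neutral_right) (auto simp: c_def)
    then show ?thesis using ij by (simp add: c_def)
  qed
  moreover have "c i \<noteq> 0" by (simp add: c_def)
  ultimately show ?thesis using ij(1) by blast
qed

lemma poly_le_power_degree:
  fixes h :: "real poly"
  shows "\<exists>C :: nat. \<forall>\<nu> :: nat. poly h (real \<nu>) \<le> real (C * (\<nu> + 1) ^ degree h)"
proof -
  define K where "K = (\<Sum>i\<le>degree h. \<bar>coeff h i\<bar>)"
  have "poly h (real \<nu>) \<le> real (nat \<lceil>K\<rceil> * (\<nu> + 1) ^ degree h)" for \<nu>
  proof -
    have "poly h (real \<nu>) = (\<Sum>i\<le>degree h. coeff h i * real \<nu> ^ i)" by (rule poly_altdef)
    also have "\<dots> \<le> (\<Sum>i\<le>degree h. \<bar>coeff h i\<bar> * real (\<nu> + 1) ^ degree h)"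
    proof (rule sum_mono)
      fix i assume "i \<in> {..degree h}"
      then have "real \<nu> ^ i \<le> real (\<nu> + 1) ^ i" "real (\<nu> + 1) ^ i \<le> real (\<nu> + 1) ^ degree h"
        by (auto intro: power_mono power_increasing)
      then have "real \<nu> ^ i \<le> real (\<nu> + 1) ^ degree h" by linarith
      then show "coeff h i * real \<nu> ^ i \<le> \<bar>coeff h i\<bar> * real (\<nu> + 1) ^ degree h"
        by (intro mult_mono) auto
    qed
    also have "\<dots> = K * real (\<nu> + 1) ^ degree h" by (simp add: K_def sum_distrib_right)
    also have "\<dots> \<le> real (nat \<lceil>K\<rceil>) * real (\<nu> + 1) ^ degree h"
      by (intro mult_right_mono) (auto simp: of_nat_ceiling)
    finally show ?thesis by simp
  qed
  then show ?thesis by blast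
qed

lemma is_ratfun_polyfun:
  assumes "is_ratfun p q R"
  shows "polyfun p q (poly_value p (fst R))" "polyfun p q (poly_value p (snd R))"
    "poly_value p (snd R) \<noteq> (\<lambda>m v. 0)"
  using assms poly_value_eq_0_iff[of "snd R" p q] unfolding is_ratfun_def polyfun_iff_cmpoly by blast+

text \<open>
  A shift relation whose right-hand side is zero forces \<open>F\<close> to vanish generically, and can then be
  replaced by the relation with both coefficients equal to one.
\<close>

lemma first_order_system_hypergeometric:
  assumes "openin (complex_space q) U" "hypergeometric_term p q U F"
  shows "first_order_system p q U F"
proof
  show "openin (complex_space q) U" by fact
  show "(\<lambda>t. F m (v(j := t))) field_differentiable at (v j)"
    if "m \<in> int_points p" "v \<in> U" "j < q" for m v j
    using assms(2) that by (auto simp: hypergeometric_term_def holomorphic_several_def)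
next
  fix i assume i: "i < p"
  then obtain R where R: "is_ratfun p q R" "\<And>m v. m \<in> int_points p \<Longrightarrow> v \<in> U \<Longrightarrow>
      poly_value p (snd R) m v * F (m(i := m i + 1)) v = poly_value p (fst R) m v * F m v"
    using assms(2) by (auto simp: hypergeometric_term_def shift_def)
  let ?a = "poly_value p (snd R)" and ?b = "poly_value p (fst R)"
  have ab: "polyfun p q ?a" "polyfun p q ?b" "?a \<noteq> (\<lambda>m v. 0)"
    using is_ratfun_polyfun[OF R(1)] by simp_all
  show "\<exists>a b. polyfun p q a \<and> polyfun p q b \<and> a \<noteq> (\<lambda>m v. 0) \<and> b \<noteq> (\<lambda>m v. 0) \<and>
      generically p q U (\<lambda>m v. a m v * F (m(i := m i + 1)) v = b m v * F m v)"
  proof (cases "?b = (\<lambda>m v. 0)")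
    case False
    then show ?thesis using ab R(2) by (intro exI[of _ ?a] exI[of _ ?b]) (auto intro: generically_always)
  next
    case True
    have *: "generically p q U (\<lambda>m v. F (m(i := m i + 1)) v = 0)"
      using generically_nonzero[OF ab(1,3)]
    proof (rule generically_mono)
      fix m v assume "m \<in> int_points p" "v \<in> U" "?a m v \<noteq> 0"
      then show "F (m(i := m i + 1)) v = 0" using R(2)[of m v] fun_cong[OF fun_cong[OF True]] by simp
    qed
    from generically_shift[OF * i, of "-1"] have "generically p q U (\<lambda>m v. F m v = 0)" by simp
    with * have "generically p q U (\<lambda>m v. 1 * F (m(i := m i + 1)) v = 1 * F m v)"
      by (rule generically_mono[OF generically_conj]) simp
    then show ?thesis
      by (intro exI[of _ "\<lambda>m v. 1"] conjI polyfun.const) (auto simp: fun_eq_iff)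
  qed
next
  fix j assume "j < q"
  then obtain R where R: "is_ratfun p q R" "\<And>m v. m \<in> int_points p \<Longrightarrow> v \<in> U \<Longrightarrow>
      poly_value p (snd R) m v * partial_deriv j F m v = poly_value p (fst R) m v * F m v"
    using assms(2) by (auto simp: hypergeometric_term_def)
  let ?a = "poly_value p (snd R)" and ?b = "poly_value p (fst R)"
  have "polyfun p q ?a" "polyfun p q ?b" "?a \<noteq> (\<lambda>m v. 0)"
    using is_ratfun_polyfun[OF R(1)] by simp_all
  then show "\<exists>a b. polyfun p q a \<and> polyfun p q b \<and> a \<noteq> (\<lambda>m v. 0) \<and>
      generically p q U (\<lambda>m v. a m v * partial_deriv j F m v = b m v * F m v)"
    using R(2) by (intro exI[of _ ?a] exI[of _ ?b]) (auto intro: generically_always)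
qed

context first_order_system
begin

lemma gen_fun_generically: "generically p q U (\<lambda>m v. G m v = gen_fun p U G m v)"
  by (rule generically_always) (simp add: gen_fun_def)

lemma rational_multiple_gen_fun:
  "rational_multiple G \<Longrightarrow> rational_multiple (gen_fun p U G)"
  using rational_multiple_cong[OF _ gen_fun_generically] .

lemma rational_multiple_weyl_act:
  assumes "rational_multiple G" "g \<in> weyl_gens p q"
  shows "rational_multiple (weyl_act p U g G)"
proof (cases g)
  case (Z i)
  then show ?thesis using assms
    by (auto simp: weyl_gens_def intro!: rational_multiple_gen_fun rational_multiple_back_shift)
next
  case (DZ i)
  then have "i < p" using assms(2) by (auto simp: weyl_gens_def)
  then have "rational_multiple (\<lambda>m v. (of_int (m i) + 1) * G (m(i := m i + 1)) v)"
    using assms(1)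
    by (intro rational_multiple_mult rational_multiple_shift polyfun.add polyfun.discrete polyfun.const)
  then show ?thesis using DZ by (auto intro!: rational_multiple_gen_fun)
next
  case (V j)
  then have "j < q" using assms(2) by (auto simp: weyl_gens_def)
  then show ?thesis using V assms(1)
    by (auto intro!: rational_multiple_gen_fun rational_multiple_mult polyfun.continuous)
next
  case (DV j)
  then show ?thesis using assms
    by (auto simp: weyl_gens_def intro!: rational_multiple_gen_fun rational_multiple_partial_deriv)
qed

lemma weyl_act_add:
  assumes "rational_multiple G" "rational_multiple H" "g \<in> weyl_gens p q"
  shows "generically p q U (\<lambda>m v. weyl_act p U g (\<lambda>m v. G m v + c * H m v) m v =
    weyl_act p U g G m v + c * weyl_act p U g H m v)"
proof (cases g)
  case (DV j)
  then have "p + j < p + q" using assms(3) by (auto simp: weyl_gens_def)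
  from delta_power_add[OF assms(1,2) this, of 1 c] show ?thesis
    by (rule generically_mono) (simp add: DV delta_def gen_fun_def)
qed (auto intro!: generically_always simp: gen_fun_def algebra_simps)

lemma bernstein_piece_subspace: "dcfun.subspace (bernstein_piece p q U F \<nu>)"
  unfolding bernstein_piece_def by (rule dcfun.subspace_span)

lemma bernstein_piece_add:
  "G \<in> bernstein_piece p q U F \<nu> \<Longrightarrow> H \<in> bernstein_piece p q U F \<nu> \<Longrightarrow>
    (\<lambda>m v. G m v + c * H m v) \<in> bernstein_piece p q U F \<nu>"
  using dcfun.subspace_add[OF bernstein_piece_subspace, of G \<nu>, OF _
      dcfun.subspace_scale[OF bernstein_piece_subspace, of H \<nu> c]]
  by (simp add: plus_fun_def)

lemma bernstein_piece_Suc: "bernstein_piece p q U F \<nu> \<subseteq> bernstein_piece p q U F (Suc \<nu>)"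
  unfolding bernstein_piece_def by (intro dcfun.span_mono) (auto intro: le_SucI)

text \<open>
  On arbitrary functions the derivative is not linear. On the span of words in the generators
  applied to \<open>F\<close> it is, generically, as all of them are rational multiples of \<open>F\<close>. Hence the action of a
  generator leads from one piece of the filtration into the next one up to generic equality.
\<close>

lemma bernstein_piece_act:
  assumes "e \<in> bernstein_piece p q U F \<nu>"
  shows "rational_multiple e \<and> (\<forall>g\<in>weyl_gens p q. \<exists>e'\<in>bernstein_piece p q U F (Suc \<nu>).
    generically p q U (\<lambda>m v. e' m v = weyl_act p U g e m v))"
  using assms unfolding bernstein_piece_def[of p q U F \<nu>]
proof (induction rule: dcfun.span_induct_alt)
  case base
  have "generically p q U (\<lambda>m v. (0 :: dcfun) m v = weyl_act p U g 0 m v)" for g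
    by (cases g) (auto intro!: generically_always simp: gen_fun_def partial_deriv_def)
  moreover have "0 \<in> bernstein_piece p q U F (Suc \<nu>)"
    by (rule dcfun.subspace_0[OF bernstein_piece_subspace])
  moreover have "rational_multiple 0" using rational_multiple_zero by (simp add: zero_fun_def)
  ultimately show ?case by blast
next
  case (step c x y)
  then obtain w where w: "x = foldr (weyl_act p U) w (gen_fun p U F)"
    "set w \<subseteq> weyl_gens p q" "length w \<le> \<nu>" by blast
  have x: "rational_multiple x"
    unfolding w(1) using w(2)
    by (induction w) (auto intro: rational_multiple_weyl_act rational_multiple_gen_fun rational_multiple_self)
  have y: "rational_multiple y" using step by blast
  have "(\<lambda>m v. c * x m v) + y = (\<lambda>m v. y m v + c * x m v)"
    by (simp add: plus_fun_def add.commute)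
  moreover have "rational_multiple (\<lambda>m v. y m v + c * x m v)"
    by (intro rational_multiple_add rational_multiple_scale x y)
  moreover have "\<exists>e'\<in>bernstein_piece p q U F (Suc \<nu>).
      generically p q U (\<lambda>m v. e' m v = weyl_act p U g (\<lambda>m v. y m v + c * x m v) m v)"
    if g: "g \<in> weyl_gens p q" for g
  proof -
    obtain e' where e': "e' \<in> bernstein_piece p q U F (Suc \<nu>)"
      "generically p q U (\<lambda>m v. e' m v = weyl_act p U g y m v)" using step g by blast
    have "weyl_act p U g x \<in> bernstein_piece p q U F (Suc \<nu>)"
      unfolding bernstein_piece_def using w g
      by (intro dcfun.span_base CollectI exI[of _ "g # w"]) auto
    from bernstein_piece_add[OF e'(1) this, of c]
    have "(\<lambda>m v. e' m v + c * weyl_act p U g x m v) \<in> bernstein_piece p q U F (Suc \<nu>)" .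
    moreover have "generically p q U (\<lambda>m v. e' m v + c * weyl_act p U g x m v =
        weyl_act p U g (\<lambda>m v. y m v + c * x m v) m v)"
      using generically_conj[OF e'(2) weyl_act_add[OF y x g, of c]] by (rule generically_mono) simp
    ultimately show ?thesis
      by (rule bexI[where x = "\<lambda>m v. e' m v + c * weyl_act p U g x m v", rotated])
  qed
  ultimately show ?case by simp
qed

definition bernstein_rep :: "nat \<Rightarrow> dcfun \<Rightarrow> bool" where
  "bernstein_rep \<nu> G \<longleftrightarrow> (\<exists>e\<in>bernstein_piece p q U F \<nu>. generically p q U (\<lambda>m v. G m v = e m v))"

lemma bernstein_rep_cong:
  assumes "bernstein_rep \<nu> G" "generically p q U (\<lambda>m v. H m v = G m v)"
  shows "bernstein_rep \<nu> H"
proof -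
  obtain e where e: "e \<in> bernstein_piece p q U F \<nu>" "generically p q U (\<lambda>m v. G m v = e m v)"
    using assms(1) by (auto simp: bernstein_rep_def)
  from generically_conj[OF assms(2) e(2)] have "generically p q U (\<lambda>m v. H m v = e m v)"
    by (rule generically_mono) simp
  then show ?thesis using e(1) by (auto simp: bernstein_rep_def)
qed

lemma bernstein_rep_add:
  assumes "bernstein_rep \<nu> G" "bernstein_rep \<nu> H"
  shows "bernstein_rep \<nu> (\<lambda>m v. G m v + c * H m v)"
proof -
  obtain e where e: "e \<in> bernstein_piece p q U F \<nu>" "generically p q U (\<lambda>m v. G m v = e m v)"
    using assms(1) by (auto simp: bernstein_rep_def)
  obtain d where d: "d \<in> bernstein_piece p q U F \<nu>" "generically p q U (\<lambda>m v. H m v = d m v)"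
    using assms(2) by (auto simp: bernstein_rep_def)
  from generically_conj[OF e(2) d(2)]
  have "generically p q U (\<lambda>m v. G m v + c * H m v = e m v + c * d m v)"
    by (rule generically_mono) simp
  then show ?thesis unfolding bernstein_rep_def
    by (rule bexI[where x = "\<lambda>m v. e m v + c * d m v"]) (rule bernstein_piece_add[OF e(1) d(1)])
qed

lemma bernstein_rep_Suc: "bernstein_rep \<nu> G \<Longrightarrow> bernstein_rep (Suc \<nu>) G"
  using bernstein_piece_Suc by (auto simp: bernstein_rep_def)

lemma bernstein_rep_self: "bernstein_rep 0 F"
proof -
  have "gen_fun p U F \<in> bernstein_piece p q U F 0"
    unfolding bernstein_piece_def by (intro dcfun.span_base) auto
  then show ?thesis using gen_fun_generically unfolding bernstein_rep_def by blast
qed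

lemma weyl_act_cong:
  assumes "generically p q U (\<lambda>m v. G m v = H m v)" "g \<in> weyl_gens p q"
  shows "generically p q U (\<lambda>m v. weyl_act p U g G m v = weyl_act p U g H m v)"
proof (cases g)
  case (Z i)
  then have "i < p" using assms(2) by (auto simp: weyl_gens_def)
  from generically_shift[OF assms(1) this, of "-1"] show ?thesis
    by (rule generically_mono) (simp add: Z gen_fun_def)
next
  case (DZ i)
  then have "i < p" using assms(2) by (auto simp: weyl_gens_def)
  from generically_shift[OF assms(1) this, of "1"] show ?thesis
    by (rule generically_mono) (simp add: DZ gen_fun_def)
next
  case (V j)
  from assms(1) show ?thesis
    by (rule generically_mono) (simp add: V gen_fun_def)
next
  case (DV j)
  then have "j < q" using assms(2) by (auto simp: weyl_gens_def)
  from partial_deriv_cong[OF assms(1) this] show ?thesis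
    by (rule generically_mono) (simp add: DV gen_fun_def)
qed

lemma bernstein_rep_act:
  assumes "bernstein_rep \<nu> G" "g \<in> weyl_gens p q"
  shows "bernstein_rep (Suc \<nu>) (weyl_act p U g G)"
proof -
  obtain e where e: "e \<in> bernstein_piece p q U F \<nu>" "generically p q U (\<lambda>m v. G m v = e m v)"
    using assms(1) by (auto simp: bernstein_rep_def)
  obtain e' where e': "e' \<in> bernstein_piece p q U F (Suc \<nu>)"
    "generically p q U (\<lambda>m v. e' m v = weyl_act p U g e m v)"
    using bernstein_piece_act[OF e(1)] assms(2) by blast
  from generically_conj[OF weyl_act_cong[OF e(2) assms(2)] e'(2)]
  have "generically p q U (\<lambda>m v. weyl_act p U g G m v = e' m v)"
    by (rule generically_mono) simp
  then show ?thesis using e'(1) unfolding bernstein_rep_def by blast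
qed

lemma bernstein_rep_step:
  assumes "bernstein_rep \<nu> G" "t < p + q"
  shows "bernstein_rep (Suc \<nu>) (step p t G)"
proof -
  have "(if t < p then Z t else DV (t - p)) \<in> weyl_gens p q"
    using assms(2) by (auto simp: weyl_gens_def)
  from bernstein_rep_act[OF assms(1) this] show ?thesis
    by (rule bernstein_rep_cong) (auto intro: generically_always simp: step_def gen_fun_def)
qed

lemma bernstein_rep_delta:
  assumes "bernstein_rep \<nu> G" "t < p + q"
  shows "bernstein_rep (Suc \<nu>) (delta p t G)"
  by (rule bernstein_rep_cong[OF bernstein_rep_add[OF bernstein_rep_step[OF assms]
        bernstein_rep_Suc[OF assms(1)], of "if t < p then -1 else 0"]])
    (auto intro: generically_always simp: delta_def step_def)

lemma bernstein_rep_coord: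
  assumes "bernstein_rep \<nu> G" "t < p + q"
  shows "bernstein_rep (\<nu> + 2) (\<lambda>m v. coord_value p m v t * G m v)"
proof (cases "t < p")
  case True
  then have "Z t \<in> weyl_gens p q" "DZ t \<in> weyl_gens p q" by (auto simp: weyl_gens_def)
  then have "bernstein_rep (Suc (Suc \<nu>)) (weyl_act p U (Z t) (weyl_act p U (DZ t) G))"
    by (intro bernstein_rep_act assms(1))
  then have "bernstein_rep (\<nu> + 2) (weyl_act p U (Z t) (weyl_act p U (DZ t) G))"
    by (simp only: add_2_eq_Suc')
  then show ?thesis
    by (rule bernstein_rep_cong)
      (auto intro: generically_always simp: gen_fun_def coord_value_def True int_points_upd)
next
  case False
  then have "V (t - p) \<in> weyl_gens p q" using assms(2) by (auto simp: weyl_gens_def)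
  from bernstein_rep_Suc[OF bernstein_rep_act[OF assms(1) this]]
  have "bernstein_rep (\<nu> + 2) (weyl_act p U (V (t - p)) G)" by (simp only: add_2_eq_Suc')
  then show ?thesis
    by (rule bernstein_rep_cong) (auto intro: generically_always simp: gen_fun_def coord_value_def False)
qed

lemma bernstein_piece_finite_basis:
  "\<exists>B. finite B \<and> card B = dcfun.dim (bernstein_piece p q U F \<nu>) \<and>
    bernstein_piece p q U F \<nu> \<subseteq> dcfun.span B"
proof -
  define S where "S = {foldr (weyl_act p U) w (gen_fun p U F) | w.
    set w \<subseteq> weyl_gens p q \<and> length w \<le> \<nu>}"
  have "S = (\<lambda>w. foldr (weyl_act p U) w (gen_fun p U F)) ` {w. set w \<subseteq> weyl_gens p q \<and> length w \<le> \<nu>}"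
    by (auto simp: S_def)
  moreover have "finite {w. set w \<subseteq> weyl_gens p q \<and> length w \<le> \<nu>}"
    by (rule finite_lists_length_le) (simp add: weyl_gens_def)
  ultimately have fin: "finite S" by simp
  obtain B where B: "B \<subseteq> dcfun.span S" "dcfun.independent B" "dcfun.span S \<subseteq> dcfun.span B"
    "card B = dcfun.dim (dcfun.span S)" using dcfun.basis_exists .
  have "finite B" using dcfun.independent_span_bound[OF fin B(2,1)] by blast
  then show ?thesis using B(3,4) unfolding bernstein_piece_def S_def[symmetric] by blast
qed

text \<open>
  A Hilbert polynomial of degree \<open>p + q\<close> bounds the dimension of the Bernstein pieces; if the module
  is zero, then so are all the pieces.
\<close>

lemma holonomic_dependent:
  assumes "holonomic p q U F"
  obtains C \<nu>0 where "\<And>\<nu> (I :: 'i set) G. \<nu> \<ge> \<nu>0 \<Longrightarrow> finite I \<Longrightarrow>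
    card I > C * (\<nu> + 1) ^ (p + q) \<Longrightarrow> (\<And>i. i \<in> I \<Longrightarrow> bernstein_rep \<nu> (G i)) \<Longrightarrow>
    \<exists>c. (\<exists>i\<in>I. c i \<noteq> 0) \<and> generically p q U (\<lambda>m v. (\<Sum>i\<in>I. c i * G i m v) = 0)"
proof -
  have "\<exists>C \<nu>0. \<forall>\<nu>\<ge>\<nu>0. \<exists>B. finite B \<and> card B \<le> C * (\<nu> + 1) ^ (p + q) \<and>
      bernstein_piece p q U F \<nu> \<subseteq> dcfun.span B"
  proof (cases "weyl_module p q U F = {0}")
    case True
    then have "bernstein_piece p q U F \<nu> \<subseteq> dcfun.span {}" for \<nu>
      by (auto simp: weyl_module_def)
    then show ?thesis by (intro exI[of _ 0] allI impI exI[of _ "{}"]) simp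
  next
    case False
    then obtain h where h: "degree h = p + q"
      "\<forall>\<^sub>F \<nu> in sequentially. real (dcfun.dim (bernstein_piece p q U F \<nu>)) = poly h (real \<nu>)"
      using assms by (auto simp: holonomic_def has_bernstein_dim_def)
    obtain \<nu>0 where \<nu>0: "\<And>\<nu>. \<nu> \<ge> \<nu>0 \<Longrightarrow>
        real (dcfun.dim (bernstein_piece p q U F \<nu>)) = poly h (real \<nu>)"
      using h(2) by (auto simp: eventually_sequentially)
    obtain C where C: "\<And>\<nu>. poly h (real \<nu>) \<le> real (C * (\<nu> + 1) ^ degree h)"
      using poly_le_power_degree[of h] by blast
    have "dcfun.dim (bernstein_piece p q U F \<nu>) \<le> C * (\<nu> + 1) ^ (p + q)" if "\<nu> \<ge> \<nu>0" for \<nu>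
      using \<nu>0[OF that] C[of \<nu>] h(1) by (metis of_nat_le_iff)
    then have "\<exists>B. finite B \<and> card B \<le> C * (\<nu> + 1) ^ (p + q) \<and>
        bernstein_piece p q U F \<nu> \<subseteq> dcfun.span B" if "\<nu> \<ge> \<nu>0" for \<nu>
      using bernstein_piece_finite_basis[of \<nu>] that by auto
    then show ?thesis by (intro exI[of _ C] exI[of _ \<nu>0]) simp
  qed
  then obtain C \<nu>0 where B: "\<And>\<nu>. \<nu> \<ge> \<nu>0 \<Longrightarrow> \<exists>B. finite B \<and> card B \<le> C * (\<nu> + 1) ^ (p + q) \<and>
      bernstein_piece p q U F \<nu> \<subseteq> dcfun.span B" by blast
  show ?thesis
  proof (rule that)
    fix \<nu> and I :: "'i set" and G
    assume \<nu>: "\<nu> \<ge> \<nu>0" and I: "finite I" "card I > C * (\<nu> + 1) ^ (p + q)"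
      and G: "\<And>i. i \<in> I \<Longrightarrow> bernstein_rep \<nu> (G i)"
    obtain B where B: "finite B" "card B \<le> C * (\<nu> + 1) ^ (p + q)"
      "bernstein_piece p q U F \<nu> \<subseteq> dcfun.span B" using B[OF \<nu>] by blast
    have "\<forall>i\<in>I. \<exists>e. e \<in> bernstein_piece p q U F \<nu> \<and> generically p q U (\<lambda>m v. G i m v = e m v)"
      using G by (auto simp: bernstein_rep_def)
    then have "\<exists>e. \<forall>i\<in>I. e i \<in> bernstein_piece p q U F \<nu> \<and>
        generically p q U (\<lambda>m v. G i m v = e i m v)" by (rule bchoice)
    then obtain e where e0: "\<forall>i\<in>I. e i \<in> bernstein_piece p q U F \<nu> \<and>
        generically p q U (\<lambda>m v. G i m v = e i m v)" ..
    have e: "e i \<in> bernstein_piece p q U F \<nu>" "generically p q U (\<lambda>m v. G i m v = e i m v)"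
      if "i \<in> I" for i using bspec[OF e0 that] by simp_all
    obtain c where c: "\<exists>i\<in>I. c i \<noteq> 0" "\<forall>m v. (\<Sum>i\<in>I. c i * e i m v) = 0"
      using dependent_family[OF I(1) B(1) le_less_trans[OF B(2) I(2)], of e] e(1) B(3) by auto
    have "generically p q U (\<lambda>m v. (\<Sum>i\<in>I. c i * G i m v) = 0)"
      using generically_ball[OF I(1) e(2)]
    proof (rule generically_mono)
      fix m v assume "\<forall>i\<in>I. G i m v = e i m v"
      then have "(\<Sum>i\<in>I. c i * G i m v) = (\<Sum>i\<in>I. c i * e i m v)" by (intro sum.cong) auto
      then show "(\<Sum>i\<in>I. c i * G i m v) = 0" using c(2) by simp
    qed
    then show "\<exists>c. (\<exists>i\<in>I. c i \<noteq> 0) \<and> generically p q U (\<lambda>m v. (\<Sum>i\<in>I. c i * G i m v) = 0)"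
      using c(1) by (intro exI[of _ c] conjI)
  qed
qed

text \<open>
  The Bernstein filtration, up to generic equality, meets the growth condition by the definition
  of holonomicity.
\<close>

theorem telescoper_of_holonomic:
  assumes "holonomic p q U F" "t0 < p + q"
  shows "\<exists>d N. (\<exists>b\<le>N. d b \<noteq> 0) \<and> telescoping ({..<p + q} - {t0})
    (\<lambda>m v. \<Sum>b\<le>N. poly (d b) (coord_value p m v t0) * (step p t0 ^^ b) F m v)"
proof (rule holonomic_dependent[OF assms(1), where 'i = "nat list \<times> nat \<times> nat"])
  fix C \<nu>0
  assume dep: "\<And>\<nu> (I :: (nat list \<times> nat \<times> nat) set) G. \<nu> \<ge> \<nu>0 \<Longrightarrow> finite I \<Longrightarrow>
    card I > C * (\<nu> + 1) ^ (p + q) \<Longrightarrow> (\<And>i. i \<in> I \<Longrightarrow> bernstein_rep \<nu> (G i)) \<Longrightarrow>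
    \<exists>c. (\<exists>i\<in>I. c i \<noteq> 0) \<and> generically p q U (\<lambda>m v. (\<Sum>i\<in>I. c i * G i m v) = 0)"
  show ?thesis
  proof (rule telescoper_of_slow_filtration[where rep = bernstein_rep and C = C and ?\<nu>0.0 = \<nu>0])
    show "\<exists>c. (\<exists>i\<in>I. c i \<noteq> 0) \<and> generically p q U (\<lambda>m v. (\<Sum>i\<in>I. c i * G i m v) = 0)"
      if "\<nu> \<ge> \<nu>0" "finite I" "card I > C * (\<nu> + 1) ^ (p + q)" "\<And>i. i \<in> I \<Longrightarrow> bernstein_rep \<nu> (G i)"
      for \<nu> and I :: "(nat list \<times> nat \<times> nat) set" and G
      using that by (rule dep)
  qed (use assms(2) bernstein_rep_self in
      \<open>auto intro: bernstein_rep_Suc bernstein_rep_step bernstein_rep_delta bernstein_rep_coord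
        simp del: add_2_eq_Suc'\<close>)
qed

end

section \<open>Proper-hypergeometric terms\<close>

text \<open>
  A bound on the total degree, generated along with the polynomial so that it can be followed
  through products, shifts and Pochhammer symbols without reference to coefficients.
\<close>

inductive degree_le :: "nat \<Rightarrow> nat \<Rightarrow> dcfun \<Rightarrow> bool" for p where
  const: "degree_le p 0 (\<lambda>m v. c)"
| coord: "i < p \<Longrightarrow> degree_le p 1 (\<lambda>m v. of_int (m i))"
| add: "degree_le p d f \<Longrightarrow> degree_le p d g \<Longrightarrow> degree_le p d (\<lambda>m v. f m v + g m v)"
| mult: "degree_le p d f \<Longrightarrow> degree_le p e g \<Longrightarrow> degree_le p (d + e) (\<lambda>m v. f m v * g m v)"
| mono: "degree_le p d f \<Longrightarrow> d \<le> e \<Longrightarrow> degree_le p e f"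

lemma degree_le_const: "degree_le p d (\<lambda>m v. c)"
  by (rule degree_le.mono[OF degree_le.const]) simp

lemma degree_le_polyfun: "degree_le p d f \<Longrightarrow> polyfun p q f"
  by (induction rule: degree_le.induct) (auto intro: polyfun.intros)

lemma polyfun_degree_le: "polyfun p 0 f \<Longrightarrow> \<exists>d. degree_le p d f"
proof (induction rule: polyfun.induct)
  case (add f g)
  then obtain d e where "degree_le p d f" "degree_le p e g" by blast
  then have "degree_le p (max d e) f" "degree_le p (max d e) g"
    by (auto elim: degree_le.mono)
  then show ?case by (blast intro: degree_le.add)
qed (auto intro: degree_le.const degree_le.coord degree_le.mult)

lemma degree_le_sum:
  "(\<And>i. i \<in> I \<Longrightarrow> degree_le p d (f i)) \<Longrightarrow> degree_le p d (\<lambda>m v. \<Sum>i\<in>I. f i m v)"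
  by (induction I rule: infinite_finite_induct) (auto intro: degree_le_const degree_le.add)

lemma degree_le_back_shift:
  "degree_le p d f \<Longrightarrow> degree_le p d (\<lambda>m v. f (m(t := m t - k)) v)"
proof (induction rule: degree_le.induct)
  case (coord i)
  then show ?case
    using degree_le.add[OF degree_le.coord degree_le_const, of i p "- of_int k"] degree_le.coord[of i p]
    by (cases "i = t") auto
qed (auto intro: degree_le.intros)

definition affine_form :: "nat \<Rightarrow> (nat \<Rightarrow> int) \<Rightarrow> complex \<Rightarrow> (nat \<Rightarrow> int) \<Rightarrow> complex" where
  "affine_form p a c m = of_int (\<Sum>i<p. a i * m i) + c"

definition coeff_norm :: "nat \<Rightarrow> (nat \<Rightarrow> int) \<Rightarrow> nat" where
  "coeff_norm p a = nat (\<Sum>i<p. \<bar>a i\<bar>)"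

lemma degree_le_affine_form: "degree_le p 1 (\<lambda>m v. affine_form p a c m)"
proof -
  have "degree_le p 1 (\<lambda>m v. of_int (a i) * of_int (m i))" if "i < p" for i
    using degree_le.mult[OF degree_le.const degree_le.coord[OF that], of "of_int (a i)"] by simp
  then have "degree_le p 1 (\<lambda>m v. (\<Sum>i<p. of_int (a i) * of_int (m i)) + c)"
    by (intro degree_le.add degree_le_sum degree_le_const) auto
  then show ?thesis by (simp add: affine_form_def)
qed

lemma affine_form_upd:
  assumes "t < p"
  shows "affine_form p a c (m(t := m t - k)) = affine_form p a c m - of_int (a t * k)"
proof -
  have "(\<Sum>i<p. a i * (m(t := m t - k)) i) = (\<Sum>i<p. a i * m i - (if i = t then a t * k else 0))"
    by (intro sum.cong) (auto simp: algebra_simps)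
  also have "\<dots> = (\<Sum>i<p. a i * m i) - a t * k"
    using assms by (simp add: sum_subtractf)
  finally show ?thesis by (simp add: affine_form_def)
qed

lemma degree_le_pochhammer:
  "degree_le p 1 f \<Longrightarrow> degree_le p n (\<lambda>m v. pochhammer (f m v) n)"
proof (induction n)
  case 0
  show ?case by (simp add: degree_le_const)
next
  case (Suc n)
  from degree_le.mult[OF Suc.IH[OF Suc.prems] degree_le.add[OF Suc.prems degree_le_const], of "of_nat n"]
  show ?case by (simp add: pochhammer_Suc)
qed

lemma pochhammer_affine_nonzero:
  assumes "coeff_norm p a = 0 \<Longrightarrow> n = 0"
  shows "(\<lambda>m (v :: nat \<Rightarrow> complex). pochhammer (affine_form p a c m) n) \<noteq> (\<lambda>m v. 0)"
  using assms
proof (induction n)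
  case 0
  show ?case by (simp add: fun_eq_iff)
next
  case (Suc n)
  then have "coeff_norm p a \<noteq> 0" by blast
  have "\<not> (\<forall>i<p. a i = 0)"
  proof
    assume "\<forall>i<p. a i = 0"
    then have "coeff_norm p a = 0" by (simp add: coeff_norm_def)
    with \<open>coeff_norm p a \<noteq> 0\<close> show False ..
  qed
  then obtain i where i: "i < p" "a i \<noteq> 0" by auto
  have "(\<lambda>m (v :: nat \<Rightarrow> complex). affine_form p a c m + of_nat n) \<noteq> (\<lambda>m v. 0)"
  proof
    assume "(\<lambda>m (v :: nat \<Rightarrow> complex). affine_form p a c m + of_nat n) = (\<lambda>m v. 0)"
    then have z: "affine_form p a c m + of_nat n = 0" for m by (simp add: fun_eq_iff)
    have "affine_form p a c ((\<lambda>_. 0)(i := 0 - 1)) = affine_form p a c (\<lambda>_. 0) - of_int (a i * 1)"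
      by (rule affine_form_upd[OF i(1), of a c "\<lambda>_. 0" 1])
    then have "affine_form p a c ((\<lambda>_. 0)(i := 0 - 1)) + of_nat n =
        (affine_form p a c (\<lambda>_. 0) + of_nat n) - of_int (a i)" by simp
    then have "(of_int (a i) :: complex) = 0" unfolding z by simp
    then show False using i by simp
  qed
  moreover have "(\<lambda>m (v :: nat \<Rightarrow> complex). pochhammer (affine_form p a c m) n) \<noteq> (\<lambda>m v. 0)"
    using Suc.IH \<open>coeff_norm p a \<noteq> 0\<close> by blast
  moreover have "polyfun p 0 (\<lambda>m v. affine_form p a c m + of_nat n)"
    by (intro polyfun.add polyfun.const degree_le_polyfun[OF degree_le_affine_form])
  moreover have "polyfun p 0 (\<lambda>m v. pochhammer (affine_form p a c m) n)"
    by (rule degree_le_polyfun[OF degree_le_pochhammer[OF degree_le_affine_form]])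
  ultimately have "(\<lambda>m (v :: nat \<Rightarrow> complex). pochhammer (affine_form p a c m) n *
      (affine_form p a c m + of_nat n)) \<noteq> (\<lambda>m v. 0)"
    by (intro polyfun_mult_nonzero)
  then show ?case by (simp only: pochhammer_Suc not_False_eq_True)
qed

text \<open>
  With the value zero of \<open>Gamma\<close> at its poles, the functional equation also holds between poles,
  and it fails only when crossing from the last pole to the first regular point. This is the zero set
  of a polynomial, so for generic identities the convention is harmless.
\<close>

lemma cfact_plus1:
  assumes "z + 1 \<noteq> 0"
  shows "cfact (z + 1) = (z + 1) * cfact z"
proof (cases "z + 1 \<in> \<int>\<^sub>\<le>\<^sub>0")
  case False
  then show ?thesis using Gamma_plus1[of "z + 1"] by (simp add: cfact_def)
next
  case True
  then obtain n where n: "z + 1 = - of_nat n" by (auto elim: nonpos_Ints_cases')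
  then have "n \<noteq> 0" using assms by auto
  then have "z + 1 + 1 = - of_nat (n - 1)" using n by (cases n) auto
  then have "z + 1 + 1 \<in> \<int>\<^sub>\<le>\<^sub>0" by (metis minus_of_nat_in_nonpos_Ints)
  then have "Gamma (z + 1 + 1) = 0" "Gamma (z + 1) = 0"
    using True Gamma_eq_zero_iff by blast+
  then show ?thesis by (simp only: cfact_def mult_zero_right)
qed

lemma cfact_plus_nat:
  assumes "pochhammer (z + 1) n \<noteq> 0"
  shows "cfact (z + of_nat n) = pochhammer (z + 1) n * cfact z"
  using assms
proof (induction n)
  case 0
  show ?case by simp
next
  case (Suc n)
  have "pochhammer (z + 1) n * (z + of_nat n + 1) \<noteq> 0"
    using Suc.prems by (simp only: pochhammer_Suc add_ac) simp
  then have nz: "pochhammer (z + 1) n \<noteq> 0" "z + of_nat n + 1 \<noteq> 0" by auto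
  have "cfact (z + of_nat (Suc n)) = (z + of_nat n + 1) * cfact (z + of_nat n)"
    using cfact_plus1[OF nz(2)] by (simp add: algebra_simps)
  then show ?case using Suc.IH[OF nz(1)] by (simp add: pochhammer_Suc algebra_simps)
qed

lemma abs_coeff_le_norm: "t < p \<Longrightarrow> \<bar>a t\<bar> \<le> int (coeff_norm p a)"
  unfolding coeff_norm_def
  using member_le_sum[of t "{..<p}" "\<lambda>i. \<bar>a i\<bar>"] by (simp add: sum_nonneg)

text \<open>
  If \<open>coeff_norm p a = 0\<close>, then \<open>d = 0\<close> and no factor occurs. Otherwise all factors of the
  Pochhammer symbol are nonconstant affine forms, hence nonzero polynomials.
\<close>

lemma cfact_affine_ratio:
  assumes "d \<le> 2 * coeff_norm p a" "y = x + of_nat d"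
  shows "\<exists>h. degree_le p (2 * coeff_norm p a) h \<and> h \<noteq> (\<lambda>m v. 0) \<and>
    generically p q U (\<lambda>m v. h m v \<noteq> 0 \<and>
      cfact (affine_form p a c m + y) = h m v * cfact (affine_form p a c m + x))"
proof -
  define h where "h = (\<lambda>m (v :: nat \<Rightarrow> complex). pochhammer (affine_form p a (c + x + 1) m) d)"
  have h: "degree_le p d h"
    unfolding h_def by (rule degree_le_pochhammer[OF degree_le_affine_form])
  have nz: "h \<noteq> (\<lambda>m v. 0)"
    unfolding h_def by (rule pochhammer_affine_nonzero) (use assms(1) in simp)
  have "generically p q U (\<lambda>m v. h m v \<noteq> 0 \<and>
      cfact (affine_form p a c m + y) = h m v * cfact (affine_form p a c m + x))"
    using generically_nonzero[OF degree_le_polyfun[OF h] nz]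
  proof (rule generically_mono)
    fix m v assume nz: "h m v \<noteq> 0"
    have "affine_form p a (c + x + 1) m = (affine_form p a c m + x) + 1"
      by (simp add: affine_form_def)
    then show "h m v \<noteq> 0 \<and> cfact (affine_form p a c m + y) = h m v * cfact (affine_form p a c m + x)"
      using cfact_plus_nat[of "affine_form p a c m + x" d] nz assms(2)
      by (simp add: h_def add.assoc)
  qed
  then show ?thesis using degree_le.mono[OF h assms(1)] nz by (intro exI[of _ h] conjI)
qed

text \<open>
  Decreasing a variable by \<open>\<sigma>\<close> changes an affine form by at most its coefficient norm, so the
  argument of a factorial stays within reach of the next kernel: the offset is a natural number,
  and its size is bounded independently of \<open>\<nu>\<close>.
\<close>

lemma shift_offset_bounds:
  assumes "t < p" "\<sigma> = 0 \<or> \<sigma> = 1"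
  shows "0 \<le> int (coeff_norm p a) - a t * \<sigma>" "nat (int (coeff_norm p a) - a t * \<sigma>) \<le> 2 * coeff_norm p a"
    "0 \<le> int (coeff_norm p a) + a t * \<sigma>" "nat (int (coeff_norm p a) + a t * \<sigma>) \<le> 2 * coeff_norm p a"
  using abs_coeff_le_norm[OF assms(1), of a] assms(2) by auto

lemma numerator_factor_step:
  assumes "t < p" "\<sigma> = 0 \<or> \<sigma> = 1"
  shows "\<exists>h. degree_le p (2 * coeff_norm p a) h \<and> h \<noteq> (\<lambda>m v. 0) \<and>
    generically p q U (\<lambda>m v. cfact (affine_form p a c (m(t := m t - \<sigma>)) - of_nat (\<nu> * coeff_norm p a)) =
      h m v * cfact (affine_form p a c m - of_nat (Suc \<nu> * coeff_norm p a)))"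
proof -
  note b = shift_offset_bounds[OF assms, of a]
  let ?d = "nat (int (coeff_norm p a) - a t * \<sigma>)"
  have d: "(of_nat ?d :: complex) = of_nat (coeff_norm p a) - of_int (a t * \<sigma>)"
    using of_nat_nat[OF b(1)] by simp
  have "- of_int (a t * \<sigma>) - of_nat (\<nu> * coeff_norm p a) =
      - (of_nat (Suc \<nu> * coeff_norm p a) :: complex) + of_nat ?d"
    unfolding d by (simp add: algebra_simps)
  from cfact_affine_ratio[OF b(2) this, of q U c] obtain h where
    h: "degree_le p (2 * coeff_norm p a) h" "h \<noteq> (\<lambda>m v. 0)"
    "generically p q U (\<lambda>m v. h m v \<noteq> 0 \<and>
      cfact (affine_form p a c m + (- of_int (a t * \<sigma>) - of_nat (\<nu> * coeff_norm p a))) =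
      h m v * cfact (affine_form p a c m + - of_nat (Suc \<nu> * coeff_norm p a)))"
    by (elim exE conjE)
  from h(3) have "generically p q U (\<lambda>m v.
      cfact (affine_form p a c (m(t := m t - \<sigma>)) - of_nat (\<nu> * coeff_norm p a)) =
      h m v * cfact (affine_form p a c m - of_nat (Suc \<nu> * coeff_norm p a)))"
  proof (rule generically_mono)
    fix m v
    have 1: "affine_form p a c (m(t := m t - \<sigma>)) - of_nat (\<nu> * coeff_norm p a) =
        affine_form p a c m + (- of_int (a t * \<sigma>) - of_nat (\<nu> * coeff_norm p a))"
      by (simp add: affine_form_upd[OF assms(1)])
    assume "h m v \<noteq> 0 \<and>
      cfact (affine_form p a c m + (- of_int (a t * \<sigma>) - of_nat (\<nu> * coeff_norm p a))) =
      h m v * cfact (affine_form p a c m + - of_nat (Suc \<nu> * coeff_norm p a))"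
    then show "cfact (affine_form p a c (m(t := m t - \<sigma>)) - of_nat (\<nu> * coeff_norm p a)) =
      h m v * cfact (affine_form p a c m - of_nat (Suc \<nu> * coeff_norm p a))"
      by (simp only: 1 add_uminus_conv_diff)
  qed
  then show ?thesis using h(1,2) by (intro exI[of _ h] conjI)
qed

lemma denominator_factor_step:
  assumes "t < p" "\<sigma> = 0 \<or> \<sigma> = 1"
  shows "\<exists>h. degree_le p (2 * coeff_norm p a) h \<and> h \<noteq> (\<lambda>m v. 0) \<and>
    generically p q U (\<lambda>m v. inverse (cfact (affine_form p a c (m(t := m t - \<sigma>)) + of_nat (\<nu> * coeff_norm p a))) =
      h m v * inverse (cfact (affine_form p a c m + of_nat (Suc \<nu> * coeff_norm p a))))"
proof -
  note b = shift_offset_bounds[OF assms, of a]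
  let ?d = "nat (int (coeff_norm p a) + a t * \<sigma>)"
  have d: "(of_nat ?d :: complex) = of_nat (coeff_norm p a) + of_int (a t * \<sigma>)"
    using of_nat_nat[OF b(3)] by simp
  have "(of_nat (Suc \<nu> * coeff_norm p a) :: complex) =
      (- of_int (a t * \<sigma>) + of_nat (\<nu> * coeff_norm p a)) + of_nat ?d"
    unfolding d by (simp add: algebra_simps)
  from cfact_affine_ratio[OF b(4) this, of q U c] obtain h where
    h: "degree_le p (2 * coeff_norm p a) h" "h \<noteq> (\<lambda>m v. 0)"
    "generically p q U (\<lambda>m v. h m v \<noteq> 0 \<and>
      cfact (affine_form p a c m + of_nat (Suc \<nu> * coeff_norm p a)) =
      h m v * cfact (affine_form p a c m + (- of_int (a t * \<sigma>) + of_nat (\<nu> * coeff_norm p a))))"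
    by (elim exE conjE)
  from h(3) have "generically p q U (\<lambda>m v.
      inverse (cfact (affine_form p a c (m(t := m t - \<sigma>)) + of_nat (\<nu> * coeff_norm p a))) =
      h m v * inverse (cfact (affine_form p a c m + of_nat (Suc \<nu> * coeff_norm p a))))"
  proof (rule generically_mono)
    fix m v
    let ?x = "affine_form p a c m + (- of_int (a t * \<sigma>) + of_nat (\<nu> * coeff_norm p a))"
    let ?y = "affine_form p a c m + of_nat (Suc \<nu> * coeff_norm p a)"
    have 1: "affine_form p a c (m(t := m t - \<sigma>)) + of_nat (\<nu> * coeff_norm p a) = ?x"
      unfolding affine_form_upd[OF assms(1)] by (simp only: diff_conv_add_uminus add.assoc)
    assume asm: "h m v \<noteq> 0 \<and> cfact ?y = h m v * cfact ?x"
    note nz = conjunct1[OF asm] and y = conjunct2[OF asm]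
    have "h m v * inverse (cfact ?y) = (h m v * inverse (h m v)) * inverse (cfact ?x)"
      unfolding y by (simp only: inverse_mult_distrib mult.assoc)
    also have "\<dots> = inverse (cfact ?x)" using nz by simp
    finally have "inverse (cfact ?x) = h m v * inverse (cfact ?y)" by (rule sym)
    then show "inverse (cfact (affine_form p a c (m(t := m t - \<sigma>)) + of_nat (\<nu> * coeff_norm p a))) =
      h m v * inverse (cfact ?y)"
      by (simp only: 1)
  qed
  then show ?thesis using h(1,2) by (intro exI[of _ h] conjI)
qed

lemma prod_list_step:
  assumes "\<And>x. x \<in> set xs \<Longrightarrow> \<exists>h. degree_le p (k x) h \<and> h \<noteq> (\<lambda>m v. 0) \<and>
    generically p q U (\<lambda>m v. \<phi> x m = h m v * \<psi> x m)"
  shows "\<exists>h. degree_le p (\<Sum>x\<leftarrow>xs. k x) h \<and> h \<noteq> (\<lambda>m v. 0) \<and>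
    generically p q U (\<lambda>m v. (\<Prod>x\<leftarrow>xs. \<phi> x m) = h m v * (\<Prod>x\<leftarrow>xs. \<psi> x m))"
  using assms
proof (induction xs)
  case Nil
  show ?case
    by (intro exI[of _ "\<lambda>m v. 1"] conjI) (auto intro: degree_le_const generically_always simp: fun_eq_iff)
next
  case (Cons x xs)
  have "\<exists>h. degree_le p (\<Sum>x\<leftarrow>xs. k x) h \<and> h \<noteq> (\<lambda>m v. 0) \<and>
    generically p q U (\<lambda>m v. (\<Prod>x\<leftarrow>xs. \<phi> x m) = h m v * (\<Prod>x\<leftarrow>xs. \<psi> x m))"
    by (rule Cons.IH) (rule Cons.prems, simp)
  then obtain h where h: "degree_le p (\<Sum>x\<leftarrow>xs. k x) h" "h \<noteq> (\<lambda>m v. 0)"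
    "generically p q U (\<lambda>m v. (\<Prod>x\<leftarrow>xs. \<phi> x m) = h m v * (\<Prod>x\<leftarrow>xs. \<psi> x m))"
    by (elim exE conjE)
  have "x \<in> set (x # xs)" by simp
  from Cons.prems[OF this] obtain g where g: "degree_le p (k x) g" "g \<noteq> (\<lambda>m v. 0)"
    "generically p q U (\<lambda>m v. \<phi> x m = g m v * \<psi> x m)"
    by (elim exE conjE)
  have "(\<lambda>m v. g m v * h m v) \<noteq> (\<lambda>m v. 0)"
    using polyfun_mult_nonzero[OF degree_le_polyfun[OF g(1)] degree_le_polyfun[OF h(1)] g(2) h(2)] .
  moreover have "generically p q U (\<lambda>m v.
      (\<Prod>x\<leftarrow>x # xs. \<phi> x m) = g m v * h m v * (\<Prod>x\<leftarrow>x # xs. \<psi> x m))"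
    using generically_conj[OF g(3) h(3)] by (rule generically_mono) simp
  ultimately show ?case
    using degree_le.mult[OF g(1) h(1)]
    by (intro exI[of _ "\<lambda>m v. g m v * h m v"] conjI) (simp_all only: list.map sum_list.Cons simp_thms)
qed

text \<open>
  A common base for all shifts of the term by at most \<open>\<nu>\<close>: numerator factorials are lowered and
  denominator factorials are raised by the largest amounts that such a shift can cause.
\<close>

definition gamma_kernel :: "nat \<Rightarrow> ((nat \<Rightarrow> int) \<times> complex) list \<Rightarrow> ((nat \<Rightarrow> int) \<times> complex) list \<Rightarrow>
    nat \<Rightarrow> (nat \<Rightarrow> complex) \<Rightarrow> nat \<Rightarrow> (nat \<Rightarrow> int) \<Rightarrow> complex" where
  "gamma_kernel p num den r \<xi> \<nu> m =
     (\<Prod>x\<leftarrow>num. cfact (affine_form p (fst x) (snd x) m - of_nat (\<nu> * coeff_norm p (fst x)))) *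
     (\<Prod>x\<leftarrow>den. inverse (cfact (affine_form p (fst x) (snd x) m + of_nat (\<nu> * coeff_norm p (fst x))))) *
     (\<Prod>i=1..r. \<xi> i powi m i)"

definition kernel_growth :: "nat \<Rightarrow> ((nat \<Rightarrow> int) \<times> complex) list \<Rightarrow> ((nat \<Rightarrow> int) \<times> complex) list \<Rightarrow> nat"
  where
  "kernel_growth p num den = (\<Sum>x\<leftarrow>num. 2 * coeff_norm p (fst x)) + (\<Sum>x\<leftarrow>den. 2 * coeff_norm p (fst x))"

text \<open>
  Both \<open>\<sigma> = 0\<close> and \<open>\<sigma> = 1\<close> are of use: the former passes to the next kernel, the latter does so while
  shifting. In either case the cost is a polynomial factor of fixed degree.
\<close>

lemma gamma_kernel_step:
  assumes "t < p" "\<sigma> = 0 \<or> \<sigma> = 1" "\<And>i. i \<in> {1..r} \<Longrightarrow> \<xi> i \<noteq> 0"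
  shows "\<exists>h. degree_le p (kernel_growth p num den) h \<and> h \<noteq> (\<lambda>m v. 0) \<and>
    generically p q U (\<lambda>m v. gamma_kernel p num den r \<xi> \<nu> (m(t := m t - \<sigma>)) =
      h m v * gamma_kernel p num den r \<xi> (Suc \<nu>) m)"
proof -
  define w where "w = (\<Prod>i=1..r. \<xi> i powi (if i = t then - \<sigma> else 0))"
  have w: "w \<noteq> 0" using assms(3) by (auto simp: w_def)
  have xi: "(\<Prod>i=1..r. \<xi> i powi (m(t := m t - \<sigma>)) i) = w * (\<Prod>i=1..r. \<xi> i powi m i)" for m
    unfolding w_def prod.distrib[symmetric]
  proof (rule prod.cong[OF refl])
    fix i assume "i \<in> {1..r}"
    then show "\<xi> i powi (m(t := m t - \<sigma>)) i = \<xi> i powi (if i = t then - \<sigma> else 0) * \<xi> i powi m i"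
      using power_int_add[of "\<xi> i" "- \<sigma>" "m i"] assms(3) by auto
  qed
  have "\<exists>f. degree_le p (\<Sum>x\<leftarrow>num. 2 * coeff_norm p (fst x)) f \<and> f \<noteq> (\<lambda>m v. 0) \<and>
    generically p q U (\<lambda>m v.
      (\<Prod>x\<leftarrow>num. cfact (affine_form p (fst x) (snd x) (m(t := m t - \<sigma>)) - of_nat (\<nu> * coeff_norm p (fst x)))) =
      f m v * (\<Prod>x\<leftarrow>num. cfact (affine_form p (fst x) (snd x) m - of_nat (Suc \<nu> * coeff_norm p (fst x)))))"
    by (rule prod_list_step) (rule numerator_factor_step[OF assms(1,2)])
  then obtain f where f: "degree_le p (\<Sum>x\<leftarrow>num. 2 * coeff_norm p (fst x)) f" "f \<noteq> (\<lambda>m v. 0)"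
    "generically p q U (\<lambda>m v.
      (\<Prod>x\<leftarrow>num. cfact (affine_form p (fst x) (snd x) (m(t := m t - \<sigma>)) - of_nat (\<nu> * coeff_norm p (fst x)))) =
      f m v * (\<Prod>x\<leftarrow>num. cfact (affine_form p (fst x) (snd x) m - of_nat (Suc \<nu> * coeff_norm p (fst x)))))"
    by (elim exE conjE)
  have "\<exists>g. degree_le p (\<Sum>x\<leftarrow>den. 2 * coeff_norm p (fst x)) g \<and> g \<noteq> (\<lambda>m v. 0) \<and>
    generically p q U (\<lambda>m v.
      (\<Prod>x\<leftarrow>den. inverse (cfact (affine_form p (fst x) (snd x) (m(t := m t - \<sigma>)) + of_nat (\<nu> * coeff_norm p (fst x))))) =
      g m v * (\<Prod>x\<leftarrow>den. inverse (cfact (affine_form p (fst x) (snd x) m + of_nat (Suc \<nu> * coeff_norm p (fst x))))))"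
    by (rule prod_list_step) (rule denominator_factor_step[OF assms(1,2)])
  then obtain g where g: "degree_le p (\<Sum>x\<leftarrow>den. 2 * coeff_norm p (fst x)) g" "g \<noteq> (\<lambda>m v. 0)"
    "generically p q U (\<lambda>m v.
      (\<Prod>x\<leftarrow>den. inverse (cfact (affine_form p (fst x) (snd x) (m(t := m t - \<sigma>)) + of_nat (\<nu> * coeff_norm p (fst x))))) =
      g m v * (\<Prod>x\<leftarrow>den. inverse (cfact (affine_form p (fst x) (snd x) m + of_nat (Suc \<nu> * coeff_norm p (fst x))))))"
    by (elim exE conjE)
  let ?h = "\<lambda>m v. w * (f m v * g m v)"
  have "degree_le p (kernel_growth p num den) ?h"
    using degree_le.mult[OF degree_le.const degree_le.mult[OF f(1) g(1)], of w]
    by (simp add: kernel_growth_def)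
  moreover have "?h \<noteq> (\<lambda>m v. 0)"
    using polyfun_mult_nonzero[OF degree_le_polyfun[OF f(1)] degree_le_polyfun[OF g(1)] f(2) g(2)] w
    by (auto simp: fun_eq_iff)
  moreover have "generically p q U (\<lambda>m v. gamma_kernel p num den r \<xi> \<nu> (m(t := m t - \<sigma>)) =
      ?h m v * gamma_kernel p num den r \<xi> (Suc \<nu>) m)"
    using generically_conj[OF f(3) g(3)]
    by (rule generically_mono) (simp only: gamma_kernel_def xi mult_ac)
  ultimately show ?thesis by (intro exI conjI)
qed

definition monomials :: "nat \<Rightarrow> nat \<Rightarrow> dcfun set" where
  "monomials p d = (\<lambda>\<alpha> m v. \<Prod>i<p. of_int (m i) ^ \<alpha> i) ` ({..<p} \<rightarrow>\<^sub>E {..d})"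

lemma finite_monomials: "finite (monomials p d)"
  unfolding monomials_def by (intro finite_imageI finite_PiE) auto

lemma card_monomials: "card (monomials p d) \<le> (d + 1) ^ p"
proof -
  have "card (monomials p d) \<le> card ({..<p} \<rightarrow>\<^sub>E {..d})"
    unfolding monomials_def by (intro card_image_le finite_PiE) auto
  then show ?thesis by (simp add: card_PiE)
qed

lemma monomials_mono: "d \<le> e \<Longrightarrow> monomials p d \<subseteq> monomials p e"
  unfolding monomials_def by (intro image_mono PiE_mono) auto

lemma monomials_mult:
  assumes "x \<in> monomials p d" "y \<in> monomials p e"
  shows "(\<lambda>m v. x m v * y m v) \<in> monomials p (d + e)"
proof -
  obtain \<alpha> \<beta> where \<alpha>: "\<alpha> \<in> {..<p} \<rightarrow>\<^sub>E {..d}" "x = (\<lambda>m v. \<Prod>i<p. of_int (m i) ^ \<alpha> i)"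
    and \<beta>: "\<beta> \<in> {..<p} \<rightarrow>\<^sub>E {..e}" "y = (\<lambda>m v. \<Prod>i<p. of_int (m i) ^ \<beta> i)"
    using assms by (auto simp: monomials_def)
  have "(\<lambda>m v. x m v * y m v) = (\<lambda>m v. \<Prod>i<p. of_int (m i) ^ (\<lambda>i\<in>{..<p}. \<alpha> i + \<beta> i) i)"
    by (simp add: \<alpha> \<beta> prod.distrib[symmetric] power_add)
  moreover have "(\<lambda>i\<in>{..<p}. \<alpha> i + \<beta> i) \<in> {..<p} \<rightarrow>\<^sub>E {..d + e}"
    using \<alpha>(1) \<beta>(1) by (auto simp: PiE_def Pi_def intro: add_mono)
  ultimately show ?thesis unfolding monomials_def by blast
qed

lemma span_monomials_mult:
  assumes "f \<in> dcfun.span (monomials p d)" "g \<in> dcfun.span (monomials p e)"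
  shows "(\<lambda>m v. f m v * g m v) \<in> dcfun.span (monomials p (d + e))"
proof -
  have x: "(\<lambda>m v. x m v * g m v) \<in> dcfun.span (monomials p (d + e))"
    if "x \<in> monomials p d" for x
    using assms(2)
  proof (induction rule: dcfun.span_induct_alt)
    case base
    have "(\<lambda>m v. x m v * (0 :: dcfun) m v) = 0" by (simp add: fun_eq_iff)
    then show ?case by (simp add: dcfun.span_zero)
  next
    case (step c y z)
    have "(\<lambda>m v. x m v * ((\<lambda>m v. c * y m v) + z) m v) =
        (\<lambda>m v. c * (x m v * y m v)) + (\<lambda>m v. x m v * z m v)"
      by (simp add: fun_eq_iff algebra_simps)
    then show ?case
      using dcfun.span_add[OF dcfun.span_scale[OF dcfun.span_base[OF monomials_mult[OF that step(1)]], of c] step(2)]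
      by simp
  qed
  show ?thesis using assms(1)
  proof (induction rule: dcfun.span_induct_alt)
    case base
    have "(\<lambda>m v. (0 :: dcfun) m v * g m v) = 0" by (simp add: fun_eq_iff)
    then show ?case by (simp add: dcfun.span_zero)
  next
    case (step c y z)
    have "(\<lambda>m v. ((\<lambda>m v. c * y m v) + z) m v * g m v) =
        (\<lambda>m v. c * (y m v * g m v)) + (\<lambda>m v. z m v * g m v)"
      by (simp add: fun_eq_iff algebra_simps)
    then show ?case
      using dcfun.span_add[OF dcfun.span_scale[OF x[OF step(1)], of c] step(2)] by simp
  qed
qed

text \<open>
  Polynomials of total degree at most \<open>d\<close> in \<open>p\<close> variables lie in a space of dimension at most
  \<open>(d + 1) ^ p\<close>, which is the bound of \<open>card_monomials\<close>.
\<close>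

lemma degree_le_span_monomials: "degree_le p d f \<Longrightarrow> f \<in> dcfun.span (monomials p d)"
proof (induction rule: degree_le.induct)
  case (const c)
  have "(\<lambda>m v. 1) \<in> monomials p 0"
    unfolding monomials_def
    by (rule image_eqI[of _ _ "\<lambda>i\<in>{..<p}. 0"]) simp_all
  from dcfun.span_scale[OF dcfun.span_base[OF this], of c] show ?case by simp
next
  case (coord i)
  have "(\<Prod>j<p. of_int (m j) ^ (\<lambda>j\<in>{..<p}. if j = i then 1 else 0) j) = (of_int (m i) :: complex)"
    for m :: "nat \<Rightarrow> int"
  proof -
    have "(\<Prod>j<p. of_int (m j) ^ (\<lambda>j\<in>{..<p}. if j = i then 1 else 0) j) =
        (\<Prod>j<p. if j = i then of_int (m j) else (1 :: complex))"
      by (intro prod.cong) auto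
    then show ?thesis using coord by simp
  qed
  then have "(\<lambda>m v. of_int (m i)) \<in> monomials p 1"
    unfolding monomials_def
    by (intro image_eqI[of _ _ "\<lambda>j\<in>{..<p}. if j = i then 1 else 0"]) (simp_all only:, auto)
  then show ?case by (rule dcfun.span_base)
next
  case (add d f g)
  have "(\<lambda>m v. f m v + g m v) = f + g" by (simp add: fun_eq_iff)
  then show ?case using dcfun.span_add[OF add.IH] by simp
next
  case (mult d f e g)
  from mult.IH show ?case by (rule span_monomials_mult)
next
  case (mono d f e)
  show ?case
    using subsetD[OF dcfun.span_mono[OF monomials_mono[OF mono.hyps(2)]] mono.IH] .
qed

text \<open>
  The topological hypothesis concerns a space without coordinates: there are no continuous
  variables, and \<open>U\<close> contains at most the empty tuple.
\<close>

locale gamma_product_term =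
  fixes p r :: nat and U :: "(nat \<Rightarrow> complex) set" and F :: dcfun
    and num den :: "((nat \<Rightarrow> int) \<times> complex) list" and \<xi> :: "nat \<Rightarrow> complex"
    and Q :: dcfun and degQ :: nat
  assumes open_domain': "openin (complex_space 0) U"
    and xi_nonzero: "\<And>i. i \<in> {1..r} \<Longrightarrow> \<xi> i \<noteq> 0"
    and degQ: "degree_le p degQ Q"
    and term_eq: "\<And>m v. m \<in> int_points p \<Longrightarrow> v \<in> U \<Longrightarrow>
      F m v = Q m v * gamma_kernel p num den r \<xi> 0 m"
begin

abbreviation (input) "kern \<equiv> gamma_kernel p num den r \<xi>"
abbreviation (input) "growth \<equiv> kernel_growth p num den"

lemma kernel_step:
  assumes "t < p" "\<sigma> = 0 \<or> \<sigma> = 1"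
  obtains h where "degree_le p growth h" "h \<noteq> (\<lambda>m v. 0)"
    "generically p 0 U (\<lambda>m v. kern \<nu> (m(t := m t - \<sigma>)) = h m v * kern (Suc \<nu>) m)"
proof -
  have "\<exists>h. degree_le p growth h \<and> h \<noteq> (\<lambda>m v. 0) \<and>
    generically p 0 U (\<lambda>m v. kern \<nu> (m(t := m t - \<sigma>)) = h m v * kern (Suc \<nu>) m)"
    by (rule gamma_kernel_step[OF assms]) (rule xi_nonzero)
  then show ?thesis using that by (elim exE conjE)
qed

text \<open>
  The term and its backward shift are both polynomial multiples of the first kernel, so each
  times the other polynomial gives the same function.
\<close>

lemma first_order: "first_order_system p 0 U F"
proof
  show "openin (complex_space 0) U" by (rule open_domain')
next
  fix t assume t: "t < p"
  let ?s = "\<lambda>f m v. f (m(t := m t + 1)) v"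
  show "\<exists>a b. polyfun p 0 a \<and> polyfun p 0 b \<and> a \<noteq> (\<lambda>m v. 0) \<and> b \<noteq> (\<lambda>m v. 0) \<and>
      generically p 0 U (\<lambda>m v. a m v * F (m(t := m t + 1)) v = b m v * F m v)"
  proof (cases "Q = (\<lambda>m v. 0)")
    case True
    then have "1 * F (m(t := m t + 1)) v = 1 * F m v" if "m \<in> int_points p" "v \<in> U" for m v
      using term_eq[OF that] term_eq[OF int_points_upd[OF that(1) t] that(2)] by simp
    then show ?thesis
      by (intro exI[of _ "\<lambda>m v. 1"] conjI polyfun.const generically_always) (auto simp: fun_eq_iff)
  next
    case False
    obtain h where h: "degree_le p growth h" "h \<noteq> (\<lambda>m v. 0)"
      "generically p 0 U (\<lambda>m v. kern 0 (m(t := m t - 0)) = h m v * kern (Suc 0) m)"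
      by (rule kernel_step[OF t disjI1[OF refl]])
    obtain g where g: "degree_le p growth g" "g \<noteq> (\<lambda>m v. 0)"
      "generically p 0 U (\<lambda>m v. kern 0 (m(t := m t - 1)) = g m v * kern (Suc 0) m)"
      by (rule kernel_step[OF t disjI2[OF refl]])
    let ?a = "\<lambda>m v. Q m v * ?s g m v" and ?b = "\<lambda>m v. ?s Q m v * ?s h m v"
    note poly = degree_le_polyfun[OF degQ, of 0] degree_le_polyfun[OF h(1), of 0] degree_le_polyfun[OF g(1), of 0]
    have "polyfun p 0 ?a" "polyfun p 0 ?b"
      by - (intro polyfun.mult polyfun_shift poly)+
    moreover have "?a \<noteq> (\<lambda>m v. 0)"
      by (rule polyfun_mult_nonzero[OF poly(1) polyfun_shift[OF poly(3)] False shift_nonzero[OF g(2)]])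
    moreover have "?b \<noteq> (\<lambda>m v. 0)"
      by (rule polyfun_mult_nonzero[OF polyfun_shift[OF poly(1)] polyfun_shift[OF poly(2)]
          shift_nonzero[OF False] shift_nonzero[OF h(2)]])
    moreover have "generically p 0 U (\<lambda>m v. ?a m v * F (m(t := m t + 1)) v = ?b m v * F m v)"
      using generically_conj[OF generically_shift[OF h(3) t, of 1] generically_shift[OF g(3) t, of 1]]
    proof (rule generically_mono)
      fix m v assume m: "m \<in> int_points p" "v \<in> U"
      let ?m = "m(t := m t + 1)"
      assume "kern 0 (?m(t := ?m t - 0)) = h ?m v * kern (Suc 0) ?m \<and>
        kern 0 (?m(t := ?m t - 1)) = g ?m v * kern (Suc 0) ?m"
      then have "kern 0 ?m = h ?m v * kern (Suc 0) ?m" "kern 0 m = g ?m v * kern (Suc 0) ?m"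
        by simp_all
      moreover have "F m v = Q m v * kern 0 m" "F ?m v = Q ?m v * kern 0 ?m"
        using term_eq m int_points_upd[OF m(1) t] by auto
      ultimately show "?a m v * F ?m v = ?b m v * F m v" by algebra
    qed
    ultimately show ?thesis by (intro exI[of _ ?a] exI[of _ ?b] conjI)
  qed
qed simp_all

sublocale first_order_system p 0 U F by (rule first_order)

text \<open>
  The filtration behind Sister Celine's method: polynomials of degree growing linearly in \<open>\<nu>\<close>, times the \<open>\<nu>\<close>-th
  kernel. The slope \<open>growth + 1\<close> leaves room for the growth of the kernel and for multiplication
  by variables.
\<close>

definition kernel_rep :: "nat \<Rightarrow> dcfun \<Rightarrow> bool" where
  "kernel_rep \<nu> G \<longleftrightarrow> (\<exists>f. degree_le p (degQ + \<nu> * (growth + 1)) f \<and>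
     generically p 0 U (\<lambda>m v. G m v = f m v * kern \<nu> m))"

lemma kernel_shift_rep:
  assumes "generically p 0 U (\<lambda>m v. G m v = f m v * kern \<nu> m)" "degree_le p d f"
    "t < p" "\<sigma> = 0 \<or> \<sigma> = 1"
  obtains f' where "degree_le p (d + growth) f'"
    "generically p 0 U (\<lambda>m v. G (m(t := m t - \<sigma>)) v = f' m v * kern (Suc \<nu>) m)"
proof -
  obtain h where h: "degree_le p growth h"
    "generically p 0 U (\<lambda>m v. kern \<nu> (m(t := m t - \<sigma>)) = h m v * kern (Suc \<nu>) m)"
    by (rule kernel_step[OF assms(3,4)])
  have "degree_le p (d + growth) (\<lambda>m v. f (m(t := m t - \<sigma>)) v * h m v)"
    by (intro degree_le.mult degree_le_back_shift assms(2) h(1))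
  moreover have "generically p 0 U (\<lambda>m v. G (m(t := m t - \<sigma>)) v =
      f (m(t := m t - \<sigma>)) v * h m v * kern (Suc \<nu>) m)"
    using generically_conj[OF generically_shift[OF assms(1,3), of "- \<sigma>"] h(2)]
    by (rule generically_mono) simp
  ultimately show ?thesis by (rule that)
qed

lemma kernel_rep_delta_step:
  assumes "kernel_rep \<nu> G" "t < p + 0"
  shows "kernel_rep (Suc \<nu>) (delta p t G)" "kernel_rep (Suc \<nu>) (step p t G)"
    "kernel_rep (\<nu> + 2) (\<lambda>m v. coord_value p m v t * G m v)"
proof -
  have t: "t < p" using assms(2) by simp
  let ?d = "degQ + \<nu> * (growth + 1)"
  obtain f where f: "degree_le p ?d f"
    "generically p 0 U (\<lambda>m v. G m v = f m v * kern \<nu> m)"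
    using assms(1) by (auto simp: kernel_rep_def)
  obtain f0 where f0: "degree_le p (?d + growth) f0"
    "generically p 0 U (\<lambda>m v. G (m(t := m t - 0)) v = f0 m v * kern (Suc \<nu>) m)"
    by (rule kernel_shift_rep[OF f(2,1) t disjI1[OF refl]])
  obtain f1 where f1: "degree_le p (?d + growth) f1"
    "generically p 0 U (\<lambda>m v. G (m(t := m t - 1)) v = f1 m v * kern (Suc \<nu>) m)"
    by (rule kernel_shift_rep[OF f(2,1) t disjI2[OF refl]])
  have le: "?d + growth \<le> degQ + Suc \<nu> * (growth + 1)" by simp
  show "kernel_rep (Suc \<nu>) (step p t G)"
    unfolding kernel_rep_def using degree_le.mono[OF f1(1) le] f1(2) t
    by (intro exI[of _ f1]) (simp add: step_def)
  have "degree_le p (degQ + Suc \<nu> * (growth + 1)) (\<lambda>m v. f1 m v + (-1) * f0 m v)"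
    using degree_le.mult[OF degree_le.const[of p "-1"] f0(1)]
    by (intro degree_le.mono[OF _ le] degree_le.add f1(1)) (simp only: add_0)
  moreover have "generically p 0 U (\<lambda>m v. delta p t G m v = (f1 m v + (-1) * f0 m v) * kern (Suc \<nu>) m)"
    using generically_conj[OF f0(2) f1(2)]
    by (rule generically_mono) (use t in \<open>simp add: delta_def algebra_simps\<close>)
  ultimately show "kernel_rep (Suc \<nu>) (delta p t G)"
    unfolding kernel_rep_def by (intro exI[of _ "\<lambda>m v. f1 m v + (-1) * f0 m v"] conjI)
  obtain f2 where f2: "degree_le p (?d + growth + growth) f2"
    "generically p 0 U (\<lambda>m v. G (m(t := m t - 0)) v = f2 m v * kern (Suc (Suc \<nu>)) m)"
    by (rule kernel_shift_rep[OF _ f0(1) t disjI1[OF refl], of G "Suc \<nu>"]) (use f0(2) in simp_all)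
  have "degree_le p (degQ + (\<nu> + 2) * (growth + 1)) (\<lambda>m v. of_int (m t) * f2 m v)"
    by (rule degree_le.mono[OF degree_le.mult[OF degree_le.coord[OF t] f2(1)]]) simp
  moreover have "generically p 0 U (\<lambda>m v. coord_value p m v t * G m v =
      of_int (m t) * f2 m v * kern (\<nu> + 2) m)"
    using f2(2) by (rule generically_mono) (use t in \<open>simp add: coord_value_def\<close>)
  ultimately show "kernel_rep (\<nu> + 2) (\<lambda>m v. coord_value p m v t * G m v)"
    unfolding kernel_rep_def by (intro exI[of _ "\<lambda>m v. of_int (m t) * f2 m v"] conjI)
qed

lemma kernel_rep_Suc:
  assumes "0 < p" "kernel_rep \<nu> G"
  shows "kernel_rep (Suc \<nu>) G"
proof -
  obtain f where f: "degree_le p (degQ + \<nu> * (growth + 1)) f"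
    "generically p 0 U (\<lambda>m v. G m v = f m v * kern \<nu> m)"
    using assms(2) by (auto simp: kernel_rep_def)
  obtain f0 where f0: "degree_le p (degQ + \<nu> * (growth + 1) + growth) f0"
    "generically p 0 U (\<lambda>m v. G (m(0 := m 0 - 0)) v = f0 m v * kern (Suc \<nu>) m)"
    by (rule kernel_shift_rep[OF f(2,1) assms(1) disjI1[OF refl]])
  have "degree_le p (degQ + Suc \<nu> * (growth + 1)) f0"
    by (rule degree_le.mono[OF f0(1)]) simp
  then show ?thesis using f0(2) by (auto simp: kernel_rep_def)
qed

lemma kernel_rep_self: "kernel_rep 0 F"
  unfolding kernel_rep_def
  by (rule exI[of _ Q]) (use degQ term_eq in \<open>auto intro: generically_always\<close>)

lemma kernel_rep_dependent:
  assumes "finite I" "card I > (degQ + growth + 2) ^ p * (\<nu> + 1) ^ (p + 0)"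
    and "\<And>i. i \<in> I \<Longrightarrow> kernel_rep \<nu> (G i)"
  shows "\<exists>c. (\<exists>i\<in>I. c i \<noteq> 0) \<and> generically p 0 U (\<lambda>m v. (\<Sum>i\<in>I. c i * G i m v) = 0)"
proof -
  let ?d = "degQ + \<nu> * (growth + 1)"
  have "\<forall>i\<in>I. \<exists>f. degree_le p ?d f \<and> generically p 0 U (\<lambda>m v. G i m v = f m v * kern \<nu> m)"
    using assms(3) by (auto simp: kernel_rep_def)
  then have "\<exists>f. \<forall>i\<in>I. degree_le p ?d (f i) \<and>
      generically p 0 U (\<lambda>m v. G i m v = f i m v * kern \<nu> m)" by (rule bchoice)
  then obtain f where f0: "\<forall>i\<in>I. degree_le p ?d (f i) \<and>
      generically p 0 U (\<lambda>m v. G i m v = f i m v * kern \<nu> m)" ..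
  have f: "degree_le p ?d (f i)" "generically p 0 U (\<lambda>m v. G i m v = f i m v * kern \<nu> m)"
    if "i \<in> I" for i using bspec[OF f0 that] by simp_all
  have "card (monomials p ?d) \<le> (?d + 1) ^ p" by (rule card_monomials)
  also have "\<dots> \<le> ((degQ + growth + 2) * (\<nu> + 1)) ^ p"
    by (intro power_mono) (auto simp: algebra_simps)
  also have "\<dots> < card I" using assms(2) by (simp only: power_mult_distrib add_0_right)
  finally have "card (monomials p ?d) < card I" .
  then obtain c where c: "\<exists>i\<in>I. c i \<noteq> 0" "\<forall>m v. (\<Sum>i\<in>I. c i * f i m v) = 0"
    using dependent_family[OF assms(1) finite_monomials, of p ?d f] degree_le_span_monomials f(1) by blast
  have "generically p 0 U (\<lambda>m v. (\<Sum>i\<in>I. c i * G i m v) = 0)"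
    using generically_ball[OF assms(1) f(2)]
  proof (rule generically_mono)
    fix m v assume "\<forall>i\<in>I. G i m v = f i m v * kern \<nu> m"
    then have "(\<Sum>i\<in>I. c i * G i m v) = (\<Sum>i\<in>I. c i * f i m v) * kern \<nu> m"
      by (simp add: sum_distrib_right mult.assoc)
    then show "(\<Sum>i\<in>I. c i * G i m v) = 0" using c(2) by simp
  qed
  then show ?thesis using c(1) by (intro exI[of _ c] conjI)
qed

theorem telescoper_of_gamma_product:
  assumes "t0 < p"
  shows "\<exists>d N. (\<exists>b\<le>N. d b \<noteq> 0) \<and> telescoping ({..<p + 0} - {t0})
    (\<lambda>m v. \<Sum>b\<le>N. poly (d b) (coord_value p m v t0) * (step p t0 ^^ b) F m v)"
proof (rule telescoper_of_slow_filtration[where rep = kernel_rep and C = "(degQ + growth + 2) ^ p"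
      and ?\<nu>0.0 = 0])
  show "\<exists>c. (\<exists>i\<in>I. c i \<noteq> 0) \<and> generically p 0 U (\<lambda>m v. (\<Sum>i\<in>I. c i * G i m v) = 0)"
    if "finite I" "card I > (degQ + growth + 2) ^ p * (\<nu> + 1) ^ (p + 0)" "\<And>i. i \<in> I \<Longrightarrow> kernel_rep \<nu> (G i)"
    for \<nu> and I :: "(nat list \<times> nat \<times> nat) set" and G
    using that by (rule kernel_rep_dependent)
  show "kernel_rep (Suc \<nu>) G" if "kernel_rep \<nu> G" for \<nu> G
    by (rule kernel_rep_Suc[OF _ that]) (use assms in simp)
qed (use assms kernel_rep_self kernel_rep_delta_step in \<open>auto simp del: add_2_eq_Suc'\<close>)

end

section \<open>Recurrences and differential equations\<close>

lemma shift_power: "(shift i ^^ l) F m v = F (m(i := m i + int l)) v"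
  by (induction l arbitrary: m) (simp_all add: shift_def add_ac)

lemma step_power_discrete:
  "t < p \<Longrightarrow> (step p t ^^ b) F m v = F (m(t := m t - int b)) v"
  by (induction b arbitrary: m) (simp_all add: step_def algebra_simps)

context first_order_system
begin

lemma telescoping_shift_power:
  assumes "telescoping T H" "T \<subseteq> {..<p + q}" "i < p" "i \<notin> T"
  shows "telescoping T (\<lambda>m v. H (m(i := m i + int N)) v)"
proof (induction N)
  case 0
  show ?case using assms(1) by simp
next
  case (Suc N)
  from telescoping_shift[OF Suc.IH assms(2-4)] show ?case
    by (simp only: fun_upd_same fun_upd_upd of_nat_Suc add_ac)
qed

text \<open>
  The dimension count yields an operator in the backward shift. Shifting everything forward by its order \<open>N\<close>
  turns it into a recurrence operator, whose coefficients are translated by \<open>N\<close> and taken in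
  reverse order.
\<close>

lemma telescoping_forward_shifts:
  assumes "telescoping T (\<lambda>m v. \<Sum>b\<le>N. poly (d b) (coord_value p m v t0) * (step p t0 ^^ b) F m v)"
    and "T = {..<p + q} - {t0}" "t0 < p" "\<exists>b\<le>N. d b \<noteq> 0"
  shows "\<exists>c. (\<exists>l\<le>N. c l \<noteq> 0) \<and>
    telescoping T (\<lambda>m v. \<Sum>l\<le>N. poly (c l) (coord_value p m v t0) * (shift t0 ^^ l) F m v)"
proof -
  define c where "c = (\<lambda>l. d (N - l) \<circ>\<^sub>p [:of_nat N, 1:])"
  obtain b where b: "b \<le> N" "d b \<noteq> 0" using assms(4) by blast
  then have "c (N - b) \<noteq> 0" using pcompose_eq_0[of "d b" "[:of_nat N, 1:]"] by (auto simp: c_def)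
  then have "\<exists>l\<le>N. c l \<noteq> 0" by (intro exI[of _ "N - b"]) simp
  moreover have "telescoping T (\<lambda>m v. \<Sum>b\<le>N. poly (d b) (coord_value p (m(t0 := m t0 + int N)) v t0) *
      (step p t0 ^^ b) F (m(t0 := m t0 + int N)) v)"
    by (rule telescoping_shift_power[OF assms(1)]) (use assms(2,3) in auto)
  moreover have "(\<Sum>b\<le>N. poly (d b) (coord_value p (m(t0 := m t0 + int N)) v t0) *
      (step p t0 ^^ b) F (m(t0 := m t0 + int N)) v) =
      (\<Sum>l\<le>N. poly (c l) (coord_value p m v t0) * (shift t0 ^^ l) F m v)" for m v
  proof (rule sum.reindex_bij_witness[of _ "\<lambda>l. N - l" "\<lambda>b. N - b"])
    fix b assume "b \<in> {..N}"
    then show "poly (c (N - b)) (coord_value p m v t0) * (shift t0 ^^ (N - b)) F m v =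
      poly (d b) (coord_value p (m(t0 := m t0 + int N)) v t0) *
      (step p t0 ^^ b) F (m(t0 := m t0 + int N)) v"
      using assms(3) by (simp add: c_def poly_pcompose coord_value_def shift_power
          step_power_discrete of_nat_diff add_diff_eq add.commute)
  qed auto
  ultimately show ?thesis by (intro exI[of _ c]) simp
qed

end

lemma certified_recurrence:
  assumes "first_order_system (Suc r) s U F"
    and "\<exists>d N. (\<exists>b\<le>N. d b \<noteq> 0) \<and>
      first_order_system.telescoping (Suc r) s U F ({..<Suc r + s} - {0})
        (\<lambda>m v. \<Sum>b\<le>N. poly (d b) (coord_value (Suc r) m v 0) * (step (Suc r) 0 ^^ b) F m v)"
  shows "\<exists>(L :: nat) (c :: nat \<Rightarrow> complex poly) (R :: nat \<Rightarrow> ratfun) (S :: nat \<Rightarrow> ratfun).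
     (\<exists>l\<le>L. c l \<noteq> 0) \<and>
     (\<forall>i\<in>{1..r}. is_ratfun (Suc r) s (R i)) \<and>
     (\<forall>j\<in>{..<s}. is_ratfun (Suc r) s (S j)) \<and>
     (\<forall>m\<in>int_points (Suc r). \<forall>v\<in>U.
        (\<forall>i\<in>{1..r}. no_pole (Suc r) (R i) m v \<and> no_pole (Suc r) (R i) (m(i := m i + 1)) v) \<and>
        (\<forall>j\<in>{..<s}. no_pole (Suc r) (S j) m v) \<longrightarrow>
        (\<Sum>l\<le>L. poly (c l) (of_int (m 0)) * (shift 0 ^^ l) F m v) =
        (\<Sum>i\<in>{1..r}. fdiff i (ratfun_mult (Suc r) (R i) F) m v) +
        (\<Sum>j\<in>{..<s}. partial_deriv j (ratfun_mult (Suc r) (S j) F) m v))"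
proof -
  interpret first_order_system "Suc r" s U F by fact
  define T where "T = {..<Suc r + s} - {0}"
  obtain d N where d_conj: "(\<exists>b\<le>N. d b \<noteq> 0) \<and> telescoping T
      (\<lambda>m v. \<Sum>b\<le>N. poly (d b) (coord_value (Suc r) m v 0) * (step (Suc r) 0 ^^ b) F m v)"
    using assms(2) unfolding T_def by (elim exE)
  note d = conjunct1[OF d_conj] conjunct2[OF d_conj]
  obtain c where c_conj: "(\<exists>l\<le>N. c l \<noteq> 0) \<and> telescoping T
      (\<lambda>m v. \<Sum>l\<le>N. poly (c l) (coord_value (Suc r) m v 0) * (shift 0 ^^ l) F m v)"
    using telescoping_forward_shifts[OF d(2) T_def zero_less_Suc d(1)] by (elim exE)
  note c = conjunct1[OF c_conj] conjunct2[OF c_conj]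
  let ?H = "\<lambda>m v. \<Sum>l\<le>N. poly (c l) (coord_value (Suc r) m v 0) * (shift 0 ^^ l) F m v"
  obtain e R where e: "e \<noteq> 0" and R: "\<forall>t\<in>T. is_ratfun (Suc r) s (R t)"
    and identity: "\<forall>m\<in>int_points (Suc r). \<forall>v\<in>U.
      (\<forall>t\<in>T. no_pole (Suc r) (R t) m v \<and> (t < Suc r \<longrightarrow> no_pole (Suc r) (R t) (m(t := m t + 1)) v)) \<longrightarrow>
      poly e (coord_value (Suc r) m v 0) * ?H m v =
        (\<Sum>t\<in>T \<inter> {..<Suc r}. fdiff t (ratfun_mult (Suc r) (R t) F) m v) +
        (\<Sum>t\<in>T - {..<Suc r}. partial_deriv (t - Suc r) (ratfun_mult (Suc r) (R t) F) m v)"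
    using certificates_of_telescoping[OF c(2) T_def trans_less_add1[OF zero_less_Suc]]
    by (elim exE conjE)
  have T1: "T \<inter> {..<Suc r} = {1..r}" by (auto simp: T_def)
  have T2: "T - {..<Suc r} = (\<lambda>j. Suc r + j) ` {..<s}"
  proof (intro equalityI subsetI)
    fix t assume "t \<in> T - {..<Suc r}"
    then show "t \<in> (\<lambda>j. Suc r + j) ` {..<s}"
      by (intro image_eqI[of _ _ "t - Suc r"]) (auto simp: T_def)
  qed (auto simp: T_def)
  have sum_T2: "(\<Sum>t\<in>T - {..<Suc r}. f t) = (\<Sum>j\<in>{..<s}. f (Suc r + j))" for f :: "nat \<Rightarrow> complex"
    unfolding T2 by (rule sum.reindex[unfolded comp_def]) (rule inj_onI, simp)
  show ?thesis
  proof (rule exI[of _ N], rule exI[of _ "\<lambda>l. e * c l"], rule exI[of _ R],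
      rule exI[of _ "\<lambda>j. R (Suc r + j)"], intro conjI ballI impI)
    show "\<exists>l\<le>N. e * c l \<noteq> 0" using c(1) e by simp
    show "is_ratfun (Suc r) s (R i)" if "i \<in> {1..r}" for i
      using that R by (auto simp: T_def)
    show "is_ratfun (Suc r) s (R (Suc r + j))" if "j \<in> {..<s}" for j
      using that R by (auto simp: T_def)
  next
    fix m v assume m: "m \<in> int_points (Suc r)" and v: "v \<in> U"
      and np: "(\<forall>i\<in>{1..r}. no_pole (Suc r) (R i) m v \<and> no_pole (Suc r) (R i) (m(i := m i + 1)) v) \<and>
        (\<forall>j\<in>{..<s}. no_pole (Suc r) (R (Suc r + j)) m v)"
    have "\<forall>t\<in>T. no_pole (Suc r) (R t) m v \<and> (t < Suc r \<longrightarrow> no_pole (Suc r) (R t) (m(t := m t + 1)) v)"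
    proof
      fix t assume t: "t \<in> T"
      show "no_pole (Suc r) (R t) m v \<and> (t < Suc r \<longrightarrow> no_pole (Suc r) (R t) (m(t := m t + 1)) v)"
      proof (cases "t < Suc r")
        case True
        then have "t \<in> {1..r}" using t T1 by blast
        then show ?thesis using np by blast
      next
        case False
        with t have "t \<in> T - {..<Suc r}" by simp
        then obtain j where j: "t = Suc r + j" "j \<in> {..<s}" unfolding T2 by (rule imageE)
        from bspec[OF conjunct2[OF np] j(2)] have "no_pole (Suc r) (R t) m v" unfolding j(1) .
        with False show ?thesis by (simp only: simp_thms)
      qed
    qed
    from mp[OF bspec[OF bspec[OF identity m] v] this] have "poly e (coord_value (Suc r) m v 0) * ?H m v =
        (\<Sum>t\<in>T \<inter> {..<Suc r}. fdiff t (ratfun_mult (Suc r) (R t) F) m v) +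
        (\<Sum>t\<in>T - {..<Suc r}. partial_deriv (t - Suc r) (ratfun_mult (Suc r) (R t) F) m v)"
      .
    then show "(\<Sum>l\<le>N. poly (e * c l) (of_int (m 0)) * (shift 0 ^^ l) F m v) =
        (\<Sum>i\<in>{1..r}. fdiff i (ratfun_mult (Suc r) (R i) F) m v) +
        (\<Sum>j\<in>{..<s}. partial_deriv j (ratfun_mult (Suc r) (R (Suc r + j)) F) m v)"
      unfolding T1 sum_T2 by (simp add: coord_value_def sum_distrib_left mult.assoc)
  qed
qed

lemma certified_differential_equation:
  assumes "first_order_system r (Suc s) U F"
    and "\<exists>d N. (\<exists>b\<le>N. d b \<noteq> 0) \<and>
      first_order_system.telescoping r (Suc s) U F ({..<r + Suc s} - {r})
        (\<lambda>m v. \<Sum>b\<le>N. poly (d b) (coord_value r m v r) * (step r r ^^ b) F m v)"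
  shows "\<exists>(L :: nat) (c :: nat \<Rightarrow> complex poly) (R :: nat \<Rightarrow> ratfun) (S :: nat \<Rightarrow> ratfun).
     (\<exists>l\<le>L. c l \<noteq> 0) \<and>
     (\<forall>i\<in>{..<r}. is_ratfun r (Suc s) (R i)) \<and>
     (\<forall>j\<in>{1..s}. is_ratfun r (Suc s) (S j)) \<and>
     (\<forall>m\<in>int_points r. \<forall>v\<in>U.
        (\<forall>i\<in>{..<r}. no_pole r (R i) m v \<and> no_pole r (R i) (m(i := m i + 1)) v) \<and>
        (\<forall>j\<in>{1..s}. no_pole r (S j) m v) \<longrightarrow>
        (\<Sum>l\<le>L. poly (c l) (v 0) * (partial_deriv 0 ^^ l) F m v) =
        (\<Sum>i\<in>{..<r}. fdiff i (ratfun_mult r (R i) F) m v) +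
        (\<Sum>j\<in>{1..s}. partial_deriv j (ratfun_mult r (S j) F) m v))"
proof -
  interpret first_order_system r "Suc s" U F by fact
  define T where "T = {..<r + Suc s} - {r}"
  have step: "step r r = partial_deriv 0" by (simp add: step_def fun_eq_iff)
  obtain c N where c_conj: "(\<exists>b\<le>N. c b \<noteq> 0) \<and> telescoping T
      (\<lambda>m v. \<Sum>b\<le>N. poly (c b) (coord_value r m v r) * (partial_deriv 0 ^^ b) F m v)"
    using assms(2) unfolding T_def step by (elim exE)
  note c = conjunct1[OF c_conj] conjunct2[OF c_conj]
  let ?H = "\<lambda>m v. \<Sum>b\<le>N. poly (c b) (coord_value r m v r) * (partial_deriv 0 ^^ b) F m v"
  obtain e R where e: "e \<noteq> 0" and R: "\<forall>t\<in>T. is_ratfun r (Suc s) (R t)"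
    and identity: "\<forall>m\<in>int_points r. \<forall>v\<in>U.
      (\<forall>t\<in>T. no_pole r (R t) m v \<and> (t < r \<longrightarrow> no_pole r (R t) (m(t := m t + 1)) v)) \<longrightarrow>
      poly e (coord_value r m v r) * ?H m v =
        (\<Sum>t\<in>T \<inter> {..<r}. fdiff t (ratfun_mult r (R t) F) m v) +
        (\<Sum>t\<in>T - {..<r}. partial_deriv (t - r) (ratfun_mult r (R t) F) m v)"
    using certificates_of_telescoping[OF c(2) T_def less_add_same_cancel1[THEN iffD2, OF zero_less_Suc]]
    by (elim exE conjE)
  have T1: "T \<inter> {..<r} = {..<r}" by (auto simp: T_def)
  have T2: "T - {..<r} = (\<lambda>j. r + j) ` {1..s}"
  proof (intro equalityI subsetI)
    fix t assume "t \<in> T - {..<r}"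
    then show "t \<in> (\<lambda>j. r + j) ` {1..s}"
      by (intro image_eqI[of _ _ "t - r"]) (auto simp: T_def)
  qed (auto simp: T_def)
  have sum_T2: "(\<Sum>t\<in>T - {..<r}. f t) = (\<Sum>j\<in>{1..s}. f (r + j))" for f :: "nat \<Rightarrow> complex"
    unfolding T2 by (rule sum.reindex[unfolded comp_def]) (rule inj_onI, simp)
  show ?thesis
  proof (rule exI[of _ N], rule exI[of _ "\<lambda>l. e * c l"], rule exI[of _ R],
      rule exI[of _ "\<lambda>j. R (r + j)"], intro conjI ballI impI)
    show "\<exists>l\<le>N. e * c l \<noteq> 0" using c(1) e by simp
    show "is_ratfun r (Suc s) (R i)" if "i \<in> {..<r}" for i
      using that R by (auto simp: T_def)
    show "is_ratfun r (Suc s) (R (r + j))" if "j \<in> {1..s}" for j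
      using that R by (auto simp: T_def)
  next
    fix m v assume m: "m \<in> int_points r" and v: "v \<in> U"
      and np: "(\<forall>i\<in>{..<r}. no_pole r (R i) m v \<and> no_pole r (R i) (m(i := m i + 1)) v) \<and>
        (\<forall>j\<in>{1..s}. no_pole r (R (r + j)) m v)"
    have "\<forall>t\<in>T. no_pole r (R t) m v \<and> (t < r \<longrightarrow> no_pole r (R t) (m(t := m t + 1)) v)"
    proof
      fix t assume t: "t \<in> T"
      show "no_pole r (R t) m v \<and> (t < r \<longrightarrow> no_pole r (R t) (m(t := m t + 1)) v)"
      proof (cases "t < r")
        case True
        then show ?thesis using np by blast
      next
        case False
        with t have "t \<in> T - {..<r}" by simp
        then obtain j where j: "t = r + j" "j \<in> {1..s}" unfolding T2 by (rule imageE)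
        from bspec[OF conjunct2[OF np] j(2)] have "no_pole r (R t) m v" unfolding j(1) .
        with False show ?thesis by (simp only: simp_thms)
      qed
    qed
    from mp[OF bspec[OF bspec[OF identity m] v] this] have "poly e (coord_value r m v r) * ?H m v =
        (\<Sum>t\<in>T \<inter> {..<r}. fdiff t (ratfun_mult r (R t) F) m v) +
        (\<Sum>t\<in>T - {..<r}. partial_deriv (t - r) (ratfun_mult r (R t) F) m v)"
      .
    then show "(\<Sum>l\<le>N. poly (e * c l) (v 0) * (partial_deriv 0 ^^ l) F m v) =
        (\<Sum>i\<in>{..<r}. fdiff i (ratfun_mult r (R i) F) m v) +
        (\<Sum>j\<in>{1..s}. partial_deriv j (ratfun_mult r (R (r + j)) F) m v)"
      unfolding T1 sum_T2 by (simp add: coord_value_def sum_distrib_left mult.assoc)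
  qed
qed

text \<open>
  The kernel of index zero is the quotient of the products of factorials, written with inverses
  in place of a division.
\<close>

lemma gamma_product_of_proper:
  assumes "openin (complex_space 0) U" "proper_hypergeometric_term r U F"
  obtains num den \<xi> Q degQ where "gamma_product_term (Suc r) r U F num den \<xi> Q degQ"
proof -
  obtain num den :: "((nat \<Rightarrow> int) \<times> complex) list" and Q \<xi> where
    Q: "indets Q \<subseteq> {..<Suc r}" and xi: "\<forall>i\<in>{1..r}. \<xi> i \<noteq> 0"
    and F: "\<forall>m\<in>int_points (Suc r). \<forall>v\<in>U. F m v =
       (\<Prod>(a, c)\<leftarrow>num. cfact (of_int (\<Sum>i<Suc r. a i * m i) + c)) /
       (\<Prod>(a, c)\<leftarrow>den. cfact (of_int (\<Sum>i<Suc r. a i * m i) + c)) *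
       poly_value (Suc r) Q m v * (\<Prod>i=1..r. \<xi> i powi m i)"
    using assms(2) unfolding proper_hypergeometric_term_def by (elim exE conjE)
  have "polyfun (Suc r) 0 (poly_value (Suc r) Q)"
    using Q by (auto simp: polyfun_iff_cmpoly)
  then obtain degQ where degQ: "degree_le (Suc r) degQ (poly_value (Suc r) Q)"
    using polyfun_degree_le by blast
  have inv: "(\<Prod>x\<leftarrow>xs. inverse (f x)) = inverse (\<Prod>x\<leftarrow>xs. f x)" for xs and f :: "'a \<Rightarrow> complex"
    by (induction xs) (simp_all add: inverse_mult_distrib)
  have "gamma_product_term (Suc r) r U F num den \<xi> (poly_value (Suc r) Q) degQ"
  proof
    fix m v assume "m \<in> int_points (Suc r)" "v \<in> U"
    then show "F m v = poly_value (Suc r) Q m v * gamma_kernel (Suc r) num den r \<xi> 0 m"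
      using F by (simp add: gamma_kernel_def affine_form_def inv case_prod_unfold divide_inverse mult_ac
          del: sum.lessThan_Suc)
  qed (use assms(1) xi degQ in auto)
  then show ?thesis by (rule that)
qed

theorem theorem1:
  fixes r s :: nat
  shows
    "(\<forall>(U :: (nat \<Rightarrow> complex) set) (F :: dcfun).
        openin (complex_space s) U \<and>
        (s = 0 \<and> proper_hypergeometric_term r U F \<or> holonomic_hypergeometric_term (Suc r) s U F) \<longrightarrow>
        (\<exists>(L :: nat) (c :: nat \<Rightarrow> complex poly) (R :: nat \<Rightarrow> ratfun) (S :: nat \<Rightarrow> ratfun).
           (\<exists>l\<le>L. c l \<noteq> 0) \<and>
           (\<forall>i\<in>{1..r}. is_ratfun (Suc r) s (R i)) \<and>
           (\<forall>j\<in>{..<s}. is_ratfun (Suc r) s (S j)) \<and>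
           (\<forall>m\<in>int_points (Suc r). \<forall>v\<in>U.
              (\<forall>i\<in>{1..r}. no_pole (Suc r) (R i) m v \<and> no_pole (Suc r) (R i) (m(i := m i + 1)) v) \<and>
              (\<forall>j\<in>{..<s}. no_pole (Suc r) (S j) m v) \<longrightarrow>
              (\<Sum>l\<le>L. poly (c l) (of_int (m 0)) * (shift 0 ^^ l) F m v) =
              (\<Sum>i\<in>{1..r}. fdiff i (ratfun_mult (Suc r) (R i) F) m v) +
              (\<Sum>j\<in>{..<s}. partial_deriv j (ratfun_mult (Suc r) (S j) F) m v))))
     \<and>
     (\<forall>(U :: (nat \<Rightarrow> complex) set) (F :: dcfun).
        openin (complex_space (Suc s)) U \<and>
        holonomic_hypergeometric_term r (Suc s) U F \<longrightarrow>
        (\<exists>(L :: nat) (c :: nat \<Rightarrow> complex poly) (R :: nat \<Rightarrow> ratfun) (S :: nat \<Rightarrow> ratfun).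
           (\<exists>l\<le>L. c l \<noteq> 0) \<and>
           (\<forall>i\<in>{..<r}. is_ratfun r (Suc s) (R i)) \<and>
           (\<forall>j\<in>{1..s}. is_ratfun r (Suc s) (S j)) \<and>
           (\<forall>m\<in>int_points r. \<forall>v\<in>U.
              (\<forall>i\<in>{..<r}. no_pole r (R i) m v \<and> no_pole r (R i) (m(i := m i + 1)) v) \<and>
              (\<forall>j\<in>{1..s}. no_pole r (S j) m v) \<longrightarrow>
              (\<Sum>l\<le>L. poly (c l) (v 0) * (partial_deriv 0 ^^ l) F m v) =
              (\<Sum>i\<in>{..<r}. fdiff i (ratfun_mult r (R i) F) m v) +
              (\<Sum>j\<in>{1..s}. partial_deriv j (ratfun_mult r (S j) F) m v))))"
proof (intro conjI allI impI, goal_cases)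
  case (1 U F)
  then have U: "openin (complex_space s) U" by (rule conjunct1)
  from 1 consider (proper) "s = 0" "proper_hypergeometric_term r U F"
    | (holonomic) "holonomic_hypergeometric_term (Suc r) s U F" by blast
  then show ?case
  proof cases
    case proper
    obtain num den \<xi> Q degQ where "gamma_product_term (Suc r) r U F num den \<xi> Q degQ"
      using gamma_product_of_proper U proper by blast
    then interpret gamma_product_term "Suc r" r U F num den \<xi> Q degQ .
    show ?thesis unfolding proper(1)
      by (rule certified_recurrence[OF first_order telescoper_of_gamma_product]) simp
  next
    case holonomic
    then have "first_order_system (Suc r) s U F"
      by (intro first_order_system_hypergeometric U) (simp add: holonomic_hypergeometric_term_def)
    then interpret first_order_system "Suc r" s U F .
    show ?thesis
      by (rule certified_recurrence[OF first_order_system_axioms telescoper_of_holonomic])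
        (use holonomic in \<open>simp_all add: holonomic_hypergeometric_term_def\<close>)
  qed
next
  case (2 U F)
  then have "first_order_system r (Suc s) U F"
    by (intro first_order_system_hypergeometric) (simp_all add: holonomic_hypergeometric_term_def)
  then interpret first_order_system r "Suc s" U F .
  show ?case
    by (rule certified_differential_equation[OF first_order_system_axioms telescoper_of_holonomic])
      (use 2 in \<open>simp_all add: holonomic_hypergeometric_term_def\<close>)
qed

end
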